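(* Let $1\le d\le D$ and $m\ge1$ be integers. Let $f:\mathbb{R}\to\mathbb{R}$ be a Lipschitz function, let $1\le q<\infty$, and let $U\subseteq\mathbb{R}^m$ be open and bounded. Then, for each $1\le i\le d$, the map $$W^{1,q}(U,M_{D,d}(\mathbb{C}))\to W^{1,q}(U,\mathbb{R}),\qquad A\mapsto f\circ\sigma_i\circ A,$$ is well-defined and continuous, where $\sigma_1(A)\ge\dots\ge\sigma_d(A)$ are the singular values of $A$. The statement remains true if $M_{D,d}(\mathbb{C})$ is replaced by $\mathrm{Herm}(d)$ and the ordered eigenvalues are used instead of the singular values: for each $1\le i\le d$ the map $W^{1,q}(U,\mathrm{Herm}(d))\to W^{1,q}(U,\mathbb{R})$, $A\mapsto f\circ\lambda_i^\uparrow\circ A$, is well-defined and continuous.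
   Context: $M_{D,d}(\mathbb{C})$ is the space of complex $D\times d$ matrices with the Frobenius norm $\|\cdot\|_2$; the singular values of $A$ are the nonnegative square roots of the eigenvalues of $A^*A$ (with multiplicity), ordered decreasingly. $\mathrm{Herm}(d)$ is the space of complex Hermitian $d\times d$ matrices, and $\lambda_1^\uparrow(A)\le\dots\le\lambda_d^\uparrow(A)$ are the increasingly ordered eigenvalues (with multiplicity) of $A\in\mathrm{Herm}(d)$. For a finite-dimensional real Euclidean space $V$, $W^{1,q}(U,V)$ has the norm $\|g\|_{L^q}+\sum_i\|\partial_ig\|_{L^q}$ with $\|g\|_{L^q}=\big\|\,\|g\|_2\,\big\|_{L^q(U)}$. *)

theory Defs
  imports "HOL-Analysis.Analysis" "HOL-Library.Multiset"
    "HOL-Computational_Algebra.Computational_Algebra"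
begin

section \<open>Matrices, eigenvalues and singular values\<close>

text \<open>
  Complex \<open>D \<times> d\<close> matrices are the type \<open>complex ^ 'd ^ 'D\<close> (row index of type \<open>'D\<close>).
  The norm of this type, as a Euclidean space over the reals, is the Frobenius norm.
\<close>

definition conj_transpose :: "complex ^ 'd ^ 'D \<Rightarrow> complex ^ 'D ^ 'd" where
  "conj_transpose A = (\<chi> i j. cnj (A $ j $ i))"

definition Herm :: "(complex ^ 'd ^ 'd) set" where
  "Herm = {A. conj_transpose A = A}"

definition charpoly :: "complex ^ 'd ^ 'd \<Rightarrow> complex poly" where
  "charpoly A = det (\<chi> i j. (if i = j then [:0, 1:] else 0) - [:A $ i $ j:])"

text \<open>
  Only used for Hermitian matrices: their eigenvalues are real, so that \<open>Re\<close> merely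
  changes the type.  \<open>proots\<close> lists the roots with multiplicity.
\<close>

definition real_eigenvalues :: "complex ^ 'd ^ 'd \<Rightarrow> real multiset" where
  "real_eigenvalues A = image_mset Re (proots (charpoly A))"

text \<open>The indices \<open>i\<close> of \<open>eigenvalue_up i\<close> and \<open>singular_value i\<close> run from \<open>1\<close> to \<open>CARD('d)\<close>.\<close>

definition eigenvalue_up :: "nat \<Rightarrow> complex ^ 'd ^ 'd \<Rightarrow> real" where
  "eigenvalue_up i A = sorted_list_of_multiset (real_eigenvalues A) ! (i - 1)"

definition singular_value :: "nat \<Rightarrow> complex ^ 'd ^ 'D \<Rightarrow> real" where
  "singular_value i A =
     rev (sorted_list_of_multiset
       (image_mset sqrt (real_eigenvalues (conj_transpose A ** A)))) ! (i - 1)"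

section \<open>Sobolev spaces\<close>

definition partial_deriv :: "'m \<Rightarrow> (real ^ 'm \<Rightarrow> real) \<Rightarrow> real ^ 'm \<Rightarrow> real" where
  "partial_deriv k \<phi> x = frechet_derivative \<phi> (at x) (axis k 1)"

primrec C_times :: "nat \<Rightarrow> (real ^ 'm \<Rightarrow> real) \<Rightarrow> bool" where
  "C_times 0 \<phi> \<longleftrightarrow> continuous_on UNIV \<phi>"
| "C_times (Suc n) \<phi> \<longleftrightarrow>
     (\<forall>x. \<phi> differentiable (at x)) \<and> (\<forall>k. C_times n (partial_deriv k \<phi>))"

definition test_functions :: "(real ^ 'm) set \<Rightarrow> (real ^ 'm \<Rightarrow> real) set" where
  "test_functions U = {\<phi>. (\<forall>n. C_times n \<phi>) \<and>
     compact (closure {x. \<phi> x \<noteq> 0}) \<and> closure {x. \<phi> x \<noteq> 0} \<subseteq> U}"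

definition locally_integrable_on ::
    "(real ^ 'm) set \<Rightarrow> (real ^ 'm \<Rightarrow> 'v :: euclidean_space) \<Rightarrow> bool" where
  "locally_integrable_on U g \<longleftrightarrow> (\<forall>K. compact K \<and> K \<subseteq> U \<longrightarrow> integrable (lebesgue_on K) g)"

definition has_weak_partial ::
    "(real ^ 'm) set \<Rightarrow> 'm \<Rightarrow> (real ^ 'm \<Rightarrow> 'v :: euclidean_space) \<Rightarrow> (real ^ 'm \<Rightarrow> 'v) \<Rightarrow> bool"
  where
  "has_weak_partial U k g h \<longleftrightarrow>
     locally_integrable_on U g \<and> locally_integrable_on U h \<and>
     (\<forall>\<phi>\<in>test_functions U.
        integral\<^sup>L (lebesgue_on U) (\<lambda>x. partial_deriv k \<phi> x *\<^sub>R g x) =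
        - integral\<^sup>L (lebesgue_on U) (\<lambda>x. \<phi> x *\<^sub>R h x))"

text \<open>Weak derivatives are unique almost everywhere on open \<open>U\<close>; this selects a representative.\<close>

definition weak_partial ::
    "(real ^ 'm) set \<Rightarrow> 'm \<Rightarrow> (real ^ 'm \<Rightarrow> 'v :: euclidean_space) \<Rightarrow> real ^ 'm \<Rightarrow> 'v" where
  "weak_partial U k g = (SOME h. has_weak_partial U k g h)"

definition in_Lq :: "(real ^ 'm) set \<Rightarrow> real \<Rightarrow> (real ^ 'm \<Rightarrow> 'v :: euclidean_space) \<Rightarrow> bool" where
  "in_Lq U q g \<longleftrightarrow> g \<in> borel_measurable (lebesgue_on U) \<and>
     integrable (lebesgue_on U) (\<lambda>x. norm (g x) powr q)"

definition Lq_norm :: "(real ^ 'm) set \<Rightarrow> real \<Rightarrow> (real ^ 'm \<Rightarrow> 'v :: euclidean_space) \<Rightarrow> real" where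
  "Lq_norm U q g = (integral\<^sup>L (lebesgue_on U) (\<lambda>x. norm (g x) powr q)) powr (1 / q)"

text \<open>
  \<open>sobolev U q V\<close> is \<open>W\<^sup>1\<^sup>,\<^sup>q(U, V)\<close> for a real linear subspace \<open>V\<close> of a Euclidean space, with the
  inherited norm.  Its elements are represented by functions; values outside \<open>U\<close> are irrelevant,
  and \<open>sobolev_norm\<close> vanishes on the functions that are zero almost everywhere on \<open>U\<close>.
\<close>

definition sobolev ::
    "(real ^ 'm) set \<Rightarrow> real \<Rightarrow> 'v :: euclidean_space set \<Rightarrow> (real ^ 'm \<Rightarrow> 'v) set" where
  "sobolev U q V = {g. (\<forall>x\<in>U. g x \<in> V) \<and> in_Lq U q g \<and>
     (\<forall>k. \<exists>h. (\<forall>x\<in>U. h x \<in> V) \<and> in_Lq U q h \<and> has_weak_partial U k g h)}"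

definition sobolev_norm ::
    "(real ^ 'm) set \<Rightarrow> real \<Rightarrow> (real ^ 'm \<Rightarrow> 'v :: euclidean_space) \<Rightarrow> real" where
  "sobolev_norm U q g = Lq_norm U q g + (\<Sum>k\<in>UNIV. Lq_norm U q (weak_partial U k g))"

text \<open>
  The elements of the Sobolev spaces being classes modulo equality almost everywhere on \<open>U\<close>,
  an operator on functions is well-defined on these classes if it maps representatives to
  representatives and respects equality almost everywhere.
\<close>

definition sobolev_well_defined ::
    "(real ^ 'm) set \<Rightarrow> real \<Rightarrow> 'v :: euclidean_space set \<Rightarrow> 'w :: euclidean_space set \<Rightarrow>
     ((real ^ 'm \<Rightarrow> 'v) \<Rightarrow> (real ^ 'm \<Rightarrow> 'w)) \<Rightarrow> bool" where
  "sobolev_well_defined U q V W T \<longleftrightarrow>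
     (\<forall>g\<in>sobolev U q V. T g \<in> sobolev U q W) \<and>
     (\<forall>g\<in>sobolev U q V. \<forall>h\<in>sobolev U q V.
        (AE x in lebesgue_on U. g x = h x) \<longrightarrow> (AE x in lebesgue_on U. T g x = T h x))"

definition sobolev_continuous ::
    "(real ^ 'm) set \<Rightarrow> real \<Rightarrow> 'v :: euclidean_space set \<Rightarrow>
     ((real ^ 'm \<Rightarrow> 'v) \<Rightarrow> (real ^ 'm \<Rightarrow> 'w :: euclidean_space)) \<Rightarrow> bool" where
  "sobolev_continuous U q V T \<longleftrightarrow>
     (\<forall>g\<in>sobolev U q V. \<forall>\<epsilon>>0. \<exists>\<delta>>0. \<forall>h\<in>sobolev U q V.
        sobolev_norm U q (\<lambda>x. h x - g x) < \<delta> \<longrightarrow>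
        sobolev_norm U q (\<lambda>x. T h x - T g x) < \<epsilon>)"

end

theory Submission
  imports Defs
begin

text \<open>
  The sum \<open>S\<^sub>k\<close> of the \<open>k\<close> largest eigenvalues, or singular values, is a supremum of linear
  functionals that is attained (Ky Fan), hence convex and Lipschitz; eigenvalues and singular values
  are differences of consecutive \<open>S\<^sub>k\<close>.

  Let \<open>F\<close> be convex and Lipschitz.  Difference quotients of a Sobolev function converge to its weak
  derivative in \<open>L\<^sup>1\<^sub>l\<^sub>o\<^sub>c\<close>.  With positive and with negative increments this shows that both
  \<open>F'(A; \<partial>A)\<close> and \<open>- F'(A; - \<partial>A)\<close> are weak derivatives of \<open>F \<circ> A\<close>, so they agree almost everywhere.
  As \<open>F'\<close> is upper semicontinuous, this two-sidedness makes \<open>F'(A\<^sub>n; \<partial>A\<^sub>n)\<close> converge to \<open>F'(A; \<partial>A)\<close>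
  whenever \<open>A\<^sub>n\<close> and \<open>\<partial>A\<^sub>n\<close> converge almost everywhere, although the general Lipschitz function
  of several variables does not act continuously.

  For the outer function \<open>f = f(0) + \<integral> g\<close> with \<open>g\<close> bounded and Borel, the derivatives are \<open>g(w\<^sub>n) \<partial>w\<^sub>n\<close>.
  They converge weakly to \<open>g(w) \<partial>w\<close> for every such \<open>g\<close>; weak convergence for both \<open>g\<close> and \<open>g\<^sup>2\<close>
  gives \<open>\<integral> (g(w\<^sub>n) - g(w))\<^sup>2 \<bar>\<partial>w\<bar> \<longlonglongrightarrow> 0\<close>, and thus almost everywhere convergence of a
  subsequence, which domination turns into convergence in \<open>L\<^sup>q\<close>.
\<close>

section \<open>Test functions and uniqueness of weak derivatives\<close>

text \<open>Two defects of the data decide the route. Eigenvalues and singular values may fail to be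
  differentiable where they cross, and a Sobolev map may stay on such matrices over a set of
  positive measure, where a gradient that exists almost everywhere says nothing. Directional
  derivatives of convex functions exist everywhere, and their chain rule comes directly from
  increments of the Sobolev map, so smooth approximation never enters. The second defect is that
  \<open>f\<close> need not be a difference of convex functions and that its derivative
  \<open>g\<close> may be discontinuous, so pointwise convergence of the inner functions says
  nothing about \<open>g\<close> composed with them. The chain rule with one fixed Borel
  \<open>g\<close> compensates: integration by parts replaces \<open>g\<close> by its Lipschitz
  primitive. The rule is needed for every bounded Borel function because the square of
  \<open>g\<close> is not tied to \<open>f\<close> at all. Pointwise convergence is available along
  subsequences only, which suffices because the limits are identified beforehand.\<close>

text \<open>A monotone class argument: Dynkin's lemma carries \<open>P\<close> from open sets to
  Borel sets; simple functions and bounded limits do the rest. Only uniformly bounded pointwise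
  limits are asked for, since the instances of \<open>lim\<close> are proved by dominated
  convergence.\<close>

lemma bounded_borel_induct:
  fixes g :: "'a::topological_space \<Rightarrow> real"
  assumes op: "\<And>S. open S \<Longrightarrow> P (indicator S)"
    and lin: "\<And>a b f g. P f \<Longrightarrow> P g \<Longrightarrow> P (\<lambda>x. a * f x + b * g x)"
    and lim: "\<And>f g C. (\<And>i::nat. P (f i)) \<Longrightarrow> (\<And>i x. \<bar>f i x\<bar> \<le> C) \<Longrightarrow>
                (\<And>x. (\<lambda>i. f i x) \<longlonglongrightarrow> g x) \<Longrightarrow> P g"
    and g: "g \<in> borel_measurable borel" "\<And>x. \<bar>g x\<bar> \<le> C"
  shows "P g"
proof -
  have P0: "P (\<lambda>x. 0)"
    using lin[OF op[OF open_empty] op[OF open_empty], of 0 0] by simp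
  have Psum: "P (\<lambda>x. \<Sum>i\<in>I. c i * f i x)" if "finite I" "\<And>i. i \<in> I \<Longrightarrow> P (f i)"
    for I :: "'i set" and c f
    using that
  proof (induction I rule: finite_induct)
    case (insert i I)
    then show ?case
      using lin[of "f i" "\<lambda>x. \<Sum>i\<in>I. c i * f i x" "c i" 1] by simp
  qed (simp add: P0)
  have Pset: "P (indicator A)" if "A \<in> sets borel" for A
  proof -
    have "Int_stable {S::'a set. open S}" "{S::'a set. open S} \<subseteq> Pow UNIV"
      by (auto simp: Int_stable_def)
    moreover have "A \<in> sigma_sets UNIV {S. open S}"
      using that by (simp add: borel_def)
    ultimately show ?thesis
    proof (induction rule: sigma_sets_induct_disjoint)
      case (basic A)
      then show ?case by (simp add: op)
    next
      case empty
      show ?case by (rule op) simp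
    next
      case (compl A)
      have "indicator (UNIV - A) = (\<lambda>x. 1 * indicator UNIV x + (-1) * indicator A x :: real)"
        by (auto simp: indicator_def)
      then show ?case
        using lin[OF op[OF open_UNIV] compl(2), of 1 "-1"] by simp
    next
      case (union A)
      \<comment> \<open>Disjointness makes the indicator of a finite union a sum, which
        \<open>lin\<close> can reach; the full union is then a bounded limit.\<close>
      let ?f = "\<lambda>n x. \<Sum>i<n. 1 * indicator (A i) x :: real"
      have eq: "?f n x = indicator (\<Union>i<n. A i) x" for n x
        using union(1)
        by (subst indicator_UN_disjoint) (auto simp: disjoint_family_on_def)
      show ?case
      proof (rule lim)
        show "P (?f n)" for n
          by (rule Psum) (use union in auto)
        show "\<bar>?f n x\<bar> \<le> 1" for n x
          unfolding eq by (simp add: indicator_def)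
        show "(\<lambda>n. ?f n x) \<longlonglongrightarrow> indicator (\<Union>i. A i) x" for x
        proof (cases "x \<in> (\<Union>i. A i)")
          case True
          then obtain i where "x \<in> A i" by auto
          then have "eventually (\<lambda>n. ?f n x = 1) sequentially"
            unfolding eq by (intro eventually_sequentiallyI[of "Suc i"]) (auto simp: indicator_def)
          then show ?thesis
            using True by (simp add: tendsto_eventually)
        next
          case False
          then show ?thesis
            unfolding eq by (simp add: indicator_def)
        qed
      qed
    qed
  qed
  obtain F where F: "\<And>i. simple_function borel (F i)" "\<And>x. (\<lambda>i. F i x) \<longlonglongrightarrow> g x"
    "\<And>i x. dist (F i x) 0 \<le> 2 * dist (g x) 0"
    using borel_measurable_implies_sequence_metric[OF g(1), of 0] by auto
  show ?thesis
  proof (rule lim)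
    fix i
    have fin: "finite (range (F i))"
      using F(1)[of i] by (simp add: simple_function_def)
    have "F i = (\<lambda>x. \<Sum>y\<in>range (F i). y * indicator (F i -` {y}) x)"
    proof
      fix x
      show "F i x = (\<Sum>y\<in>range (F i). y * indicator (F i -` {y}) x)"
        using fin by (subst sum.mono_neutral_right[of _ "{F i x}"]) (auto simp: indicator_def)
    qed
    moreover have "P (\<lambda>x. \<Sum>y\<in>range (F i). y * indicator (F i -` {y}) x)"
    proof (rule Psum[OF fin], rule Pset)
      fix y assume "y \<in> range (F i)"
      then show "F i -` {y} \<in> sets borel"
        using simple_functionD(2)[OF F(1)[of i], of "{y}"] by simp
    qed
    ultimately show "P (F i)" by simp
    show "\<bar>F i x\<bar> \<le> 2 * C" for x
      using F(3)[of i x] g(2)[of x] by simp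
  qed (use F in auto)
qed

section \<open>Smooth bump functions on boxes\<close>

text \<open>The parameters \<open>p\<close> and \<open>n\<close> make the family closed under differentiation;
  for \<open>p = 1\<close>, \<open>n = 0\<close> it tends to the indicator of \<open>(a, b)\<close> as \<open>c \<rightarrow> 0\<close>.\<close>

definition bump1 :: "real \<Rightarrow> real \<Rightarrow> real \<Rightarrow> real poly \<Rightarrow> nat \<Rightarrow> real \<Rightarrow> real" where
  "bump1 a b c p n t =
     (if a < t \<and> t < b then poly p t / ((t - a) * (b - t)) ^ n * exp (- c / ((t - a) * (b - t)))
      else 0)"

text \<open>Used at the endpoints of a bump and outside its interval, where the quotient formula
  cannot be differentiated.\<close>

lemma has_real_derivative_zero_if_square_bound:
  fixes f :: "real \<Rightarrow> real"
  assumes "\<And>t. \<bar>f t\<bar> \<le> M * (t - x)\<^sup>2"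
  shows "(f has_real_derivative 0) (at x)"
proof -
  have f0: "f x = 0" using assms[of x] by simp
  have "((\<lambda>h. (f (x + h) - f x) / h) \<longlongrightarrow> 0) (at 0)"
  proof (rule Lim_null_comparison)
    show "\<forall>\<^sub>F h in at 0. norm ((f (x + h) - f x) / h) \<le> M * \<bar>h\<bar>"
      unfolding eventually_at
    proof (intro exI[of _ 1] conjI ballI impI)
      fix h :: real assume "h \<noteq> 0 \<and> dist h 0 < 1"
      then show "norm ((f (x + h) - f x) / h) \<le> M * \<bar>h\<bar>"
        using assms[of "x + h"] f0
        by (simp add: divide_simps power2_eq_square abs_mult mult.assoc)
    qed simp
    show "((\<lambda>h. M * \<bar>h\<bar>) \<longlongrightarrow> 0) (at 0)"
      by (auto intro!: tendsto_eq_intros)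
  qed
  then show ?thesis by (simp add: DERIV_def)
qed

lemma power_over_fact_le_exp:
  fixes x :: real
  assumes "x \<ge> 0"
  shows "x ^ n / fact n \<le> exp x"
proof -
  have "(\<Sum>i\<in>{n}. x ^ i /\<^sub>R fact i) \<le> (\<Sum>i. x ^ i /\<^sub>R fact i)"
    using assms by (intro sum_le_suminf summable_exp_generic) auto
  then show ?thesis by (simp add: exp_def field_simps)
qed

lemma bump1_square_bound:
  assumes "c > 0"
  obtains M where "M \<ge> 0" "\<And>t. a < t \<Longrightarrow> t < b \<Longrightarrow> \<bar>bump1 a b c p n t\<bar> \<le> M * ((t - a) * (b - t))\<^sup>2"
proof -
  have "bounded (poly p ` {a..b})"
    by (intro compact_imp_bounded compact_continuous_image continuous_intros compact_Icc)
  then obtain B where B: "\<And>t. t \<in> {a..b} \<Longrightarrow> \<bar>poly p t\<bar> \<le> B" and B0: "B > 0"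
    unfolding bounded_pos by (metis imageI real_norm_def)
  \<comment> \<open>From \<open>exp (c / w) \<ge> (c / w) ^ (n + 2) / fact (n + 2)\<close>: the
    power \<open>n\<close> cancels the denominator of the bump, and the surplus 2 leaves the square
    that forces a zero derivative.\<close>
  define K where "K = fact (n + 2) / c ^ (n + 2)"
  have K: "K \<ge> 0" using assms by (simp add: K_def)
  show ?thesis
  proof (rule that[of "B * K"])
    show "B * K \<ge> 0" using B0 K by simp
    fix t assume t: "a < t" "t < b"
    define w where "w = (t - a) * (b - t)"
    have w: "w > 0" using t by (simp add: w_def)
    have "(c / w) ^ (n + 2) / fact (n + 2) \<le> exp (c / w)"
      using power_over_fact_le_exp[of "c / w" "n + 2"] assms w by simp
    then have "exp (- (c / w)) \<le> inverse ((c / w) ^ (n + 2) / fact (n + 2))"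
      unfolding exp_minus using assms w by (intro le_imp_inverse_le) auto
    also have "\<dots> = K * w ^ n * w\<^sup>2"
      using assms w by (simp add: K_def divide_simps power_add power2_eq_square)
    finally have e: "exp (- c / w) \<le> K * w ^ n * w\<^sup>2" by simp
    have "\<bar>bump1 a b c p n t\<bar> = \<bar>poly p t\<bar> / w ^ n * exp (- c / w)"
      using t w by (simp add: bump1_def w_def[symmetric] abs_mult)
    also have "\<dots> \<le> B / w ^ n * (K * w ^ n * w\<^sup>2)"
      using B[of t] t w e B0 by (intro mult_mono divide_right_mono) auto
    also have "\<dots> = B * K * w\<^sup>2" using w by simp
    finally show "\<bar>bump1 a b c p n t\<bar> \<le> B * K * ((t - a) * (b - t))\<^sup>2"
      by (simp add: w_def)
  qed
qed

text \<open>Differentiation only changes the polynomial and raises the exponent by 2, so that all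
  higher derivatives stay within one explicit family.\<close>

lemma bump1_has_derivative:
  assumes c: "c > 0"
  shows "\<exists>q m. \<forall>t. (bump1 a b c p n has_real_derivative bump1 a b c q m t) (at t)"
proof -
  define W :: "real poly" where "W = [:- a * b, a + b, - 1:]"
  have W: "poly W t = (t - a) * (b - t)" for t
    by (simp add: W_def algebra_simps)
  \<comment> \<open>The quotient and chain rules, brought to the common denominator
    \<open>W ^ (n + 2)\<close>; the last term stems from the exponential.\<close>
  define q where "q = pderiv p * W\<^sup>2 - of_nat n * p * pderiv W * W + smult c (p * pderiv W)"
  have "(bump1 a b c p n has_real_derivative bump1 a b c q (n + 2) t) (at t)" for t
  proof (cases "a < t \<and> t < b")
    case True
    then have w: "poly W t > 0" by (simp add: W)
    have dW: "(poly W has_real_derivative poly (pderiv W) t) (at t)"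
      by (rule poly_DERIV)
    have dp: "(poly p has_real_derivative poly (pderiv p) t) (at t)"
      by (rule poly_DERIV)
    have "((\<lambda>t. poly p t / poly W t ^ n * exp (- c / poly W t)) has_real_derivative
             poly q t / poly W t ^ (n + 2) * exp (- c / poly W t)) (at t)"
    proof (cases n)
      case 0
      then show ?thesis using w
        by (auto intro!: derivative_eq_intros dW dp simp: q_def field_simps power2_eq_square)
    next
      case (Suc m)
      show ?thesis unfolding Suc using w
        by (auto intro!: derivative_eq_intros dW dp simp: q_def Suc)
          (cases m; simp add: field_simps power2_eq_square)
    qed
    then have "((\<lambda>t. poly p t / poly W t ^ n * exp (- c / poly W t)) has_real_derivative
             bump1 a b c q (n + 2) t) (at t)"
      using True by (simp add: bump1_def W)
    then show ?thesis
    proof (rule DERIV_cong_ev[OF refl _ refl, THEN iffD1, rotated])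
      have "\<forall>\<^sub>F x in nhds t. x \<in> {a<..<b}"
        using True by (intro eventually_nhds_in_open) auto
      then show "\<forall>\<^sub>F x in nhds t. poly p x / poly W x ^ n * exp (- c / poly W x) = bump1 a b c p n x"
        by eventually_elim (simp add: bump1_def W)
    qed
  next
    case False
    obtain M where M: "M \<ge> 0"
      "\<And>t. a < t \<Longrightarrow> t < b \<Longrightarrow> \<bar>bump1 a b c p n t\<bar> \<le> M * ((t - a) * (b - t))\<^sup>2"
      using bump1_square_bound[OF c] by blast
    \<comment> \<open>For \<open>s\<close> inside the interval, an endpoint lies between
      \<open>s\<close> and \<open>t\<close>. Hence one of the factors \<open>s - a\<close> and
      \<open>b - s\<close> is at most the distance from \<open>s\<close> to \<open>t\<close>, and
      the other at most \<open>b - a\<close>.\<close>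
    have "\<bar>bump1 a b c p n s\<bar> \<le> M * (b - a)\<^sup>2 * (s - t)\<^sup>2" for s
    proof (cases "a < s \<and> s < b")
      case True
      have "\<bar>(s - a) * (b - s)\<bar> \<le> \<bar>(b - a) * (s - t)\<bar>"
      proof (cases "t \<le> a")
        case t: True
        have "(s - a) * (b - s) \<le> (s - t) * (b - a)"
          using True t by (intro mult_mono) auto
        then show ?thesis using True t by (simp add: abs_mult mult.commute)
      next
        case t: False
        then have "t \<ge> b" using False by auto
        then have "(s - a) * (b - s) \<le> (b - a) * (t - s)"
          using True by (intro mult_mono) auto
        then show ?thesis using True \<open>t \<ge> b\<close> by (simp add: abs_mult)
      qed
      then have "((s - a) * (b - s))\<^sup>2 \<le> ((b - a) * (s - t))\<^sup>2"
        by (rule abs_le_square_iff[THEN iffD1])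
      then have "M * ((s - a) * (b - s))\<^sup>2 \<le> M * ((b - a) * (s - t))\<^sup>2"
        using M(1) by (rule mult_left_mono)
      then show ?thesis
        using M(2)[of s] True by (simp add: power_mult_distrib mult.assoc)
    qed (use M in \<open>auto simp: bump1_def\<close>)
    then have "(bump1 a b c p n has_real_derivative 0) (at t)"
      by (rule has_real_derivative_zero_if_square_bound)
    moreover have "bump1 a b c q (n + 2) t = 0"
      unfolding bump1_def using False by auto
    ultimately show ?thesis by simp
  qed
  then show ?thesis by blast
qed

text \<open>Polynomial and exponent may differ from coordinate to coordinate, because a partial
  derivative alters a single factor of the product.\<close>

definition box_bumps :: "real ^ 'm \<Rightarrow> real ^ 'm \<Rightarrow> real \<Rightarrow> (real ^ 'm \<Rightarrow> real) set" where
  "box_bumps a b c = {\<phi>. \<exists>p n. \<phi> = (\<lambda>x. \<Prod>i\<in>UNIV. bump1 (a $ i) (b $ i) c (p i) (n i) (x $ i))}"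

lemma box_bumps_derivative:
  fixes a b :: "real ^ 'm"
  assumes c: "c > 0" and \<phi>: "\<phi> \<in> box_bumps a b c"
  shows "\<phi> differentiable (at x)" and "partial_deriv k \<phi> \<in> box_bumps a b c"
proof -
  obtain p n where \<phi>_eq: "\<phi> = (\<lambda>x. \<Prod>i\<in>UNIV. bump1 (a $ i) (b $ i) c (p i) (n i) (x $ i))"
    using \<phi> by (auto simp: box_bumps_def)
  have "\<forall>i. \<exists>q m. \<forall>t. (bump1 (a $ i) (b $ i) c (p i) (n i) has_real_derivative
            bump1 (a $ i) (b $ i) c q m t) (at t)"
    using bump1_has_derivative[OF c] by blast
  then obtain q m where qm: "\<And>i t. (bump1 (a $ i) (b $ i) c (p i) (n i) has_real_derivative
            bump1 (a $ i) (b $ i) c (q i) (m i) t) (at t)"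
    by metis
  define b0 b1 where "b0 = (\<lambda>i. bump1 (a $ i) (b $ i) c (p i) (n i))"
    and "b1 = (\<lambda>i. bump1 (a $ i) (b $ i) c (q i) (m i))"
  have d: "((\<lambda>x::real^'m. b0 i (x $ i)) has_derivative (\<lambda>h. b1 i (x $ i) * h $ i)) (at x)" for i x
  proof -
    have "(b0 i has_derivative (*) (b1 i (x $ i))) (at (x $ i))"
      using qm[of i "x $ i"] by (simp add: has_field_derivative_def b0_def b1_def)
    then have "(b0 i \<circ> (\<lambda>x. x $ i) has_derivative (*) (b1 i (x $ i)) \<circ> (\<lambda>h. h $ i)) (at x)"
      by (intro diff_chain_at bounded_linear.has_derivative[OF bounded_linear_vec_nth]
            has_derivative_ident) simp
    then show ?thesis by (simp add: o_def)
  qed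
  have D: "(\<phi> has_derivative (\<lambda>h. \<Sum>i\<in>UNIV. b1 i (x $ i) * h $ i * (\<Prod>j\<in>UNIV - {i}. b0 j (x $ j)))) (at x)" for x
    unfolding \<phi>_eq b0_def[symmetric]
    using has_derivative_prod[where I=UNIV, OF d] by (simp add: b0_def)
  then show "\<phi> differentiable (at x)" by (auto simp: differentiable_def)
  have "partial_deriv k \<phi> = (\<lambda>x. \<Prod>i\<in>UNIV. bump1 (a $ i) (b $ i) c ((p(k := q k)) i) ((n(k := m k)) i) (x $ i))"
  proof
    fix x
    have "partial_deriv k \<phi> x = (\<Sum>i\<in>UNIV. b1 i (x $ i) * axis k 1 $ i * (\<Prod>j\<in>UNIV - {i}. b0 j (x $ j)))"
      unfolding partial_deriv_def frechet_derivative_at[OF D[of x], symmetric] by simp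
    also have "\<dots> = b1 k (x $ k) * (\<Prod>j\<in>UNIV - {k}. b0 j (x $ j))"
      by (subst sum.mono_neutral_right[of _ "{k}"]) (auto simp: axis_def)
    also have "\<dots> = (\<Prod>i\<in>UNIV. (if i = k then b1 i else b0 i) (x $ i))"
      by (subst (2) prod.remove[of _ k]) (auto intro!: prod.cong)
    also have "\<dots> = (\<Prod>i\<in>UNIV. bump1 (a $ i) (b $ i) c ((p(k := q k)) i) ((n(k := m k)) i) (x $ i))"
      by (intro prod.cong) (auto simp: b0_def b1_def)
    finally show "partial_deriv k \<phi> x = \<dots>" .
  qed
  then show "partial_deriv k \<phi> \<in> box_bumps a b c"
    unfolding box_bumps_def by blast
qed

lemma box_bumps_C_times:
  assumes "c > 0" "\<phi> \<in> box_bumps a b c"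
  shows "C_times n \<phi>"
  using assms(2)
proof (induction n arbitrary: \<phi>)
  case 0
  then show ?case
    using box_bumps_derivative(1)[OF assms(1)]
    by (auto intro!: continuous_at_imp_continuous_on differentiable_imp_continuous_within)
next
  case (Suc n)
  then show ?case
    using box_bumps_derivative[OF assms(1) Suc.prems] by auto
qed

lemma box_bumps_test_functions:
  assumes c: "c > 0" and \<phi>: "\<phi> \<in> box_bumps a b c" and U: "cbox a b \<subseteq> U"
  shows "\<phi> \<in> test_functions U"
proof -
  obtain p n where \<phi>_eq: "\<phi> = (\<lambda>x. \<Prod>i\<in>UNIV. bump1 (a $ i) (b $ i) c (p i) (n i) (x $ i))"
    using \<phi> by (auto simp: box_bumps_def)
  have "{x. \<phi> x \<noteq> 0} \<subseteq> cbox a b"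
    by (auto simp: \<phi>_eq bump1_def mem_box_cart split: if_splits) (meson less_imp_le)+
  then have "closure {x. \<phi> x \<noteq> 0} \<subseteq> cbox a b"
    by (rule closure_minimal) (rule closed_cbox)
  moreover from this have "compact (closure {x. \<phi> x \<noteq> 0})"
    using compact_Int_closed[OF compact_cbox closed_closure] by (metis inf.absorb_iff2)
  ultimately show ?thesis
    using U box_bumps_C_times[OF c \<phi>] by (auto simp: test_functions_def)
qed

text \<open>As the parameter \<open>1 / Suc j\<close> tends to 0, the exponential factors tend to 1
  inside the box, while every bump vanishes off it. Convergence at every point with a common bound
  takes the place of mollification.\<close>

lemma indicator_box_limit_test_functions:
  fixes a b :: "real ^ 'm"
  assumes U: "cbox a b \<subseteq> U"
  obtains \<phi> :: "nat \<Rightarrow> real ^ 'm \<Rightarrow> real" where "\<And>j. \<phi> j \<in> test_functions U"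
    "\<And>j x. \<bar>\<phi> j x\<bar> \<le> 1" "\<And>x. (\<lambda>j. \<phi> j x) \<longlonglongrightarrow> indicator (box a b) x"
proof
  define \<phi> where "\<phi> = (\<lambda>j x. \<Prod>i\<in>UNIV. bump1 (a $ i) (b $ i) (1 / Suc j) 1 0 ((x :: real^'m) $ i))"
  have "\<phi> j \<in> box_bumps a b (1 / Suc j)" for j
    unfolding box_bumps_def \<phi>_def by (rule CollectI, rule exI[of _ "\<lambda>_. 1"], rule exI[of _ "\<lambda>_. 0"]) simp
  then show "\<phi> j \<in> test_functions U" for j
    by (intro box_bumps_test_functions[OF _ _ U]) auto
  show "\<bar>\<phi> j x\<bar> \<le> 1" for j x
    unfolding \<phi>_def abs_prod
    by (intro prod_le_1) (auto simp: bump1_def intro!: divide_nonneg_nonneg mult_nonneg_nonneg)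
  show "(\<lambda>j. \<phi> j x) \<longlonglongrightarrow> indicator (box a b) x" for x
  proof -
    have "(\<lambda>j. bump1 (a $ i) (b $ i) (1 / Suc j) 1 0 (x $ i)) \<longlonglongrightarrow>
            (if a $ i < x $ i \<and> x $ i < b $ i then 1 else 0)" for i
    proof (cases "a $ i < x $ i \<and> x $ i < b $ i")
      case True
      have "(\<lambda>j. - (1 / real (Suc j)) / ((x $ i - a $ i) * (b $ i - x $ i))) \<longlonglongrightarrow> 0"
        using tendsto_divide[OF tendsto_minus[OF LIMSEQ_Suc[OF lim_1_over_n]] tendsto_const,
            of "(x $ i - a $ i) * (b $ i - x $ i)"] True by simp
      from tendsto_exp[OF this] show ?thesis
        using True by (simp add: bump1_def)
    qed (auto simp: bump1_def)
    then have "(\<lambda>j. \<phi> j x) \<longlonglongrightarrow> (\<Prod>i\<in>UNIV. if a $ i < x $ i \<and> x $ i < b $ i then 1 else 0)"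
      unfolding \<phi>_def by (intro tendsto_prod)
    moreover have "(\<Prod>i\<in>UNIV. if a $ i < x $ i \<and> x $ i < b $ i then 1 else 0) = (indicator (box a b) x :: real)"
      by (auto simp: indicator_def mem_box_cart intro: prod.neutral)
    ultimately show ?thesis by simp
  qed
qed

section \<open>Integrals over subsets and basic properties of test functions\<close>

lemma integrable_lebesgue_on_subset:
  fixes f :: "'a::euclidean_space \<Rightarrow> 'v::euclidean_space"
  assumes "integrable (lebesgue_on S) f" "T \<subseteq> S" "S \<in> sets lebesgue" "T \<in> sets lebesgue"
  shows "integrable (lebesgue_on T) f"
  using set_integrable_subset[of lebesgue S f T] assms
  by (simp add: integrable_restrict_space set_integrable_def)

lemma integral_lebesgue_on_support:
  fixes f :: "'a::euclidean_space \<Rightarrow> 'v::euclidean_space"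
  assumes "\<And>x. x \<in> S - T \<Longrightarrow> f x = 0" "T \<subseteq> S" "S \<in> sets lebesgue" "T \<in> sets lebesgue"
  shows "integral\<^sup>L (lebesgue_on S) f = integral\<^sup>L (lebesgue_on T) f"
    and "integrable (lebesgue_on S) f \<longleftrightarrow> integrable (lebesgue_on T) f"
proof -
  have "(\<lambda>x. indicator S x *\<^sub>R f x) = (\<lambda>x. indicator T x *\<^sub>R f x)"
    using assms(1,2) by (auto simp: indicator_def fun_eq_iff)
  then show "integral\<^sup>L (lebesgue_on S) f = integral\<^sup>L (lebesgue_on T) f"
    "integrable (lebesgue_on S) f \<longleftrightarrow> integrable (lebesgue_on T) f"
    using assms(3,4) by (simp_all add: integral_restrict_space integrable_restrict_space)
qed

lemma test_function_continuous:
  assumes "\<phi> \<in> test_functions U"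
  shows "continuous_on UNIV \<phi>" "continuous_on UNIV (partial_deriv k \<phi>)" "\<phi> differentiable (at x)"
proof -
  have "C_times 0 \<phi>" "C_times (Suc 0) \<phi>"
    using assms unfolding test_functions_def by blast+
  then show "continuous_on UNIV \<phi>" "continuous_on UNIV (partial_deriv k \<phi>)" "\<phi> differentiable (at x)"
    by simp_all
qed

lemma test_function_borel [measurable]:
  assumes "\<phi> \<in> test_functions U"
  shows "\<phi> \<in> borel_measurable borel" "partial_deriv k \<phi> \<in> borel_measurable borel"
  using test_function_continuous[OF assms] by (auto intro: borel_measurable_continuous_onI)

text \<open>One compact set and one constant serve the function and all its partial derivatives at
  once. The set is the closed support; its complement is open, so the derivatives vanish there
  too.\<close>

lemma test_functionE:
  fixes \<phi> :: "real ^ 'm \<Rightarrow> real"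
  assumes \<phi>: "\<phi> \<in> test_functions U"
  obtains K C where "compact K" "K \<subseteq> U" "\<And>x. x \<notin> K \<Longrightarrow> \<phi> x = 0"
    "\<And>x k. x \<notin> K \<Longrightarrow> partial_deriv k \<phi> x = 0" "C \<ge> 0" "\<And>x. \<bar>\<phi> x\<bar> \<le> C"
    "\<And>k x. \<bar>partial_deriv k \<phi> x\<bar> \<le> C"
proof -
  let ?K = "closure {x. \<phi> x \<noteq> 0}"
  have K: "compact ?K" "?K \<subseteq> U" using \<phi> by (auto simp: test_functions_def)
  have z: "\<phi> x = 0" if "x \<notin> ?K" for x
    using that closure_subset[of "{x. \<phi> x \<noteq> 0}"] by auto
  have dz: "partial_deriv k \<phi> x = 0" if "x \<notin> ?K" for x k
  proof -
    have "(\<phi> has_derivative (\<lambda>h. 0)) (at x)"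
    proof (rule has_derivative_transform_within_open)
      show "((\<lambda>x. 0) has_derivative (\<lambda>h. 0)) (at x)" by (rule has_derivative_const)
      show "open (- ?K)" by (rule open_Compl) (rule closed_closure)
      show "x \<in> - ?K" using that by simp
      show "0 = \<phi> y" if "y \<in> - ?K" for y using z[of y] that by (metis ComplD)
    qed
    then show ?thesis
      unfolding partial_deriv_def by (simp add: frechet_derivative_at[symmetric])
  qed
  have bnd: "\<exists>C. \<forall>x. \<bar>f x\<bar> \<le> C" if "continuous_on UNIV f" "\<And>x. x \<notin> ?K \<Longrightarrow> f x = 0"
    for f :: "real ^ 'm \<Rightarrow> real"
  proof -
    have "bounded (f ` ?K)"
      by (intro compact_imp_bounded compact_continuous_image K continuous_on_subset[OF that(1)]) auto
    then obtain B where "\<And>x. x \<in> ?K \<Longrightarrow> \<bar>f x\<bar> \<le> B" "B > 0"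
      unfolding bounded_pos by (metis imageI real_norm_def)
    then show ?thesis using that(2) by (metis abs_zero less_imp_le)
  qed
  obtain C0 where C0: "\<And>x. \<bar>\<phi> x\<bar> \<le> C0"
    using bnd[OF test_function_continuous(1)[OF \<phi>] z] by blast
  have "\<exists>C. \<forall>k x. \<bar>partial_deriv k \<phi> x\<bar> \<le> C k"
    using bnd[OF test_function_continuous(2)[OF \<phi>] dz] by metis
  then obtain C1 where C1: "\<And>k x. \<bar>partial_deriv k \<phi> x\<bar> \<le> C1 k" by blast
  have C1': "C1 k \<ge> 0" for k using C1[of k 0] by linarith
  have C0': "C0 \<ge> 0" using C0[of 0] by linarith
  show ?thesis
  proof (rule that[OF K z dz])
    show "C0 + (\<Sum>k\<in>UNIV. C1 k) \<ge> 0"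
      using C0' C1' by (simp add: sum_nonneg)
    show "\<bar>\<phi> x\<bar> \<le> C0 + (\<Sum>k\<in>UNIV. C1 k)" for x
      using C0[of x] sum_nonneg[of UNIV C1] C1' by simp
    show "\<bar>partial_deriv k \<phi> x\<bar> \<le> C0 + (\<Sum>k\<in>UNIV. C1 k)" for k x
      using C1[of k x] C0' member_le_sum[of k UNIV C1] C1' by simp
  qed
qed

lemma test_function_translate:
  fixes \<phi> :: "real ^ 'm \<Rightarrow> real"
  assumes \<phi>: "\<phi> \<in> test_functions U" and V: "\<And>x. x \<in> U \<Longrightarrow> x + t \<in> V"
  shows "(\<lambda>x. \<phi> (x - t)) \<in> test_functions V"
    and "partial_deriv k (\<lambda>x. \<phi> (x - t)) x = partial_deriv k \<phi> (x - t)"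
proof -
  have D: "((\<lambda>x. \<phi> (x - t)) has_derivative frechet_derivative \<phi> (at (x - t))) (at x)"
    if "\<And>x. \<phi> differentiable (at x)" for \<phi> :: "real ^ 'm \<Rightarrow> real" and x
  proof -
    have "(\<phi> has_derivative frechet_derivative \<phi> (at (x - t))) (at (x - t))"
      using that frechet_derivative_works by blast
    moreover have "((\<lambda>x. x - t) has_derivative (\<lambda>h. h)) (at x)"
      by (auto intro!: derivative_eq_intros)
    ultimately show ?thesis
      using has_derivative_compose[of "\<lambda>x. x - t" "\<lambda>h. h" x UNIV \<phi>] by simp
  qed
  have pd: "partial_deriv k (\<lambda>x. \<phi> (x - t)) x = partial_deriv k \<phi> (x - t)"
    if "\<And>x. \<phi> differentiable (at x)" for \<phi> :: "real ^ 'm \<Rightarrow> real" and x k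
    using frechet_derivative_at[OF D[OF that, of x]] by (simp add: partial_deriv_def)
  then show "partial_deriv k (\<lambda>x. \<phi> (x - t)) x = partial_deriv k \<phi> (x - t)"
    using test_function_continuous(3)[OF \<phi>] by blast
  have C: "C_times n \<phi> \<Longrightarrow> C_times n (\<lambda>x. \<phi> (x - t))" for n and \<phi> :: "real ^ 'm \<Rightarrow> real"
  proof (induction n arbitrary: \<phi>)
    case 0
    then show ?case
      by (auto intro!: continuous_on_compose2[of UNIV \<phi>] continuous_intros)
  next
    case (Suc n)
    have d: "\<And>x. \<phi> differentiable (at x)" using Suc.prems by simp
    have "partial_deriv k (\<lambda>x. \<phi> (x - t)) = (\<lambda>x. partial_deriv k \<phi> (x - t))" for k
      using pd[OF d] by auto
    then show ?case
      using Suc D[OF d] by (auto simp: differentiable_def)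
  qed
  have im: "{x. \<phi> (x - t) \<noteq> 0} = (\<lambda>x. x + t) ` {x. \<phi> x \<noteq> 0}"
    by (auto simp: image_iff) (metis diff_add_cancel)
  have cl: "closure {x. \<phi> (x - t) \<noteq> 0} = (\<lambda>x. x + t) ` closure {x. \<phi> x \<noteq> 0}"
    unfolding im using closure_translation[of t "{x. \<phi> x \<noteq> 0}"] by (simp add: add.commute)
  have "compact ((\<lambda>x. x + t) ` closure {x. \<phi> x \<noteq> 0})"
    using \<phi> by (intro compact_continuous_image continuous_intros) (auto simp: test_functions_def)
  then show "(\<lambda>x. \<phi> (x - t)) \<in> test_functions V"
    unfolding test_functions_def mem_Collect_eq cl using \<phi> V C
    by (auto simp del: compact_closure simp: test_functions_def)
qed

lemma test_functions_mono: "U \<subseteq> V \<Longrightarrow> test_functions U \<subseteq> test_functions V"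
  by (auto simp: test_functions_def)

lemma integrable_scaleR_bounded:
  fixes f :: "'a \<Rightarrow> 'v::euclidean_space"
  assumes "integrable M f" "\<psi> \<in> borel_measurable M" "\<And>x. x \<in> space M \<Longrightarrow> \<bar>\<psi> x\<bar> \<le> C"
  shows "integrable M (\<lambda>x. \<psi> x *\<^sub>R f x)"
proof (rule Bochner_Integration.integrable_bound[of M "\<lambda>x. C * norm (f x)"])
  show "AE x in M. norm (\<psi> x *\<^sub>R f x) \<le> norm (C * norm (f x))"
  proof (rule AE_I2)
    fix x assume "x \<in> space M"
    then have "\<bar>\<psi> x\<bar> \<le> \<bar>C\<bar>" using assms(3)[of x] by linarith
    then show "norm (\<psi> x *\<^sub>R f x) \<le> norm (C * norm (f x))"
      by (simp add: abs_mult mult_right_mono)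
  qed
qed (use assms in \<open>auto intro!: integrable_mult_right integrable_norm borel_measurable_scaleR\<close>)

lemma norm_integral_le_AE:
  fixes f :: "'a \<Rightarrow> 'v::euclidean_space"
  assumes "integrable M f" "integrable M g" "AE x in M. norm (f x) \<le> g x"
  shows "norm (\<integral>x. f x \<partial>M) \<le> (\<integral>x. g x \<partial>M)"
proof -
  have "norm (\<integral>x. f x \<partial>M) \<le> (\<integral>x. norm (f x) \<partial>M)" by (rule integral_norm_bound)
  also have "\<dots> \<le> (\<integral>x. g x \<partial>M)" using assms by (intro integral_mono_AE) auto
  finally show ?thesis .
qed

section \<open>From test functions to bounded measurable multipliers\<close>

text \<open>Replacing \<open>g\<close> by \<open>f i\<close> costs at most
  \<open>\<integral>x. \<bar>g x - f i x\<bar> * w x \<partial>M\<close>, which does not depend on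
  \<open>n\<close>; so \<open>i\<close> is chosen first and \<open>n\<close> afterwards.\<close>

lemma bounded_limit_uniform:
  fixes c :: "nat \<Rightarrow> 'a \<Rightarrow> 'v::euclidean_space" and f :: "nat \<Rightarrow> 'a \<Rightarrow> real"
  assumes w: "integrable M w" and cm: "\<And>n. c n \<in> borel_measurable M"
    and cw: "\<And>n. AE x in M. norm (c n x) \<le> w x"
    and fm: "\<And>i. f i \<in> borel_measurable M" and gm: "g \<in> borel_measurable M"
    and fC: "\<And>i x. \<bar>f i x\<bar> \<le> C" and fg: "\<And>x. (\<lambda>i. f i x) \<longlonglongrightarrow> g x"
    and lim: "\<And>i. (\<lambda>n. \<integral>x. f i x *\<^sub>R c n x \<partial>M) \<longlonglongrightarrow> 0"
  shows "(\<lambda>n. \<integral>x. g x *\<^sub>R c n x \<partial>M) \<longlonglongrightarrow> 0"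
proof -
  have gC: "\<bar>g x\<bar> \<le> C" for x
    by (rule LIMSEQ_le_const2[OF tendsto_rabs[OF fg[of x]]]) (use fC in auto)
  have ci: "integrable M (c n)" for n
    by (rule Bochner_Integration.integrable_bound[OF w cm]) (use cw[of n] in eventually_elim, auto)
  have I: "(\<lambda>i. \<integral>x. \<bar>g x - f i x\<bar> * w x \<partial>M) \<longlonglongrightarrow> (\<integral>x. 0 \<partial>M)"
  proof (rule integral_dominated_convergence[where w = "\<lambda>x. 2 * C * \<bar>w x\<bar>"])
    show "AE x in M. (\<lambda>i. \<bar>g x - f i x\<bar> * w x) \<longlonglongrightarrow> 0"
    proof (rule AE_I2)
      fix x
      show "(\<lambda>i. \<bar>g x - f i x\<bar> * w x) \<longlonglongrightarrow> 0"
        using tendsto_mult_left[OF tendsto_rabs[OF tendsto_diff[OF tendsto_const[of "g x"] fg[of x]]], of "w x"]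
        by (simp add: mult.commute)
    qed
    show "AE x in M. norm (\<bar>g x - f i x\<bar> * w x) \<le> 2 * C * \<bar>w x\<bar>" for i
    proof (rule AE_I2)
      fix x
      have "\<bar>g x - f i x\<bar> \<le> 2 * C" using gC[of x] fC[of i x] by linarith
      then show "norm (\<bar>g x - f i x\<bar> * w x) \<le> 2 * C * \<bar>w x\<bar>"
        by (simp add: abs_mult mult_right_mono)
    qed
  qed (use w fm gm in \<open>auto intro!: integrable_mult_right\<close>)
  show ?thesis
  proof (rule LIMSEQ_I)
    fix e :: real assume e: "e > 0"
    have "eventually (\<lambda>i. \<bar>\<integral>x. \<bar>g x - f i x\<bar> * w x \<partial>M\<bar> < e / 2) sequentially"
      using order_tendstoD(2)[OF tendsto_rabs[OF I], of "e / 2"] e by simp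
    then obtain i where i: "\<bar>\<integral>x. \<bar>g x - f i x\<bar> * w x \<partial>M\<bar> < e / 2"
      by (auto simp: eventually_sequentially)
    obtain N where N: "\<And>n. n \<ge> N \<Longrightarrow> norm (\<integral>x. f i x *\<^sub>R c n x \<partial>M) < e / 2"
      using LIMSEQ_D[OF lim[of i], of "e / 2"] e by auto
    show "\<exists>N. \<forall>n\<ge>N. norm ((\<integral>x. g x *\<^sub>R c n x \<partial>M) - 0) < e"
    proof (intro exI allI impI)
      fix n assume n: "n \<ge> N"
      have int: "integrable M (\<lambda>x. g x *\<^sub>R c n x)" "integrable M (\<lambda>x. f i x *\<^sub>R c n x)"
        by (intro integrable_scaleR_bounded[OF ci, where C = C] gm fm gC fC)+
      have "norm ((\<integral>x. g x *\<^sub>R c n x \<partial>M) - (\<integral>x. f i x *\<^sub>R c n x \<partial>M))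
          = norm (\<integral>x. (g x - f i x) *\<^sub>R c n x \<partial>M)"
        using int by (simp add: scaleR_left_diff_distrib)
      also have "\<dots> \<le> (\<integral>x. \<bar>g x - f i x\<bar> * w x \<partial>M)"
      proof (rule norm_integral_le_AE)
        show "integrable M (\<lambda>x. (g x - f i x) *\<^sub>R c n x)"
          unfolding scaleR_left_diff_distrib by (rule Bochner_Integration.integrable_diff[OF int])
        have "integrable M (\<lambda>x. \<bar>g x - f i x\<bar> *\<^sub>R w x)"
        proof (rule integrable_scaleR_bounded[OF w, where C = "2 * C"])
          fix x
          show "\<bar>\<bar>g x - f i x\<bar>\<bar> \<le> 2 * C" using gC[of x] fC[of i x] by linarith
        qed (use gm fm in auto)
        then show "integrable M (\<lambda>x. \<bar>g x - f i x\<bar> * w x)" by simp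
        show "AE x in M. norm ((g x - f i x) *\<^sub>R c n x) \<le> \<bar>g x - f i x\<bar> * w x"
          using cw[of n] by eventually_elim (simp add: mult_left_mono)
      qed
      finally have "norm (\<integral>x. g x *\<^sub>R c n x \<partial>M) \<le> norm (\<integral>x. f i x *\<^sub>R c n x \<partial>M)
          + \<bar>\<integral>x. \<bar>g x - f i x\<bar> * w x \<partial>M\<bar>"
        by (smt (verit) norm_triangle_sub)
      then show "norm ((\<integral>x. g x *\<^sub>R c n x \<partial>M) - 0) < e"
        using N[OF n] i by simp
    qed
  qed
qed

text \<open>The common majorant \<open>w\<close> rules out concentration, so a limit against test
  functions extends to boxes, open sets, bounded Borel functions and finally classes modulo null
  sets. For a constant sequence this is the fundamental lemma of the calculus of variations.\<close>

lemma test_limit_bounded: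
  fixes c :: "nat \<Rightarrow> real ^ 'm \<Rightarrow> 'v::euclidean_space"
  assumes U: "open U" and w: "integrable (lebesgue_on U) w"
    and cm: "\<And>n. c n \<in> borel_measurable (lebesgue_on U)"
    and cw: "\<And>n. AE x in lebesgue_on U. norm (c n x) \<le> w x"
    and test: "\<And>\<phi>. \<phi> \<in> test_functions U \<Longrightarrow>
                 (\<lambda>n. \<integral>x. \<phi> x *\<^sub>R c n x \<partial>lebesgue_on U) \<longlonglongrightarrow> 0"
    and \<psi>: "\<psi> \<in> borel_measurable (lebesgue_on U)" "\<And>x. x \<in> U \<Longrightarrow> \<bar>\<psi> x\<bar> \<le> C"
  shows "(\<lambda>n. \<integral>x. \<psi> x *\<^sub>R c n x \<partial>lebesgue_on U) \<longlonglongrightarrow> 0"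
proof -
  let ?M = "lebesgue_on U"
  define P where "P = (\<lambda>\<psi> :: real ^ 'm \<Rightarrow> real. \<psi> \<in> borel_measurable borel \<and> (\<exists>C. \<forall>x. \<bar>\<psi> x\<bar> \<le> C) \<and>
      (\<lambda>n. \<integral>x. \<psi> x *\<^sub>R c n x \<partial>?M) \<longlonglongrightarrow> 0)"
  have Ul: "U \<in> sets lebesgue" using U by auto
  have bl: "\<psi> \<in> borel_measurable ?M" if "\<psi> \<in> borel_measurable borel" for \<psi> :: "real ^ 'm \<Rightarrow> real"
    using that by (intro measurable_restrict_space1) (simp add: measurable_completion)
  have ci: "integrable ?M (c n)" for n
    by (rule Bochner_Integration.integrable_bound[OF w cm]) (use cw[of n] in eventually_elim, auto)
  have lin: "P (\<lambda>x. a * f x + b * g x)" if "P f" "P g" for a b f g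
  proof -
    obtain C1 C2 where C: "\<And>x. \<bar>f x\<bar> \<le> C1" "\<And>x. \<bar>g x\<bar> \<le> C2"
      using \<open>P f\<close> \<open>P g\<close> by (auto simp: P_def)
    have m: "f \<in> borel_measurable borel" "g \<in> borel_measurable borel"
      using that by (auto simp: P_def)
    have "\<bar>a * f x + b * g x\<bar> \<le> \<bar>a\<bar> * C1 + \<bar>b\<bar> * C2" for x
      using C[of x] by (intro order_trans[OF abs_triangle_ineq] add_mono) (auto simp: abs_mult mult_left_mono)
    moreover have "(\<lambda>n. \<integral>x. (a * f x + b * g x) *\<^sub>R c n x \<partial>?M) =
       (\<lambda>n. a *\<^sub>R (\<integral>x. f x *\<^sub>R c n x \<partial>?M) + b *\<^sub>R (\<integral>x. g x *\<^sub>R c n x \<partial>?M))"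
    proof
      fix n
      have "integrable ?M (\<lambda>x. f x *\<^sub>R c n x)" "integrable ?M (\<lambda>x. g x *\<^sub>R c n x)"
        using integrable_scaleR_bounded[OF ci bl] m C by blast+
      then show "(\<integral>x. (a * f x + b * g x) *\<^sub>R c n x \<partial>?M) =
         a *\<^sub>R (\<integral>x. f x *\<^sub>R c n x \<partial>?M) + b *\<^sub>R (\<integral>x. g x *\<^sub>R c n x \<partial>?M)"
        by (simp add: scaleR_left_distrib flip: scaleR_scaleR)
    qed
    moreover have "(\<lambda>n. a *\<^sub>R (\<integral>x. f x *\<^sub>R c n x \<partial>?M) + b *\<^sub>R (\<integral>x. g x *\<^sub>R c n x \<partial>?M)) \<longlonglongrightarrow> a *\<^sub>R 0 + b *\<^sub>R 0"
      using that by (intro tendsto_intros) (auto simp: P_def)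
    ultimately show ?thesis
      using m unfolding P_def by auto
  qed
  have lim: "P g" if f: "\<And>i::nat. P (f i)" and fC: "\<And>i x. \<bar>f i x\<bar> \<le> C" and fg: "\<And>x. (\<lambda>i. f i x) \<longlonglongrightarrow> g x"
    for f g C
  proof -
    have gC: "\<bar>g x\<bar> \<le> C" for x
      by (rule LIMSEQ_le_const2[OF tendsto_rabs[OF fg[of x]]]) (use fC in auto)
    have fm: "f i \<in> borel_measurable borel" for i using f by (simp add: P_def)
    have gm: "g \<in> borel_measurable borel"
      by (rule borel_measurable_LIMSEQ_metric[OF fm fg])
    have "(\<lambda>n. \<integral>x. g x *\<^sub>R c n x \<partial>?M) \<longlonglongrightarrow> 0"
      by (rule bounded_limit_uniform[OF w cm cw bl[OF fm] bl[OF gm] fC fg])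
        (use f in \<open>auto simp: P_def\<close>)
    then show ?thesis using gC gm unfolding P_def by blast
  qed
  \<comment> \<open>Boxes are stable under intersection, so inclusion-exclusion reaches their finite unions.\<close>
  define E :: "(real ^ 'm) set set" where "E = {B. \<exists>a b. B = box a b \<and> cbox a b \<subseteq> U}"
  have E: "P (indicator B)" if B: "B \<in> E" for B
  proof -
    obtain a b where ab: "B = box a b" "cbox a b \<subseteq> U" using B by (auto simp: E_def)
    obtain \<phi> :: "nat \<Rightarrow> real ^ 'm \<Rightarrow> real" where \<phi>: "\<And>j. \<phi> j \<in> test_functions U"
      "\<And>j x. \<bar>\<phi> j x\<bar> \<le> 1" "\<And>x. (\<lambda>j. \<phi> j x) \<longlonglongrightarrow> indicator (box a b) x"
      using indicator_box_limit_test_functions[OF ab(2)] by blast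
    have "P (\<phi> j)" for j
      using test[OF \<phi>(1)[of j]] test_function_borel(1)[OF \<phi>(1)[of j]] \<phi>(2)[of j] unfolding P_def by blast
    then show ?thesis using lim[OF _ \<phi>(2) \<phi>(3)] ab(1) by simp
  qed
  have Eint: "A \<inter> B \<in> E" if AB: "A \<in> E" "B \<in> E" for A B
  proof -
    obtain a b c d where "A = box a b" "cbox a b \<subseteq> U" "B = box c d" "cbox c d \<subseteq> U"
      using AB unfolding E_def by blast
    then have "A \<inter> B = box (\<Sum>i\<in>Basis. max (a \<bullet> i) (c \<bullet> i) *\<^sub>R i) (\<Sum>i\<in>Basis. min (b \<bullet> i) (d \<bullet> i) *\<^sub>R i)"
      "cbox (\<Sum>i\<in>Basis. max (a \<bullet> i) (c \<bullet> i) *\<^sub>R i) (\<Sum>i\<in>Basis. min (b \<bullet> i) (d \<bullet> i) *\<^sub>R i) \<subseteq> U"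
      using Int_interval[of a b c d] by (auto simp: box_Int_box)
    then show ?thesis by (auto simp: E_def)
  qed
  have P0: "P (\<lambda>x. 0)" by (auto simp: P_def)
  have union: "P (indicator (\<Union>i<n. A i))" if "\<And>i. A i \<in> E" for n :: nat and A
    using that
  proof (induction n arbitrary: A)
    case 0
    have "indicator (\<Union>i<0. A i) = (\<lambda>x. 0 :: real)" by (auto simp: indicator_def)
    then show ?case using P0 by simp
  next
    case (Suc n)
    have 1: "P (indicator (\<Union>i<n. A i))" by (rule Suc.IH[OF Suc.prems])
    have 2: "P (indicator (\<Union>i<n. A i \<inter> A n))" by (rule Suc.IH) (use Suc.prems Eint in auto)
    have 3: "P (indicator (A n))" by (rule E) (rule Suc.prems)
    have "indicator (\<Union>i<Suc n. A i) = (\<lambda>x. 1 * (1 * indicator (\<Union>i<n. A i) x + 1 * indicator (A n) x)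
          + (-1) * indicator (\<Union>i<n. A i \<inter> A n) x :: real)"
      by (auto simp: indicator_def fun_eq_iff less_Suc_eq)
    then show ?case using lin[OF lin[OF 1 3] 2, of 1 1 1 "-1"] by simp
  qed
  \<comment> \<open>Only the part of \<open>S\<close> in \<open>U\<close> matters. It is a countable
    union of boxes whose closures lie in \<open>U\<close>, enumerated by \<open>A\<close> and
    approached by finite unions.\<close>
  have op: "P (indicator S)" if S: "open S" for S
  proof -
    have SU: "open (S \<inter> U)" using S U by auto
    let ?F = "{B \<in> E. B \<subseteq> S \<inter> U}"
    have opF: "\<And>B. B \<in> ?F \<Longrightarrow> open B" by (auto simp: E_def open_box)
    obtain F where F: "F \<subseteq> ?F" "countable F" "\<Union>F = \<Union>?F"
    by (rule Lindelof[OF opF])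
    have "S \<inter> U \<subseteq> \<Union>?F"
    proof
      fix x assume x: "x \<in> S \<inter> U"
      obtain a b where "cbox a b \<subseteq> S \<inter> U" "x \<in> box a b"
        by (rule open_contains_cbox[OF SU x])
      moreover have "box a b \<subseteq> cbox a b" by (rule box_subset_cbox)
      ultimately show "x \<in> \<Union>?F" by (auto simp: E_def)
    qed
    then have FU: "\<Union>F = S \<inter> U" using F(3) by auto
    have "P (indicator (S \<inter> U))"
    proof (cases "F = {}")
      case True
      then have "indicator (S \<inter> U) = (\<lambda>x. 0 :: real)" using FU by (auto simp: indicator_def)
      then show ?thesis using P0 by simp
    next
      case False
      define A where "A = from_nat_into F"
      have A: "A i \<in> E" for i using from_nat_into[OF False] F(1) by (auto simp: A_def)
      have AU: "(\<Union>i. A i) = S \<inter> U" using FU range_from_nat_into[OF False F(2)] by (simp add: A_def)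
      show ?thesis
      proof (rule lim[OF union[OF A]])
        show "\<bar>indicator (\<Union>i<n. A i) x :: real\<bar> \<le> 1" for n x by (simp add: indicator_def)
        show "(\<lambda>n. indicator (\<Union>i<n. A i) x) \<longlonglongrightarrow> (indicator (S \<inter> U) x :: real)" for x
        proof (cases "x \<in> S \<inter> U")
          case True
          then obtain i where "x \<in> A i" using AU by auto
          then have "eventually (\<lambda>n. indicator (\<Union>i<n. A i) x = (1::real)) sequentially"
            by (intro eventually_sequentiallyI[of "Suc i"]) (auto simp: indicator_def)
          then show ?thesis using True by (simp add: tendsto_eventually)
        next
          case False
          then show ?thesis using AU by (auto simp: indicator_def)
        qed
      qed
    qed
    moreover have "(\<integral>x. indicator S x *\<^sub>R c n x \<partial>?M) = (\<integral>x. indicator (S \<inter> U) x *\<^sub>R c n x \<partial>?M)" for n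
      by (rule Bochner_Integration.integral_cong) (auto simp: indicator_def)
    ultimately show ?thesis
      using S unfolding P_def by (auto intro!: exI[of _ 1] simp: indicator_def)
  qed
  have "(\<lambda>x. if x \<in> U then \<psi> x else 0) \<in> borel_measurable lebesgue"
    using borel_measurable_if_I[OF \<psi>(1) Ul] by simp
  then obtain \<psi>2 where \<psi>2: "\<psi>2 \<in> borel_measurable lborel" "AE x in lborel. (if x \<in> U then \<psi> x else 0) = \<psi>2 x"
    using completion_ex_borel_measurable_real by blast
  \<comment> \<open>Clamping restores the bound where the Borel representative violates it, which
    happens on a null set only. The absolute value covers a negative \<open>C\<close>, possible for
    empty \<open>U\<close>.\<close>
  define \<psi>3 where "\<psi>3 = (\<lambda>x. max (- \<bar>C\<bar>) (min \<bar>C\<bar> (\<psi>2 x)))"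
  have \<psi>3: "\<psi>3 \<in> borel_measurable borel" "\<And>x. \<bar>\<psi>3 x\<bar> \<le> \<bar>C\<bar>"
    using \<psi>2(1) by (auto simp: \<psi>3_def)
  have "P \<psi>3"
    by (rule bounded_borel_induct[of P, OF op lin lim \<psi>3])
  have "AE x in lebesgue. (if x \<in> U then \<psi> x else 0) = \<psi>2 x"
    using AE_completion[OF \<psi>2(2)] by simp
  then have "AE x in lebesgue. x \<in> U \<longrightarrow> \<psi> x = \<psi>3 x"
  proof eventually_elim
    case (elim x)
    show ?case
    proof
      assume x: "x \<in> U"
      then have "\<psi>2 x = \<psi> x" using elim by simp
      moreover have "\<bar>\<psi> x\<bar> \<le> \<bar>C\<bar>" using \<psi>(2)[OF x] by linarith
      ultimately show "\<psi> x = \<psi>3 x" by (simp add: \<psi>3_def)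
    qed
  qed
  then have "AE x in ?M. \<psi> x = \<psi>3 x"
    using Ul by (subst AE_restrict_space_iff) auto
  then have "(\<integral>x. \<psi> x *\<^sub>R c n x \<partial>?M) = (\<integral>x. \<psi>3 x *\<^sub>R c n x \<partial>?M)" for n
    by (intro integral_cong_AE borel_measurable_scaleR \<psi> cm bl \<psi>3) auto
  then show ?thesis using \<open>P \<psi>3\<close> by (simp add: P_def)
qed

text \<open>For a constant sequence, convergence to 0 is equality with 0. The sign of a component of
  \<open>w\<close> then becomes an admissible multiplier and makes the integral of its absolute
  value vanish.\<close>

lemma test_zero_imp_AE_zero_integrable:
  fixes w :: "real ^ 'm \<Rightarrow> 'v::euclidean_space"
  assumes U: "open U" and w: "integrable (lebesgue_on U) w"
    and test: "\<And>\<phi>. \<phi> \<in> test_functions U \<Longrightarrow> (\<integral>x. \<phi> x *\<^sub>R w x \<partial>lebesgue_on U) = 0"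
  shows "AE x in lebesgue_on U. w x = 0"
proof -
  have z: "(\<integral>x. \<psi> x *\<^sub>R w x \<partial>lebesgue_on U) = 0"
    if "\<psi> \<in> borel_measurable (lebesgue_on U)" "\<And>x. x \<in> U \<Longrightarrow> \<bar>\<psi> x\<bar> \<le> 1" for \<psi>
  proof -
    have "(\<lambda>n::nat. \<integral>x. \<psi> x *\<^sub>R w x \<partial>lebesgue_on U) \<longlonglongrightarrow> 0"
      by (rule test_limit_bounded[OF U, where w = "\<lambda>x. norm (w x)" and C = 1])
        (use w test that in auto)
    then show ?thesis by (simp add: LIMSEQ_const_iff)
  qed
  have "AE x in lebesgue_on U. w x \<bullet> b = 0" for b
  proof -
    define s where "s = (\<lambda>x. sgn (w x \<bullet> b))"
    have s: "s \<in> borel_measurable (lebesgue_on U)"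
      using w unfolding s_def by measurable
    have s1: "\<bar>s x\<bar> \<le> 1" for x by (simp add: s_def sgn_if)
    have i: "integrable (lebesgue_on U) (\<lambda>x. s x *\<^sub>R w x)"
      by (rule integrable_scaleR_bounded[OF w s s1])
    have "(\<integral>x. \<bar>w x \<bullet> b\<bar> \<partial>lebesgue_on U) = (\<integral>x. (s x *\<^sub>R w x) \<bullet> b \<partial>lebesgue_on U)"
      by (intro Bochner_Integration.integral_cong) (auto simp: s_def sgn_if)
    also have "\<dots> = (\<integral>x. s x *\<^sub>R w x \<partial>lebesgue_on U) \<bullet> b"
      by (rule integral_inner_left) (use i in auto)
    also have "\<dots> = 0" using z[OF s s1] by simp
    finally show ?thesis
      using w by (subst (asm) integral_nonneg_eq_0_iff_AE) auto
  qed
  then have "AE x in lebesgue_on U. \<forall>b\<in>Basis. w x \<bullet> b = 0"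
    by (subst AE_finite_all) auto
  then show ?thesis by eventually_elim (simp add: euclidean_all_zero_iff)
qed

text \<open>Local integrability is enough because \<open>U\<close> is a countable union of boxes
  with closure in \<open>U\<close>, and a test function of such a box is one of
  \<open>U\<close>.\<close>

lemma test_zero_imp_AE_zero:
  fixes w :: "real ^ 'm \<Rightarrow> 'v::euclidean_space"
  assumes U: "open U" and w: "locally_integrable_on U w"
    and test: "\<And>\<phi>. \<phi> \<in> test_functions U \<Longrightarrow> (\<integral>x. \<phi> x *\<^sub>R w x \<partial>lebesgue_on U) = 0"
  shows "AE x in lebesgue_on U. w x = 0"
proof -
  let ?F = "{B. \<exists>a b. B = box a b \<and> cbox a b \<subseteq> U}"
  have opF: "\<And>B. B \<in> ?F \<Longrightarrow> open B" by (auto simp: open_box)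
  obtain F where F: "F \<subseteq> ?F" "countable F" "\<Union>F = \<Union>?F"
    by (rule Lindelof[OF opF])
  have "U \<subseteq> \<Union>?F"
  proof
    fix x assume x: "x \<in> U"
    obtain a b where "cbox a b \<subseteq> U" "x \<in> box a b"
      by (rule open_contains_cbox[OF U x])
    then show "x \<in> \<Union>?F" by blast
  qed
  then have FU: "U \<subseteq> \<Union>F" using F(3) by auto
  have "AE x in lebesgue. x \<in> B \<longrightarrow> w x = 0" if B: "B \<in> F" for B
  proof -
    obtain a b where ab: "B = box a b" "cbox a b \<subseteq> U" using B F(1) by auto
    have BU: "B \<subseteq> U" using ab box_subset_cbox by blast
    have "AE x in lebesgue_on B. w x = 0"
    proof (rule test_zero_imp_AE_zero_integrable)
      show "open B" by (simp add: ab open_box)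
      show "integrable (lebesgue_on B) w"
        by (rule integrable_lebesgue_on_subset[of "cbox a b"])
          (use w ab box_subset_cbox[of a b] in \<open>simp_all add: locally_integrable_on_def\<close>)
      fix \<phi> assume \<phi>: "\<phi> \<in> test_functions B"
      obtain K where K: "K \<subseteq> B" "\<And>x. x \<notin> K \<Longrightarrow> \<phi> x = 0"
        using test_functionE[OF \<phi>] by metis
      have "(\<integral>x. \<phi> x *\<^sub>R w x \<partial>lebesgue_on U) = (\<integral>x. \<phi> x *\<^sub>R w x \<partial>lebesgue_on B)"
        by (rule integral_lebesgue_on_support(1)) (use K U BU ab in auto)
      then show "(\<integral>x. \<phi> x *\<^sub>R w x \<partial>lebesgue_on B) = 0"
        using test test_functions_mono[OF BU] \<phi> by auto
    qed
    then show ?thesis by (subst (asm) AE_restrict_space_iff) (auto simp: ab)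
  qed
  then have "AE x in lebesgue. \<forall>B\<in>F. x \<in> B \<longrightarrow> w x = 0"
    using F(2) by (subst AE_ball_countable) auto
  then have "AE x in lebesgue. x \<in> U \<longrightarrow> w x = 0"
    by eventually_elim (use FU in auto)
  then show ?thesis using U by (subst AE_restrict_space_iff) auto
qed

section \<open>Difference quotients and chain rules\<close>

lemma lborel_translate:
  fixes f :: "'a::euclidean_space \<Rightarrow> 'v::euclidean_space"
  assumes f: "f \<in> borel_measurable borel"
  shows "(\<integral>x. f (x + t) \<partial>lborel) = (\<integral>x. f x \<partial>lborel)"
    and "integrable lborel (\<lambda>x. f (x + t)) \<longleftrightarrow> integrable lborel f"
proof -
  have m: "(+) t \<in> measurable lborel borel" by simp
  show "(\<integral>x. f (x + t) \<partial>lborel) = (\<integral>x. f x \<partial>lborel)"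
    using integral_distr[OF m, of f] f by (simp add: lborel_distr_plus add.commute)
  show "integrable lborel (\<lambda>x. f (x + t)) \<longleftrightarrow> integrable lborel f"
    using integrable_distr_eq[OF m, of f] f by (simp add: lborel_distr_plus add.commute)
qed

text \<open>Translation invariance makes the replacement errors at \<open>x + t\<close> and at
  \<open>x\<close> equal; hence the factor 2, uniformly in \<open>t\<close>.\<close>

lemma L1_translation_approx:
  fixes f g :: "'a::euclidean_space \<Rightarrow> 'v::euclidean_space"
  assumes f: "integrable lborel f" and g: "integrable lborel g"
  shows "(\<integral>x. norm (f (x + t) - f x) \<partial>lborel) \<le>
           (\<integral>x. norm (g (x + t) - g x) \<partial>lborel) + 2 * (\<integral>x. norm (f x - g x) \<partial>lborel)"
proof -
  have ft: "integrable lborel (\<lambda>x. f (x + t))" and gt: "integrable lborel (\<lambda>x. g (x + t))"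
    using f g by (simp_all add: lborel_translate(2))
  have "(\<integral>x. norm (f (x + t) - f x) \<partial>lborel) \<le>
      (\<integral>x. norm (g (x + t) - g x) + (norm (f (x + t) - g (x + t)) + norm (f x - g x)) \<partial>lborel)"
  proof (rule integral_mono)
    fix x
    have eq: "f (x + t) - f x = (g (x + t) - g x) + ((f (x + t) - g (x + t)) - (f x - g x))" by simp
    have tri: "norm (a + (b - c)) \<le> norm a + (norm b + norm c)" for a b c :: 'v
      using norm_triangle_ineq[of a "b - c"] norm_triangle_ineq4[of b c] by linarith
    show "norm (f (x + t) - f x) \<le> norm (g (x + t) - g x) + (norm (f (x + t) - g (x + t)) + norm (f x - g x))"
      by (subst eq) (rule tri)
  qed (use f g ft gt in auto)
  also have "\<dots> = (\<integral>x. norm (g (x + t) - g x) \<partial>lborel) +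
      ((\<integral>x. norm (f (x + t) - g (x + t)) \<partial>lborel) + (\<integral>x. norm (f x - g x) \<partial>lborel))"
    using f g ft gt by simp
  also have "(\<integral>x. norm (f (x + t) - g (x + t)) \<partial>lborel) = (\<integral>x. norm (f x - g x) \<partial>lborel)"
    using f g by (intro lborel_translate(1)[where f = "\<lambda>x. norm (f x - g x)"]) auto
  finally show ?thesis by simp
qed

lemma L1_translation_limit:
  fixes f :: "'a::euclidean_space \<Rightarrow> 'v::euclidean_space"
  assumes f: "integrable lborel f"
    and approx: "\<And>e. e > 0 \<Longrightarrow> \<exists>g. integrable lborel g \<and> (\<integral>x. norm (f x - g x) \<partial>lborel) < e \<and>
                   (\<lambda>n. \<integral>x. norm (g (x + t n) - g x) \<partial>lborel) \<longlonglongrightarrow> 0"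
  shows "(\<lambda>n. \<integral>x. norm (f (x + t n) - f x) \<partial>lborel) \<longlonglongrightarrow> 0"
proof (rule LIMSEQ_I)
  fix e :: real assume e: "e > 0"
  obtain g where g: "integrable lborel g" "(\<integral>x. norm (f x - g x) \<partial>lborel) < e / 4"
    "(\<lambda>n. \<integral>x. norm (g (x + t n) - g x) \<partial>lborel) \<longlonglongrightarrow> 0"
    using approx[of "e / 4"] e by auto
  obtain N where N: "\<And>n. n \<ge> N \<Longrightarrow> norm (\<integral>x. norm (g (x + t n) - g x) \<partial>lborel) < e / 2"
    using LIMSEQ_D[OF g(3), of "e / 2"] e by auto
  show "\<exists>N. \<forall>n\<ge>N. norm ((\<integral>x. norm (f (x + t n) - f x) \<partial>lborel) - 0) < e"
  proof (intro exI allI impI)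
    fix n assume "n \<ge> N"
    moreover have "(\<integral>x. norm (f (x + t n) - f x) \<partial>lborel) \<ge> 0" by simp
    ultimately show "norm ((\<integral>x. norm (f (x + t n) - f x) \<partial>lborel) - 0) < e"
      using L1_translation_approx[OF f g(1), of "t n"] N[of n] g(2) by simp
  qed
qed

text \<open>By translation invariance the positive and negative parts of the increment have the same
  integral, so only the points that the translation moves out of \<open>U\<close> count. Each point
  of the open set eventually stays inside, and the indicator of \<open>U\<close> dominates; the
  boundary never has to be examined.\<close>

lemma L1_translation_continuous_open:
  fixes U :: "'a::euclidean_space set"
  assumes U: "open U" "emeasure lborel U < \<infinity>" and t: "t \<longlonglongrightarrow> 0"
  shows "(\<lambda>n. \<integral>x. \<bar>indicator U (x + t n) - indicator U x\<bar> \<partial>lborel) \<longlonglongrightarrow> (0::real)"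
proof -
  let ?i = "indicator U :: 'a \<Rightarrow> real"
  have Ub: "U \<in> sets borel" using U by simp
  have i: "integrable lborel ?i" using U by simp
  have it: "integrable lborel (\<lambda>x. ?i (x + s))" for s
    using i by (subst lborel_translate(2)) auto
  have eq: "(\<integral>x. \<bar>?i (x + s) - ?i x\<bar> \<partial>lborel) = 2 * (\<integral>x. max 0 (?i x - ?i (x + s)) \<partial>lborel)" for s
  proof -
    have "(\<integral>x. \<bar>?i (x + s) - ?i x\<bar> \<partial>lborel) = (\<integral>x. 2 * max 0 (?i x - ?i (x + s)) + (?i (x + s) - ?i x) \<partial>lborel)"
      by (rule Bochner_Integration.integral_cong) (auto simp: indicator_def)
    also have "\<dots> = 2 * (\<integral>x. max 0 (?i x - ?i (x + s)) \<partial>lborel) + ((\<integral>x. ?i (x + s) \<partial>lborel) - (\<integral>x. ?i x \<partial>lborel))"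
      using i it[of s] by (simp add: integrable_max)
    also have "(\<integral>x. ?i (x + s) \<partial>lborel) = (\<integral>x. ?i x \<partial>lborel)"
      by (rule lborel_translate(1)) (use Ub in auto)
    finally show ?thesis by simp
  qed
  have "(\<lambda>n. \<integral>x. max 0 (?i x - ?i (x + t n)) \<partial>lborel) \<longlonglongrightarrow> (\<integral>x. 0 \<partial>(lborel :: 'a measure))"
  proof (rule integral_dominated_convergence[where w = ?i])
    show "AE x in lborel. (\<lambda>n. max 0 (?i x - ?i (x + t n))) \<longlonglongrightarrow> 0"
    proof (rule AE_I2)
      fix x
      show "(\<lambda>n. max 0 (?i x - ?i (x + t n))) \<longlonglongrightarrow> 0"
      proof (cases "x \<in> U")
        case True
        have "(\<lambda>n. x + t n) \<longlonglongrightarrow> x" using tendsto_add[OF tendsto_const t, of x] by simp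
        from topological_tendstoD[OF this U(1) True]
        have "eventually (\<lambda>n. max 0 (?i x - ?i (x + t n)) = 0) sequentially"
          by eventually_elim (simp add: True)
        then show ?thesis by (rule tendsto_eventually)
      next
        case False
        then have "max 0 (?i x - ?i (x + t n)) = 0" for n by (simp add: indicator_def)
        then show ?thesis by simp
      qed
    qed
    show "AE x in lborel. norm (max 0 (?i x - ?i (x + t n))) \<le> ?i x" for n
      by (rule AE_I2) (auto simp: indicator_def)
    show "(\<lambda>x. max 0 (?i x - ?i (x + t n))) \<in> borel_measurable lborel" for n
      using i it[of "t n"] by (intro borel_measurable_integrable integrable_max) auto
  qed (use i in auto)
  from tendsto_mult_left[OF this, of 2] show ?thesis
    unfolding eq by simp
qed

text \<open>Outer regularity leads from open sets to Borel sets of finite measure; additivity and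
  approximation in L^1 do the rest.\<close>

lemma L1_translation_continuous:
  fixes f :: "'a::euclidean_space \<Rightarrow> 'v::euclidean_space"
  assumes f: "integrable lborel f" and t: "t \<longlonglongrightarrow> 0"
  shows "(\<lambda>n. \<integral>x. norm (f (x + t n) - f x) \<partial>lborel) \<longlonglongrightarrow> 0"
  using f
proof (induction f rule: integrable_induct)
  case (base A c)
  have Ai: "integrable lborel (\<lambda>x. indicator A x *\<^sub>R c)"
    using base by (intro integrable_scaleR_left) auto
  show ?case
  proof (rule L1_translation_limit[OF Ai])
    fix e :: real assume e: "e > 0"
    \<comment> \<open>The summand 1 covers \<open>c = 0\<close>.\<close>
    define e' where "e' = e / (norm c + 1)"
    have e': "e' > 0" using e by (simp add: e'_def add_nonneg_pos)
    obtain U where U: "open U" "A \<subseteq> U" "emeasure lborel (U - A) < e'"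
      using outer_regular_lborel[of A e'] base e' by auto
    have UA: "U - A \<in> sets lborel" using U base by auto
    have "emeasure lborel U \<le> emeasure lborel A + emeasure lborel (U - A)"
      using U(2) base(1) UA by (metis Un_Diff_cancel emeasure_subadditive sup.absorb2)
    then have Ufin: "emeasure lborel U < \<infinity>"
      using base(2) U(3) by (metis ennreal_add_less_top ennreal_less_top infinity_ennreal_def order.strict_trans1 order.strict_trans)
    have Ui: "integrable lborel (\<lambda>x. indicator U x *\<^sub>R c)"
      using U(1) Ufin by (intro integrable_scaleR_left) auto
    have "(\<integral>x. norm (indicator A x *\<^sub>R c - indicator U x *\<^sub>R c) \<partial>lborel) = (\<integral>x. indicator (U - A) x * norm c \<partial>lborel)"
      using U(2) by (intro Bochner_Integration.integral_cong) (auto simp: indicator_def)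
    also have "\<dots> = measure lborel (U - A) * norm c" using UA by simp
    also have "\<dots> \<le> e' * norm c"
      using U(3) e' by (intro mult_right_mono) (auto simp: measure_def enn2real_leI)
    also have "\<dots> < e' * (norm c + 1)" using e' by (intro mult_strict_left_mono) auto
    also have "norm c + 1 \<noteq> 0" using norm_ge_zero[of c] by linarith
    then have "e' * (norm c + 1) = e" by (simp add: e'_def)
    finally have 1: "(\<integral>x. norm (indicator A x *\<^sub>R c - indicator U x *\<^sub>R c) \<partial>lborel) < e" .
    have "(\<lambda>n. (\<integral>x. \<bar>indicator U (x + t n) - indicator U x :: real\<bar> \<partial>lborel) * norm c) \<longlonglongrightarrow> 0 * norm c"
      by (intro tendsto_mult_right L1_translation_continuous_open U(1) Ufin t)
    moreover have "(\<lambda>n. (\<integral>x. \<bar>indicator U (x + t n) - indicator U x :: real\<bar> \<partial>lborel) * norm c) =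
       (\<lambda>n. \<integral>x. norm (indicator U (x + t n) *\<^sub>R c - indicator U x *\<^sub>R c) \<partial>lborel)"
      by (simp add: scaleR_left_diff_distrib[symmetric])
    ultimately show "\<exists>g. integrable lborel g \<and> (\<integral>x. norm (indicator A x *\<^sub>R c - g x) \<partial>lborel) < e \<and>
                   (\<lambda>n. \<integral>x. norm (g (x + t n) - g x) \<partial>lborel) \<longlonglongrightarrow> 0"
      using 1 Ui by (intro exI[of _ "\<lambda>x. indicator U x *\<^sub>R c"]) auto
  qed
next
  case (add f g)
  have fi: "integrable lborel f" "integrable lborel g" by fact+
  have lims: "(\<lambda>n. \<integral>x. norm (f (x + t n) - f x) \<partial>lborel) \<longlonglongrightarrow> 0"
    "(\<lambda>n. \<integral>x. norm (g (x + t n) - g x) \<partial>lborel) \<longlonglongrightarrow> 0" by fact+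
  have t': "integrable lborel (\<lambda>x. f (x + s))" "integrable lborel (\<lambda>x. g (x + s))" for s
    using fi by (simp_all add: lborel_translate(2))
  show ?case
  proof (rule tendsto_sandwich[OF _ _ tendsto_const])
    show "\<forall>\<^sub>F n in sequentially. 0 \<le> (\<integral>x. norm (f (x + t n) + g (x + t n) - (f x + g x)) \<partial>lborel)"
      by simp
    show "\<forall>\<^sub>F n in sequentially. (\<integral>x. norm (f (x + t n) + g (x + t n) - (f x + g x)) \<partial>lborel)
      \<le> (\<integral>x. norm (f (x + t n) - f x) \<partial>lborel) + (\<integral>x. norm (g (x + t n) - g x) \<partial>lborel)"
    proof (rule always_eventually, rule allI)
      fix n
      have "(\<integral>x. norm (f (x + t n) + g (x + t n) - (f x + g x)) \<partial>lborel) \<le>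
        (\<integral>x. norm (f (x + t n) - f x) + norm (g (x + t n) - g x) \<partial>lborel)"
        using fi t' by (intro integral_mono) (auto simp: norm_diff_triangle_ineq)
      then show "(\<integral>x. norm (f (x + t n) + g (x + t n) - (f x + g x)) \<partial>lborel)
      \<le> (\<integral>x. norm (f (x + t n) - f x) \<partial>lborel) + (\<integral>x. norm (g (x + t n) - g x) \<partial>lborel)"
        using fi t' by simp
    qed
    show "(\<lambda>n. (\<integral>x. norm (f (x + t n) - f x) \<partial>lborel) + (\<integral>x. norm (g (x + t n) - g x) \<partial>lborel)) \<longlonglongrightarrow> 0"
      using tendsto_add[OF lims] by simp
  qed
next
  case (lim f s)
  show ?case
  proof (rule L1_translation_limit[OF lim(4)])
    fix e :: real assume e: "e > 0"
    have "(\<lambda>i. \<integral>x. norm (f x - s i x) \<partial>lborel) \<longlonglongrightarrow> (\<integral>x. 0 \<partial>(lborel :: 'a measure))"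
    proof (rule integral_dominated_convergence[where w = "\<lambda>x. 3 * norm (f x)"])
      show "AE x in lborel. (\<lambda>i. norm (f x - s i x)) \<longlonglongrightarrow> 0"
      proof (rule AE_I2)
        fix x
        show "(\<lambda>i. norm (f x - s i x)) \<longlonglongrightarrow> 0"
          using tendsto_norm[OF tendsto_diff[OF tendsto_const[of "f x"] lim(2)[of x]]] by simp
      qed
      show "AE x in lborel. norm (norm (f x - s i x)) \<le> 3 * norm (f x)" for i
      proof (rule AE_I2)
        fix x
        show "norm (norm (f x - s i x)) \<le> 3 * norm (f x)"
          using lim(3)[of x i] norm_triangle_ineq4[of "f x" "s i x"] by simp
      qed
    qed (use lim(1,4) in auto)
    then have "eventually (\<lambda>i. (\<integral>x. norm (f x - s i x) \<partial>lborel) < e) sequentially"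
      using order_tendstoD(2)[of _ 0 sequentially e] e by simp
    then obtain i where "(\<integral>x. norm (f x - s i x) \<partial>lborel) < e"
      by (auto simp: eventually_sequentially)
    then show "\<exists>g. integrable lborel g \<and> (\<integral>x. norm (f x - g x) \<partial>lborel) < e \<and>
                   (\<lambda>n. \<integral>x. norm (g (x + t n) - g x) \<partial>lborel) \<longlonglongrightarrow> 0"
      using lim(1,5) by blast
  qed
qed

section \<open>Increments of weakly differentiable functions\<close>

text \<open>The form in which Fubini is justified below: the slices are built from translates of one
  function, so their L^1 norms share a bound \<open>B\<close>, and \<open>s\<close> is confined to
  an interval of length 1.\<close>

lemma integrable_strip:
  fixes f :: "real \<Rightarrow> 'a::euclidean_space \<Rightarrow> 'v::euclidean_space"
  assumes m: "case_prod f \<in> borel_measurable (borel \<Otimes>\<^sub>M borel)"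
    and i: "\<And>s. integrable lborel (f s)" and B: "\<And>s. (\<integral>y. norm (f s y) \<partial>lborel) \<le> B"
  shows "integrable (lborel \<Otimes>\<^sub>M lborel) (\<lambda>(s, y). indicator {0..1} s *\<^sub>R f s y)"
proof (rule lborel_pair.Fubini_integrable)
  have m': "case_prod f \<in> borel_measurable (lborel \<Otimes>\<^sub>M lborel)"
    using m by simp
  show meas: "(\<lambda>(s, y). indicator {0..1} s *\<^sub>R f s y) \<in> borel_measurable (lborel \<Otimes>\<^sub>M lborel)"
    using m' by measurable
  have "(\<lambda>s. \<integral>y. norm (f s y) \<partial>lborel) \<in> borel_measurable lborel"
    using m' by measurable
  then have mn: "(\<lambda>s. indicator {0..1::real} s *\<^sub>R (\<integral>y. norm (f s y) \<partial>lborel)) \<in> borel_measurable lborel"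
    by measurable
  have "integrable lborel (\<lambda>s. indicator {0..1::real} s *\<^sub>R (\<integral>y. norm (f s y) \<partial>lborel))"
  proof (rule Bochner_Integration.integrable_bound[OF _ mn])
    show "integrable lborel (\<lambda>s. indicator {0..1::real} s *\<^sub>R B)"
      by (intro integrable_scaleR_left) simp
    show "AE s in lborel. norm (indicator {0..1::real} s *\<^sub>R (\<integral>y. norm (f s y) \<partial>lborel))
        \<le> norm (indicator {0..1::real} s *\<^sub>R B)"
    proof (rule AE_I2)
      fix s
      have "0 \<le> (\<integral>y. norm (f s y) \<partial>lborel)" by simp
      then show "norm (indicator {0..1::real} s *\<^sub>R (\<integral>y. norm (f s y) \<partial>lborel))
        \<le> norm (indicator {0..1::real} s *\<^sub>R B)"
        using B[of s] by (auto simp: indicator_def)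
    qed
  qed
  then show "integrable lborel (\<lambda>s. \<integral>y. norm (case (s, y) of (s, y) \<Rightarrow> indicator {0..1::real} s *\<^sub>R f s y) \<partial>lborel)"
    by simp
  show "AE s in lborel. integrable lborel (\<lambda>y. case (s, y) of (s, y) \<Rightarrow> indicator {0..1::real} s *\<^sub>R f s y)"
    using i by simp
qed

lemma integral_lebesgue_on_eq_lborel:
  fixes f :: "'a::euclidean_space \<Rightarrow> 'v::euclidean_space"
  assumes "f \<in> borel_measurable borel" "\<And>x. x \<notin> S \<Longrightarrow> f x = 0" "S \<in> sets lebesgue"
  shows "integral\<^sup>L (lebesgue_on S) f = integral\<^sup>L lborel f"
proof -
  have "(\<lambda>x. indicator S x *\<^sub>R f x) = f" using assms(2) by (auto simp: indicator_def)
  then show ?thesis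
    using assms by (simp add: integral_restrict_space integral_completion)
qed

lemma integrable_lborel_imp_lebesgue_on:
  fixes f :: "'a::euclidean_space \<Rightarrow> 'v::euclidean_space"
  assumes "integrable lborel f" "S \<in> sets lebesgue"
  shows "integrable (lebesgue_on S) f"
proof -
  have "integrable lebesgue f"
    using assms(1) by (simp add: integrable_completion)
  then have "integrable lebesgue (\<lambda>x. indicator S x *\<^sub>R f x)"
    using integrable_mult_indicator[OF assms(2)] by blast
  then show ?thesis using assms(2) by (simp add: integrable_restrict_space)
qed

lemma AE_lebesgue_on_iff_lborel:
  assumes "S \<in> sets lebesgue"
  shows "(AE x in lebesgue_on S. P x) \<longleftrightarrow> (AE x in lborel. x \<in> S \<longrightarrow> P x)"
  using assms by (simp add: AE_restrict_space_iff AE_completion_iff)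

text \<open>The fundamental theorem of calculus along a segment. The integral form both bounds
  difference quotients uniformly and can be exchanged with integration over the base point.\<close>

lemma test_function_increment:
  fixes \<phi> :: "real ^ 'm \<Rightarrow> real"
  assumes \<phi>: "\<phi> \<in> test_functions U"
  shows "\<phi> (y - h *\<^sub>R axis k 1) - \<phi> y =
    - h * (\<integral>s. partial_deriv k \<phi> (y - (s * h) *\<^sub>R axis k 1) * indicator {0..1} s \<partial>lborel)"
proof -
  define F where "F = (\<lambda>s. \<phi> (y - (s * h) *\<^sub>R axis k 1))"
  define G where "G = (\<lambda>s. - h * partial_deriv k \<phi> (y - (s * h) *\<^sub>R axis k 1))"
  have D: "(F has_real_derivative G s) (at s)" for s
  proof -
    let ?y = "y - (s * h) *\<^sub>R axis k 1"
    have d: "(\<phi> has_derivative frechet_derivative \<phi> (at ?y)) (at ?y)"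
      using test_function_continuous(3)[OF \<phi>] frechet_derivative_works by blast
    have "((\<lambda>s. y - (s * h) *\<^sub>R axis k 1) has_derivative (\<lambda>r. - ((r * h) *\<^sub>R axis k 1))) (at s)"
      by (auto intro!: derivative_eq_intros)
    from has_derivative_compose[OF this d]
    have "(F has_derivative (\<lambda>r. frechet_derivative \<phi> (at ?y) (- ((r * h) *\<^sub>R axis k 1)))) (at s)"
      unfolding F_def .
    moreover have "frechet_derivative \<phi> (at ?y) (- ((r * h) *\<^sub>R axis k 1)) = G s * r" for r
    proof -
      have lin: "linear (frechet_derivative \<phi> (at ?y))"
        using d has_derivative_linear by blast
      show ?thesis
        by (simp add: linear_neg[OF lin] linear_scale[OF lin] G_def partial_deriv_def)
    qed
    ultimately show ?thesis
      by (simp add: has_field_derivative_def)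
  qed
  have c: "isCont G s" for s
  proof -
    have "continuous_on UNIV G"
      unfolding G_def
      by (intro continuous_intros continuous_on_compose2[OF test_function_continuous(2)[OF \<phi>]]) auto
    then show ?thesis by (simp add: continuous_on_eq_continuous_at)
  qed
  have "(\<integral>s. G s * indicator {0..1} s \<partial>lborel) = F 1 - F 0"
    by (rule integral_FTC_Icc_real) (use D c in auto)
  then show ?thesis by (simp add: F_def G_def mult.assoc)
qed

text \<open>The fundamental theorem of calculus in a coordinate direction, by duality: the increment
  is moved to the test function, where it is classical; for each \<open>s\<close> the translated
  test function admits the weak derivative; Fubini moves everything back.\<close>

lemma increment_eq_integral_weak_partial:
  fixes u v :: "real ^ 'm \<Rightarrow> 'v::euclidean_space"
  assumes u: "integrable lborel u" and v: "integrable lborel v"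
    and weak: "\<And>\<phi>. \<phi> \<in> test_functions U \<Longrightarrow>
      (\<integral>x. partial_deriv k \<phi> x *\<^sub>R u x \<partial>lborel) = - (\<integral>x. \<phi> x *\<^sub>R v x \<partial>lborel)"
    and S: "open S" "\<And>x s. x \<in> S \<Longrightarrow> \<bar>s\<bar> \<le> \<bar>h\<bar> \<Longrightarrow> x + s *\<^sub>R axis k 1 \<in> U"
  shows "AE x in lborel. x \<in> S \<longrightarrow> u (x + h *\<^sub>R axis k 1) - u x =
           h *\<^sub>R (\<integral>s. indicator {0..1} s *\<^sub>R v (x + (s * h) *\<^sub>R axis k 1) \<partial>lborel)"
proof -
  let ?e = "axis k 1 :: real ^ 'm"
  have um [measurable]: "u \<in> borel_measurable borel" and vm [measurable]: "v \<in> borel_measurable borel"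
    using u v by auto
  define G where "G = (\<lambda>x. \<integral>s. indicator {0..1} s *\<^sub>R v (x + (s * h) *\<^sub>R ?e) \<partial>lborel)"
  have vi: "integrable lborel (\<lambda>x. v (x + s))" for s using v by (simp add: lborel_translate(2))
  have int_v: "integrable (lborel \<Otimes>\<^sub>M lborel) (\<lambda>(s, x). indicator {0..1} s *\<^sub>R (\<psi> x *\<^sub>R v (x + (s * h) *\<^sub>R ?e)))"
    if \<psi>: "\<psi> \<in> borel_measurable borel" "\<And>x. \<bar>\<psi> x\<bar> \<le> C" for \<psi> C
  proof (rule integrable_strip)
    show "(\<lambda>(s, x). \<psi> x *\<^sub>R v (x + (s * h) *\<^sub>R ?e)) \<in> borel_measurable (borel \<Otimes>\<^sub>M borel)"
      using \<psi>(1) by measurable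
    fix s
    show i: "integrable lborel (\<lambda>x. \<psi> x *\<^sub>R v (x + (s * h) *\<^sub>R ?e))"
      by (rule integrable_scaleR_bounded[OF vi, where C = C]) (use \<psi> in auto)
    have "(\<integral>x. norm (\<psi> x *\<^sub>R v (x + (s * h) *\<^sub>R ?e)) \<partial>lborel) \<le> (\<integral>x. C * norm (v (x + (s * h) *\<^sub>R ?e)) \<partial>lborel)"
      using \<psi>(2) by (intro integral_mono integrable_norm[OF i] integrable_mult_right integrable_norm[OF vi])
        (simp add: mult_right_mono)
    also have "\<dots> = C * (\<integral>x. norm (v x) \<partial>lborel)"
      using lborel_translate(1)[where f = "\<lambda>x. norm (v x)"] by simp
    finally show "(\<integral>x. norm (\<psi> x *\<^sub>R v (x + (s * h) *\<^sub>R ?e)) \<partial>lborel) \<le> C * (\<integral>x. norm (v x) \<partial>lborel)" .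
  qed
  have Gi: "integrable lborel G"
    using lborel_pair.integrable_snd[OF int_v[of "\<lambda>_. 1" 1]] by (simp add: G_def)
  have Gm [measurable]: "G \<in> borel_measurable borel" using Gi by auto
  have uti: "integrable lborel (\<lambda>x. u (x + h *\<^sub>R ?e))"
    using u by (simp add: lborel_translate(2))
  define w where "w = (\<lambda>x. u (x + h *\<^sub>R ?e) - u x - h *\<^sub>R G x)"
  have wi: "integrable lborel w"
    unfolding w_def using u uti Gi by auto
  have Sl: "S \<in> sets lebesgue" using S(1) by auto
  have "AE x in lebesgue_on S. w x = 0"
  proof (rule test_zero_imp_AE_zero_integrable[OF S(1) integrable_lborel_imp_lebesgue_on[OF wi Sl]])
    fix \<psi> assume \<psi>: "\<psi> \<in> test_functions S"
    have \<psi>m [measurable]: "\<psi> \<in> borel_measurable borel" "partial_deriv k \<psi> \<in> borel_measurable borel"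
      using test_function_borel[OF \<psi>] by auto
    obtain K C where KC: "K \<subseteq> S" "\<And>x. x \<notin> K \<Longrightarrow> \<psi> x = 0" "\<And>x. \<bar>\<psi> x\<bar> \<le> C" "\<And>k x. \<bar>partial_deriv k \<psi> x\<bar> \<le> C"
      by (rule test_functionE[OF \<psi>]) blast
    have sh: "\<bar>s * h\<bar> \<le> \<bar>h\<bar>" if "s \<in> {0..1}" for s
      using that by (simp add: abs_mult mult_left_le_one_le)
    have \<psi>i: "integrable lborel (\<lambda>x. \<psi> x *\<^sub>R f x)" if "integrable lborel f" for f :: "real ^ 'm \<Rightarrow> 'v"
      by (rule integrable_scaleR_bounded[OF that, where C = C]) (use KC in auto)
    have 1: "(\<integral>x. \<psi> x *\<^sub>R u (x + h *\<^sub>R ?e) \<partial>lborel) = (\<integral>y. \<psi> (y - h *\<^sub>R ?e) *\<^sub>R u y \<partial>lborel)"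
      using lborel_translate(1)[of "\<lambda>y. \<psi> (y - h *\<^sub>R ?e) *\<^sub>R u y" "h *\<^sub>R ?e"] by simp
    have u\<psi>: "integrable lborel (\<lambda>y. \<psi> (y - h *\<^sub>R ?e) *\<^sub>R u y)"
      by (rule integrable_scaleR_bounded[OF u, where C = C]) (use KC in auto)
    have int_u: "integrable (lborel \<Otimes>\<^sub>M lborel)
        (\<lambda>(s, y). indicator {0..1} s *\<^sub>R (partial_deriv k \<psi> (y - (s * h) *\<^sub>R ?e) *\<^sub>R u y))"
    proof (rule integrable_strip)
      show "(\<lambda>(s, y). partial_deriv k \<psi> (y - (s * h) *\<^sub>R ?e) *\<^sub>R u y) \<in> borel_measurable (borel \<Otimes>\<^sub>M borel)"
        by measurable
      fix s
      show i: "integrable lborel (\<lambda>y. partial_deriv k \<psi> (y - (s * h) *\<^sub>R ?e) *\<^sub>R u y)"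
        by (rule integrable_scaleR_bounded[OF u, where C = C]) (use KC in auto)
      show "(\<integral>y. norm (partial_deriv k \<psi> (y - (s * h) *\<^sub>R ?e) *\<^sub>R u y) \<partial>lborel) \<le> (\<integral>y. C * norm (u y) \<partial>lborel)"
        using KC(4) by (intro integral_mono integrable_norm[OF i] integrable_mult_right integrable_norm[OF u])
          (simp add: mult_right_mono)
    qed
    \<comment> \<open>Here \<open>S\<close> must keep distance \<open>\<bar>h\<bar>\<close> from the
      complement of \<open>U\<close> in direction \<open>k\<close>: a test function of
      \<open>S\<close>, moved by \<open>s * h\<close>, must be a test function of
      \<open>U\<close>.\<close>
    have slice: "(\<integral>y. partial_deriv k \<psi> (y - (s * h) *\<^sub>R ?e) *\<^sub>R u y \<partial>lborel) =
        - (\<integral>x. \<psi> x *\<^sub>R v (x + (s * h) *\<^sub>R ?e) \<partial>lborel)" if s: "s \<in> {0..1}" for s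
    proof -
      have t: "(\<lambda>x. \<psi> (x - (s * h) *\<^sub>R ?e)) \<in> test_functions U"
        by (rule test_function_translate(1)[OF \<psi>]) (use S(2) sh[OF s] in auto)
      have "(\<integral>y. partial_deriv k \<psi> (y - (s * h) *\<^sub>R ?e) *\<^sub>R u y \<partial>lborel) =
          (\<integral>y. partial_deriv k (\<lambda>x. \<psi> (x - (s * h) *\<^sub>R ?e)) y *\<^sub>R u y \<partial>lborel)"
        using test_function_translate(2)[OF \<psi>, of "(s * h) *\<^sub>R ?e" U] S(2) sh[OF s]
        by (subst test_function_translate(2)[OF \<psi>, of "(s * h) *\<^sub>R ?e" U]) auto
      also have "\<dots> = - (\<integral>y. \<psi> (y - (s * h) *\<^sub>R ?e) *\<^sub>R v y \<partial>lborel)"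
        by (rule weak[OF t])
      also have "(\<integral>y. \<psi> (y - (s * h) *\<^sub>R ?e) *\<^sub>R v y \<partial>lborel) = (\<integral>x. \<psi> x *\<^sub>R v (x + (s * h) *\<^sub>R ?e) \<partial>lborel)"
        using lborel_translate(1)[of "\<lambda>y. \<psi> (y - (s * h) *\<^sub>R ?e) *\<^sub>R v y" "(s * h) *\<^sub>R ?e"] by simp
      finally show ?thesis .
    qed
    have "(\<integral>y. \<psi> (y - h *\<^sub>R ?e) *\<^sub>R u y \<partial>lborel) - (\<integral>y. \<psi> y *\<^sub>R u y \<partial>lborel)
        = (\<integral>y. (\<psi> (y - h *\<^sub>R ?e) - \<psi> y) *\<^sub>R u y \<partial>lborel)"
      using u\<psi> \<psi>i[OF u] by (simp add: scaleR_left_diff_distrib)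
    also have "\<dots> = (\<integral>y. - h *\<^sub>R (\<integral>s. indicator {0..1} s *\<^sub>R (partial_deriv k \<psi> (y - (s * h) *\<^sub>R ?e) *\<^sub>R u y) \<partial>lborel) \<partial>lborel)"
    proof (rule Bochner_Integration.integral_cong[OF refl])
      fix y
      have "(\<integral>s. indicator {0..1} s *\<^sub>R (partial_deriv k \<psi> (y - (s * h) *\<^sub>R ?e) *\<^sub>R u y) \<partial>lborel) =
         (\<integral>s. partial_deriv k \<psi> (y - (s * h) *\<^sub>R ?e) * indicator {0..1} s \<partial>lborel) *\<^sub>R u y"
      proof -
        have "integrable lborel (\<lambda>s. partial_deriv k \<psi> (y - (s * h) *\<^sub>R ?e) * indicator {0..1} s)"
        proof -
          have "integrable lborel (indicator {0..1::real} :: real \<Rightarrow> real)" by simp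
          from integrable_scaleR_bounded[OF this, of "\<lambda>s. partial_deriv k \<psi> (y - (s * h) *\<^sub>R ?e)" C] KC(4)
          show ?thesis by simp
        qed
        then show ?thesis
          by (subst integral_scaleR_left[symmetric]) (auto simp: mult.commute)
      qed
      then show "(\<psi> (y - h *\<^sub>R ?e) - \<psi> y) *\<^sub>R u y =
        - h *\<^sub>R (\<integral>s. indicator {0..1} s *\<^sub>R (partial_deriv k \<psi> (y - (s * h) *\<^sub>R ?e) *\<^sub>R u y) \<partial>lborel)"
        unfolding test_function_increment[OF \<psi>] by simp
    qed
    also have "\<dots> = - h *\<^sub>R (\<integral>y. (\<integral>s. indicator {0..1} s *\<^sub>R (partial_deriv k \<psi> (y - (s * h) *\<^sub>R ?e) *\<^sub>R u y) \<partial>lborel) \<partial>lborel)"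
      by (rule integral_scaleR_right)
    also have "(\<integral>y. (\<integral>s. indicator {0..1} s *\<^sub>R (partial_deriv k \<psi> (y - (s * h) *\<^sub>R ?e) *\<^sub>R u y) \<partial>lborel) \<partial>lborel) =
       (\<integral>s. (\<integral>y. indicator {0..1} s *\<^sub>R (partial_deriv k \<psi> (y - (s * h) *\<^sub>R ?e) *\<^sub>R u y) \<partial>lborel) \<partial>lborel)"
      by (rule lborel_pair.Fubini_integral[OF int_u])
    also have "\<dots> = (\<integral>s. (\<integral>x. indicator {0..1} s *\<^sub>R (- (\<psi> x *\<^sub>R v (x + (s * h) *\<^sub>R ?e))) \<partial>lborel) \<partial>lborel)"
      by (rule Bochner_Integration.integral_cong[OF refl]) (use slice in \<open>auto simp: indicator_def\<close>)
    also have "\<dots> = - (\<integral>s. (\<integral>x. indicator {0..1} s *\<^sub>R (\<psi> x *\<^sub>R v (x + (s * h) *\<^sub>R ?e)) \<partial>lborel) \<partial>lborel)"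
      by simp
    also have "(\<integral>s. (\<integral>x. indicator {0..1} s *\<^sub>R (\<psi> x *\<^sub>R v (x + (s * h) *\<^sub>R ?e)) \<partial>lborel) \<partial>lborel) =
        (\<integral>x. (\<integral>s. indicator {0..1} s *\<^sub>R (\<psi> x *\<^sub>R v (x + (s * h) *\<^sub>R ?e)) \<partial>lborel) \<partial>lborel)"
      by (rule lborel_pair.Fubini_integral[OF int_v[OF \<psi>m(1) KC(3)], symmetric])
    also have "\<dots> = (\<integral>x. \<psi> x *\<^sub>R G x \<partial>lborel)"
    proof (rule Bochner_Integration.integral_cong[OF refl])
      fix x
      show "(\<integral>s. indicator {0..1} s *\<^sub>R (\<psi> x *\<^sub>R v (x + (s * h) *\<^sub>R ?e)) \<partial>lborel) = \<psi> x *\<^sub>R G x"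
        unfolding G_def by (subst integral_scaleR_right[symmetric]) (simp add: mult.commute)
    qed
    finally have "(\<integral>x. \<psi> x *\<^sub>R u (x + h *\<^sub>R ?e) \<partial>lborel) - (\<integral>x. \<psi> x *\<^sub>R u x \<partial>lborel)
        - h *\<^sub>R (\<integral>x. \<psi> x *\<^sub>R G x \<partial>lborel) = 0"
      unfolding 1 by simp
    moreover have "(\<integral>x. \<psi> x *\<^sub>R w x \<partial>lborel) = (\<integral>x. \<psi> x *\<^sub>R u (x + h *\<^sub>R ?e) \<partial>lborel) -
        (\<integral>x. \<psi> x *\<^sub>R u x \<partial>lborel) - h *\<^sub>R (\<integral>x. \<psi> x *\<^sub>R G x \<partial>lborel)"
    proof -
      have "\<psi> x *\<^sub>R w x = \<psi> x *\<^sub>R u (x + h *\<^sub>R ?e) - \<psi> x *\<^sub>R u x - h *\<^sub>R (\<psi> x *\<^sub>R G x)" for x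
        by (simp add: w_def scaleR_right_diff_distrib mult.commute)
      then show ?thesis
        using \<psi>i[OF u] \<psi>i[OF uti] \<psi>i[OF Gi] by (simp del: scaleR_scaleR)
    qed
    moreover have "(\<integral>x. \<psi> x *\<^sub>R w x \<partial>lebesgue_on S) = (\<integral>x. \<psi> x *\<^sub>R w x \<partial>lborel)"
      by (rule integral_lebesgue_on_eq_lborel) (use wi KC Sl in auto)
    ultimately show "(\<integral>x. \<psi> x *\<^sub>R w x \<partial>lebesgue_on S) = 0" by simp
  qed
  then have "AE x in lborel. x \<in> S \<longrightarrow> w x = 0"
    using Sl by (simp add: AE_lebesgue_on_iff_lborel)
  then show ?thesis
    by eventually_elim (auto simp: w_def G_def algebra_simps)
qed

text \<open>The difference quotient is an average of \<open>v\<close> over a segment. Its distance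
  from \<open>v\<close> is therefore at most an average of the L^1 modulus of continuity
  \<open>\<omega>\<close> of \<open>v\<close>, which tends to 0.\<close>

lemma difference_quotient_L1_limit:
  fixes u v :: "real ^ 'm \<Rightarrow> 'v::euclidean_space"
  assumes u: "integrable lborel u" and v: "integrable lborel v"
    and weak: "\<And>\<phi>. \<phi> \<in> test_functions U \<Longrightarrow>
      (\<integral>x. partial_deriv k \<phi> x *\<^sub>R u x \<partial>lborel) = - (\<integral>x. \<phi> x *\<^sub>R v x \<partial>lborel)"
    and S: "open S" "\<And>x s. x \<in> S \<Longrightarrow> \<bar>s\<bar> \<le> \<delta> \<Longrightarrow> x + s *\<^sub>R axis k 1 \<in> U"
    and h: "h \<longlonglongrightarrow> 0" "\<And>n. h n \<noteq> 0" "\<And>n. \<bar>h n\<bar> \<le> \<delta>"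
  shows "(\<lambda>n. \<integral>x. indicator S x * norm ((1 / h n) *\<^sub>R (u (x + h n *\<^sub>R axis k 1) - u x) - v x) \<partial>lborel) \<longlonglongrightarrow> 0"
proof -
  let ?e = "axis k 1 :: real ^ 'm"
  have um [measurable]: "u \<in> borel_measurable borel" and vm [measurable]: "v \<in> borel_measurable borel"
    using u v by auto
  have Sb [measurable]: "S \<in> sets borel" using S(1) by simp
  define \<omega> where "\<omega> = (\<lambda>t. \<integral>x. norm (v (x + t *\<^sub>R ?e) - v x) \<partial>lborel)"
  have vi: "integrable lborel (\<lambda>x. v (x + s) - v x)" for s
    using v by (simp add: lborel_translate(2))
  have \<omega>b: "\<omega> t \<le> 2 * (\<integral>x. norm (v x) \<partial>lborel)" for t
    using L1_translation_approx[OF v, of "\<lambda>_. 0"] by (simp add: \<omega>_def)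
  have \<omega>0: "\<omega> t \<ge> 0" for t by (simp add: \<omega>_def)
  have strip: "integrable (lborel \<Otimes>\<^sub>M lborel) (\<lambda>(s, x). indicator {0..1} s *\<^sub>R norm (v (x + (s * r) *\<^sub>R ?e) - v x))" for r
  proof (rule integrable_strip)
    show "(\<lambda>(s, x). norm (v (x + (s * r) *\<^sub>R ?e) - v x)) \<in> borel_measurable (borel \<Otimes>\<^sub>M borel)"
      by measurable
    show "integrable lborel (\<lambda>x. norm (v (x + (s * r) *\<^sub>R ?e) - v x))" for s using vi by simp
    show "(\<integral>y. norm (norm (v (y + (s * r) *\<^sub>R ?e) - v y)) \<partial>lborel) \<le> 2 * (\<integral>x. norm (v x) \<partial>lborel)" for s
      using \<omega>b[of "s * r"] by (simp add: \<omega>_def)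
  qed
  have \<omega>m: "(\<lambda>s. indicator {0..1} s * \<omega> (s * r)) \<in> borel_measurable lborel" for r
    using lborel_pair.integrable_fst'[OF strip[of r]] by (simp add: \<omega>_def borel_measurable_integrable)
  have bound: "(\<integral>x. indicator S x * norm ((1 / r) *\<^sub>R (u (x + r *\<^sub>R ?e) - u x) - v x) \<partial>lborel)
      \<le> (\<integral>s. indicator {0..1} s * \<omega> (s * r) \<partial>lborel)" if r: "r \<noteq> 0" "\<bar>r\<bar> \<le> \<delta>" for r
  proof -
    let ?H = "\<lambda>x. \<integral>s. indicator {0..1} s *\<^sub>R norm (v (x + (s * r) *\<^sub>R ?e) - v x) \<partial>lborel"
    have incr: "AE x in lborel. x \<in> S \<longrightarrow> u (x + r *\<^sub>R ?e) - u x =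
           r *\<^sub>R (\<integral>s. indicator {0..1} s *\<^sub>R v (x + (s * r) *\<^sub>R ?e) \<partial>lborel)"
      by (rule increment_eq_integral_weak_partial[OF u v weak S(1)]) (use S(2) r in auto)
    have "integrable (lborel \<Otimes>\<^sub>M lborel) (\<lambda>(s, x). indicator {0..1} s *\<^sub>R v (x + (s * r) *\<^sub>R ?e))"
    proof (rule integrable_strip)
      show "(\<lambda>(s, x). v (x + (s * r) *\<^sub>R ?e)) \<in> borel_measurable (borel \<Otimes>\<^sub>M borel)"
        by measurable
      show "integrable lborel (\<lambda>x. v (x + (s * r) *\<^sub>R ?e))" for s
        using v by (simp add: lborel_translate(2))
      show "(\<integral>y. norm (v (y + (s * r) *\<^sub>R ?e)) \<partial>lborel) \<le> (\<integral>x. norm (v x) \<partial>lborel)" for s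
        using lborel_translate(1)[where f = "\<lambda>x. norm (v x)"] by simp
    qed
    then have AEv: "AE x in lborel. integrable lborel (\<lambda>s. indicator {0..1} s *\<^sub>R v (x + (s * r) *\<^sub>R ?e))"
      using lborel_pair.AE_integrable_snd by fastforce
    have AEn: "AE x in lborel. integrable lborel (\<lambda>s. indicator {0..1} s *\<^sub>R norm (v (x + (s * r) *\<^sub>R ?e) - v x))"
      using lborel_pair.AE_integrable_snd[OF strip] by simp
    have Hi: "integrable lborel ?H"
      using lborel_pair.integrable_snd[OF strip] by simp
    have i1: "integrable lborel (\<lambda>s. indicator {0..1::real} s *\<^sub>R v x)" for x
      by (intro integrable_scaleR_left) simp
    have "(\<integral>x. indicator S x * norm ((1 / r) *\<^sub>R (u (x + r *\<^sub>R ?e) - u x) - v x) \<partial>lborel) \<le> (\<integral>x. ?H x \<partial>lborel)"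
    proof (rule integral_mono_AE[OF _ Hi])
      have "integrable lborel (\<lambda>x. indicator S x *\<^sub>R norm ((1 / r) *\<^sub>R (u (x + r *\<^sub>R ?e) - u x) - v x))"
        using u v by (intro integrable_mult_indicator integrable_norm Bochner_Integration.integrable_diff integrable_scaleR_right)
          (auto simp: lborel_translate(2))
      then show "integrable lborel (\<lambda>x. indicator S x * norm ((1 / r) *\<^sub>R (u (x + r *\<^sub>R ?e) - u x) - v x))"
        by simp
      show "AE x in lborel. indicator S x * norm ((1 / r) *\<^sub>R (u (x + r *\<^sub>R ?e) - u x) - v x) \<le> ?H x"
        using incr AEv AEn
      proof eventually_elim
        case (elim x)
        show ?case
        proof (cases "x \<in> S")
          case True
          have "(1 / r) *\<^sub>R (u (x + r *\<^sub>R ?e) - u x) - v x =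
            (\<integral>s. indicator {0..1} s *\<^sub>R v (x + (s * r) *\<^sub>R ?e) \<partial>lborel) - (\<integral>s. indicator {0..1::real} s *\<^sub>R v x \<partial>lborel)"
            using elim(1) True r by simp
          also have "\<dots> = (\<integral>s. indicator {0..1} s *\<^sub>R (v (x + (s * r) *\<^sub>R ?e) - v x) \<partial>lborel)"
            using elim(2) i1 by (simp add: scaleR_right_diff_distrib)
          finally have "norm ((1 / r) *\<^sub>R (u (x + r *\<^sub>R ?e) - u x) - v x) \<le>
             (\<integral>s. norm (indicator {0..1} s *\<^sub>R (v (x + (s * r) *\<^sub>R ?e) - v x)) \<partial>lborel)"
            by (simp add: integral_norm_bound del: norm_scaleR)
          then show ?thesis using True by simp
        next
          case False
          then show ?thesis by (simp add: integral_nonneg_AE)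
        qed
      qed
    qed
    also have "(\<integral>x. ?H x \<partial>lborel) = (\<integral>s. (\<integral>x. indicator {0..1} s *\<^sub>R norm (v (x + (s * r) *\<^sub>R ?e) - v x) \<partial>lborel) \<partial>lborel)"
      by (rule lborel_pair.Fubini_integral[OF strip])
    also have "\<dots> = (\<integral>s. indicator {0..1} s * \<omega> (s * r) \<partial>lborel)"
      by (simp add: \<omega>_def)
    finally show ?thesis .
  qed
  have "(\<lambda>n. \<integral>s. indicator {0..1} s * \<omega> (s * h n) \<partial>lborel) \<longlonglongrightarrow> (\<integral>s. 0 \<partial>(lborel :: real measure))"
  proof (rule integral_dominated_convergence[where w = "\<lambda>s. indicator {0..1::real} s * (2 * (\<integral>x. norm (v x) \<partial>lborel))"])
    show "AE s in lborel. (\<lambda>n. indicator {0..1} s * \<omega> (s * h n)) \<longlonglongrightarrow> 0"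
    proof (rule AE_I2)
      fix s :: real
      have "(\<lambda>n. (s * h n) *\<^sub>R ?e) \<longlonglongrightarrow> (s * 0) *\<^sub>R ?e"
        by (intro tendsto_intros h)
      then have "(\<lambda>n. \<omega> (s * h n)) \<longlonglongrightarrow> 0"
        unfolding \<omega>_def by (intro L1_translation_continuous[OF v]) simp
      then show "(\<lambda>n. indicator {0..1} s * \<omega> (s * h n)) \<longlonglongrightarrow> 0"
        by (rule tendsto_mult_right_zero)
    qed
    show "AE s in lborel. norm (indicator {0..1} s * \<omega> (s * h n)) \<le> indicator {0..1} s * (2 * (\<integral>x. norm (v x) \<partial>lborel))" for n
      using \<omega>b \<omega>0 by (intro AE_I2) (auto simp: indicator_def)
    show "integrable lborel (\<lambda>s. indicator {0..1::real} s * (2 * (\<integral>x. norm (v x) \<partial>lborel)))"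
      by simp
  qed (use \<omega>m in auto)
  then have "(\<lambda>n. \<integral>s. indicator {0..1} s * \<omega> (s * h n) \<partial>lborel) \<longlonglongrightarrow> 0" by simp
  then show ?thesis
  proof (rule tendsto_sandwich[OF _ _ tendsto_const, rotated 2])
    show "\<forall>\<^sub>F n in sequentially. 0 \<le> (\<integral>x. indicator S x * norm ((1 / h n) *\<^sub>R (u (x + h n *\<^sub>R ?e) - u x) - v x) \<partial>lborel)"
      by simp
    show "\<forall>\<^sub>F n in sequentially. (\<integral>x. indicator S x * norm ((1 / h n) *\<^sub>R (u (x + h n *\<^sub>R ?e) - u x) - v x) \<partial>lborel)
      \<le> (\<integral>s. indicator {0..1} s * \<omega> (s * h n) \<partial>lborel)"
      using bound h by simp
  qed
qed

section \<open>Borel representatives\<close>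

text \<open>Translations and product measures are treated for Borel functions, so a Lebesgue
  measurable function is first changed on a null set, one coordinate at a time, and extended by
  0.\<close>

lemma lebesgue_on_borel_representative:
  fixes f :: "'a::euclidean_space \<Rightarrow> 'v::euclidean_space"
  assumes f: "f \<in> borel_measurable (lebesgue_on S)" and S: "S \<in> sets borel"
  obtains g where "g \<in> borel_measurable borel" "\<And>x. x \<notin> S \<Longrightarrow> g x = 0"
    "AE x in lebesgue_on S. f x = g x"
proof -
  have Sl: "S \<in> sets lebesgue" using S by simp
  have "\<forall>b. \<exists>g. g \<in> borel_measurable lborel \<and> (AE x in lborel. (if x \<in> S then f x \<bullet> b else 0) = (g x :: real))"
  proof
    fix b
    have "(\<lambda>x. f x \<bullet> b) \<in> borel_measurable (lebesgue_on S)" using f by simp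
    from borel_measurable_if_I[OF this Sl] have "(\<lambda>x. if x \<in> S then f x \<bullet> b else 0) \<in> borel_measurable lebesgue"
      by simp
    from completion_ex_borel_measurable_real[OF this]
    show "\<exists>g. g \<in> borel_measurable lborel \<and> (AE x in lborel. (if x \<in> S then f x \<bullet> b else 0) = g x)"
      by blast
  qed
  from choice[OF this] obtain G :: "'v \<Rightarrow> 'a \<Rightarrow> real" where
    "\<forall>b. G b \<in> borel_measurable lborel \<and> (AE x in lborel. (if x \<in> S then f x \<bullet> b else 0) = G b x)"
    ..
  then have G: "\<And>b. G b \<in> borel_measurable borel"
    "\<And>b. AE x in lborel. (if x \<in> S then f x \<bullet> b else 0) = G b x"
    by auto
  define g where "g = (\<lambda>x. indicator S x *\<^sub>R (\<Sum>b\<in>Basis. G b x *\<^sub>R b))"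
  have "AE x in lborel. \<forall>b\<in>Basis. (if x \<in> S then f x \<bullet> b else 0) = G b x"
    using G(2) by (subst AE_finite_all) auto
  then have "AE x in lborel. x \<in> S \<longrightarrow> f x = g x"
  proof eventually_elim
    case (elim x)
    show ?case
    proof
      assume "x \<in> S"
      then have "g x = (\<Sum>b\<in>Basis. (f x \<bullet> b) *\<^sub>R b)" using elim by (simp add: g_def)
      then show "f x = g x" by (simp add: euclidean_representation)
    qed
  qed
  then have "AE x in lebesgue_on S. f x = g x"
    using Sl by (simp add: AE_lebesgue_on_iff_lborel)
  moreover have "g \<in> borel_measurable borel"
    unfolding g_def using G(1) S by measurable
  ultimately show ?thesis using that[of g] by (simp add: g_def)
qed

lemma lebesgue_on_integrable_representative:
  fixes f :: "'a::euclidean_space \<Rightarrow> 'v::euclidean_space"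
  assumes f: "integrable (lebesgue_on S) f" and S: "S \<in> sets borel"
  obtains g where "integrable lborel g" "\<And>x. x \<notin> S \<Longrightarrow> g x = 0"
    "AE x in lebesgue_on S. f x = g x"
proof -
  have Sl: "S \<in> sets lebesgue" using S by simp
  obtain g where g: "g \<in> borel_measurable borel" "\<And>x. x \<notin> S \<Longrightarrow> g x = 0"
    "AE x in lebesgue_on S. f x = g x"
    using lebesgue_on_borel_representative[OF borel_measurable_integrable[OF f] S] by blast
  have gm: "g \<in> borel_measurable (lebesgue_on S)"
    using g(1) by (intro measurable_restrict_space1) (simp add: measurable_completion)
  have "integrable (lebesgue_on S) g"
    using integrable_cong_AE[OF borel_measurable_integrable[OF f] gm g(3)] f by simp
  then have "integrable lebesgue (\<lambda>x. indicator S x *\<^sub>R g x)"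
    using Sl by (simp add: integrable_restrict_space)
  moreover have "(\<lambda>x. indicator S x *\<^sub>R g x) = g" using g(2) by (auto simp: indicator_def)
  ultimately have "integrable lborel g" using g(1) by (simp add: integrable_completion)
  then show ?thesis using that g by blast
qed

lemma borel_measurable_lebesgue_on:
  "f \<in> borel_measurable borel \<Longrightarrow> f \<in> borel_measurable (lebesgue_on S)"
  by (intro measurable_restrict_space1) (simp add: measurable_completion)

lemma locally_integrable_onD:
  assumes "locally_integrable_on U g" "compact K" "K \<subseteq> U"
  shows "integrable (lebesgue_on K) g"
  using assms by (simp add: locally_integrable_on_def)

section \<open>The chain rule for directionally differentiable Lipschitz functions\<close>

lemma test_function_difference_quotient:
  fixes \<phi> :: "real ^ 'm \<Rightarrow> real"
  assumes \<phi>: "\<phi> \<in> test_functions U" and h: "h \<longlonglongrightarrow> 0" "\<And>n. h n \<noteq> 0"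
  shows "(\<lambda>n. (\<phi> (x - h n *\<^sub>R axis k 1) - \<phi> x) / h n) \<longlonglongrightarrow> - partial_deriv k \<phi> x"
proof -
  have d: "(\<phi> has_derivative frechet_derivative \<phi> (at x)) (at x)"
    using test_function_continuous(3)[OF \<phi>] frechet_derivative_works by blast
  have "((\<lambda>r. x - r *\<^sub>R axis k 1) has_derivative (\<lambda>r. - (r *\<^sub>R axis k 1))) (at 0)"
    by (auto intro!: derivative_eq_intros)
  then have "((\<lambda>r. \<phi> (x - r *\<^sub>R axis k 1)) has_derivative (\<lambda>r. frechet_derivative \<phi> (at x) (- (r *\<^sub>R axis k 1)))) (at 0)"
    by (rule has_derivative_compose) (use d in simp)
  moreover have "(\<lambda>r. frechet_derivative \<phi> (at x) (- (r *\<^sub>R axis k 1))) = (*) (- partial_deriv k \<phi> x)"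
  proof -
    have lin: "linear (frechet_derivative \<phi> (at x))"
      using d has_derivative_linear by blast
    show ?thesis by (simp add: linear_neg[OF lin] linear_scale[OF lin] partial_deriv_def fun_eq_iff)
  qed
  ultimately have "((\<lambda>r. \<phi> (x - r *\<^sub>R axis k 1)) has_real_derivative - partial_deriv k \<phi> x) (at 0)"
    by (simp add: has_field_derivative_def)
  then have "((\<lambda>r. (\<phi> (x - r *\<^sub>R axis k 1) - \<phi> x) / r) \<longlongrightarrow> - partial_deriv k \<phi> x) (at 0)"
    by (simp add: DERIV_def)
  then show ?thesis
    using h unfolding tendsto_at_iff_sequentially by (auto simp: o_def)
qed

text \<open>A single sequence \<open>t\<close> of increments enters, and its sign is free: positive
  and negative sequences give the two one-sided derivatives. The Lipschitz bound allows the
  difference quotient of \<open>u\<close> to be replaced by \<open>v\<close> inside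
  \<open>F\<close>, and translation invariance acts as a discrete integration by parts.\<close>

lemma weak_partial_directional_chain:
  fixes u v :: "real ^ 'm \<Rightarrow> 'v::euclidean_space" and F :: "'v \<Rightarrow> real"
  assumes U: "open U" and uv: "has_weak_partial U k u v"
    and F: "\<And>x y. \<bar>F x - F y\<bar> \<le> L * norm (x - y)"
    and t: "t \<longlonglongrightarrow> 0" "\<And>n. t n \<noteq> 0"
    and dF: "\<And>A H. (\<lambda>n. (F (A + t n *\<^sub>R H) - F A) / t n) \<longlonglongrightarrow> dF A H"
  shows "has_weak_partial U k (\<lambda>x. F (u x)) (\<lambda>x. dF (u x) (v x))"
proof -
  let ?e = "axis k 1 :: real ^ 'm"
  have ul: "locally_integrable_on U u" and vl: "locally_integrable_on U v"
    and weak: "\<And>\<phi>. \<phi> \<in> test_functions U \<Longrightarrow> (\<integral>x. partial_deriv k \<phi> x *\<^sub>R u x \<partial>lebesgue_on U)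
      = - (\<integral>x. \<phi> x *\<^sub>R v x \<partial>lebesgue_on U)"
    using uv by (auto simp: has_weak_partial_def)
  have L: "L \<ge> 0"
    using F[of "SOME b. b \<in> Basis" 0] norm_some_Basis[where 'a='v] by simp
  have Fc: "continuous_on UNIV F"
  proof -
    have "L-lipschitz_on UNIV F" using F L by (intro lipschitz_onI) (auto simp: dist_norm)
    then show ?thesis by (rule lipschitz_on_continuous_on)
  qed
  have Fm [measurable]: "F \<in> borel_measurable borel" using Fc by (rule borel_measurable_continuous_onI)
  have qb: "\<bar>(F (A + t n *\<^sub>R H) - F A) / t n\<bar> \<le> L * norm H" for A H n
    using F[of "A + t n *\<^sub>R H" A] t(2)[of n] by (simp add: divide_simps) (simp add: algebra_simps)
  have dFb: "\<bar>dF A H\<bar> \<le> L * norm H" for A H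
    by (rule LIMSEQ_le_const2[OF tendsto_rabs[OF dF]]) (use qb in auto)
  have dFm: "(\<lambda>x. dF (a x) (b x)) \<in> borel_measurable M"
    if [measurable]: "a \<in> borel_measurable M" "b \<in> borel_measurable M" for a b and M :: "(real ^ 'm) measure"
  proof (rule borel_measurable_LIMSEQ_metric)
    show "(\<lambda>x. (F (a x + t n *\<^sub>R b x) - F (a x)) / t n) \<in> borel_measurable M" for n
      by measurable
    show "(\<lambda>n. (F (a x + t n *\<^sub>R b x) - F (a x)) / t n) \<longlonglongrightarrow> dF (a x) (b x)" for x
      by (rule dF)
  qed
  have Fu: "integrable M (\<lambda>x. F (a x))" if a: "integrable M a" and M: "finite_measure M"
    for a :: "real ^ 'm \<Rightarrow> 'v" and M
  proof (rule Bochner_Integration.integrable_bound[of M "\<lambda>x. \<bar>F 0\<bar> + L * norm (a x)"])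
    show "integrable M (\<lambda>x. \<bar>F 0\<bar> + L * norm (a x))"
      using a finite_measure.integrable_const[OF M] by (intro Bochner_Integration.integrable_add integrable_mult_right integrable_norm) auto
    show "(\<lambda>x. F (a x)) \<in> borel_measurable M" using a by measurable
    show "AE x in M. norm (F (a x)) \<le> norm (\<bar>F 0\<bar> + L * norm (a x))"
    proof (rule AE_I2)
      fix x
      have "0 \<le> L * norm (a x)" using L by simp
      then show "norm (F (a x)) \<le> norm (\<bar>F 0\<bar> + L * norm (a x))"
        using F[of "a x" 0] by simp
    qed
  qed
  have dFi: "integrable M (\<lambda>x. dF (a x) (b x))" if a: "integrable M a" "integrable M b" for a b and M :: "(real ^ 'm) measure"
    by (rule Bochner_Integration.integrable_bound[of M "\<lambda>x. L * norm (b x)"])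
      (use a dFb in \<open>auto intro!: dFm integrable_mult_right AE_I2 order_trans[OF dFb]\<close>)
  have fin: "finite_measure (lebesgue_on K)" if "bounded K" "K \<in> sets lebesgue" for K :: "(real ^ 'm) set"
    using that bounded_set_imp_lmeasurable by (intro finite_measure_lebesgue_on) auto
  have loc: "locally_integrable_on U (\<lambda>x. F (u x))" "locally_integrable_on U (\<lambda>x. dF (u x) (v x))"
    unfolding locally_integrable_on_def
  proof (safe)
    fix K assume K: "compact K" "K \<subseteq> U"
    have Kl: "K \<in> sets lebesgue" using lmeasurable_compact[OF K(1)] by (rule fmeasurableD)
    show "integrable (lebesgue_on K) (\<lambda>x. F (u x))"
      by (rule Fu[OF locally_integrable_onD[OF ul K] fin[OF compact_imp_bounded[OF K(1)] Kl]])
    show "integrable (lebesgue_on K) (\<lambda>x. dF (u x) (v x))"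
      by (rule dFi[OF locally_integrable_onD[OF ul K] locally_integrable_onD[OF vl K]])
  qed
  have main: "(\<integral>x. partial_deriv k \<phi> x *\<^sub>R F (u x) \<partial>lebesgue_on U) = - (\<integral>x. \<phi> x *\<^sub>R dF (u x) (v x) \<partial>lebesgue_on U)"
    if \<phi>: "\<phi> \<in> test_functions U" for \<phi>
  proof -
    obtain K C where K: "compact K" "K \<subseteq> U" and KC: "\<And>x. x \<notin> K \<Longrightarrow> \<phi> x = 0"
      "\<And>x k. x \<notin> K \<Longrightarrow> partial_deriv k \<phi> x = 0" "C \<ge> 0" "\<And>x. \<bar>\<phi> x\<bar> \<le> C" "\<And>k x. \<bar>partial_deriv k \<phi> x\<bar> \<le> C"
      by (rule test_functionE[OF \<phi>]) blast
    have \<phi>m [measurable]: "\<phi> \<in> borel_measurable borel" "partial_deriv k \<phi> \<in> borel_measurable borel"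
      using test_function_borel[OF \<phi>] by auto
    obtain \<epsilon> where \<epsilon>: "\<epsilon> > 0" "(\<Union>x\<in>K. cball x \<epsilon>) \<subseteq> U"
      using compact_subset_open_imp_cball_epsilon_subset[OF K(1) U K(2)] by blast
    \<comment> \<open>Nested neighbourhoods
      \<open>K \<subseteq> S \<subseteq> V \<subseteq> K1 \<subseteq> U\<close>: shifts by at most
      \<open>\<epsilon> / 2\<close> lead from \<open>S\<close> into \<open>V\<close>, and
      compactness of \<open>K1\<close> makes \<open>u\<close> and \<open>v\<close> integrable on
      \<open>V\<close>.\<close>
    define K1 where "K1 = (\<Union>x\<in>K. cball x \<epsilon>)"
    define V where "V = (\<Union>x\<in>K. ball x \<epsilon>)"
    define S where "S = (\<Union>x\<in>K. ball x (\<epsilon> / 2))"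
    have K1: "compact K1" "K1 \<subseteq> U"
      using compact_minkowski_sum_cball[OF K(1), of \<epsilon>] \<epsilon> by (auto simp: K1_def)
    have VK1: "V \<subseteq> K1" unfolding V_def K1_def using ball_subset_cball by blast
    have Vo: "open V" and So: "open S" by (auto simp: V_def S_def)
    have VU: "V \<subseteq> U" and Vb: "bounded V"
      using VK1 K1 compact_imp_bounded bounded_subset by blast+
    have KV: "K \<subseteq> V" and KS: "K \<subseteq> S" using \<epsilon>(1) by (auto simp: V_def S_def)
    have Vl: "V \<in> sets lebesgue" and Vbo [measurable]: "V \<in> sets borel" and Ul: "U \<in> sets lebesgue"
      using Vo U by auto
    have Sbo [measurable]: "S \<in> sets borel" using So by auto
    have SV: "x + s *\<^sub>R ?e \<in> V" if x: "x \<in> S" and s: "\<bar>s\<bar> \<le> \<epsilon> / 2" for x s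
    proof -
      obtain y where "y \<in> K" "dist y x < \<epsilon> / 2" using x by (auto simp: S_def)
      moreover have "dist x (x + s *\<^sub>R ?e) \<le> \<epsilon> / 2" using s by (simp add: dist_norm)
      ultimately show ?thesis
        unfolding V_def using dist_triangle[of y "x + s *\<^sub>R ?e" x] by force
    qed
    have uV: "integrable (lebesgue_on V) u" "integrable (lebesgue_on V) v"
      by (auto intro!: integrable_lebesgue_on_subset[OF _ VK1] locally_integrable_onD[OF ul K1]
          locally_integrable_onD[OF vl K1] Vl simp: K1 compact_imp_closed)
    obtain u' where u': "integrable lborel u'" "\<And>x. x \<notin> V \<Longrightarrow> u' x = 0" "AE x in lebesgue_on V. u x = u' x"
      using lebesgue_on_integrable_representative[OF uV(1) Vbo] by blast
    obtain v' where v': "integrable lborel v'" "\<And>x. x \<notin> V \<Longrightarrow> v' x = 0" "AE x in lebesgue_on V. v x = v' x"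
      using lebesgue_on_integrable_representative[OF uV(2) Vbo] by blast
    have u'm [measurable]: "u' \<in> borel_measurable borel" and v'm [measurable]: "v' \<in> borel_measurable borel"
      using u' v' by auto
    have weak': "(\<integral>x. partial_deriv k \<psi> x *\<^sub>R u' x \<partial>lborel) = - (\<integral>x. \<psi> x *\<^sub>R v' x \<partial>lborel)"
      if \<psi>: "\<psi> \<in> test_functions V" for \<psi>
    proof -
      have [measurable]: "\<psi> \<in> borel_measurable borel" "partial_deriv k \<psi> \<in> borel_measurable borel"
        using test_function_borel[OF \<psi>] by auto
      obtain K' where K': "K' \<subseteq> V" "\<And>x. x \<notin> K' \<Longrightarrow> \<psi> x = 0" "\<And>x k. x \<notin> K' \<Longrightarrow> partial_deriv k \<psi> x = 0"
        by (rule test_functionE[OF \<psi>]) blast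
      have \<psi>U: "\<psi> \<in> test_functions U" using \<psi> test_functions_mono[OF VU] by blast
      have lm: "\<psi> \<in> borel_measurable (lebesgue_on V)" "partial_deriv k \<psi> \<in> borel_measurable (lebesgue_on V)"
        "u' \<in> borel_measurable (lebesgue_on V)" "v' \<in> borel_measurable (lebesgue_on V)"
        by (auto intro!: borel_measurable_lebesgue_on)
      have "(\<integral>x. partial_deriv k \<psi> x *\<^sub>R u' x \<partial>lborel) = (\<integral>x. partial_deriv k \<psi> x *\<^sub>R u' x \<partial>lebesgue_on V)"
        by (rule integral_lebesgue_on_eq_lborel[symmetric]) (use u'(2) Vl in auto)
      also have "\<dots> = (\<integral>x. partial_deriv k \<psi> x *\<^sub>R u x \<partial>lebesgue_on V)"
        using u'(3) uV lm by (intro integral_cong_AE borel_measurable_scaleR) auto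
      also have "\<dots> = (\<integral>x. partial_deriv k \<psi> x *\<^sub>R u x \<partial>lebesgue_on U)"
        by (rule integral_lebesgue_on_support(1)[symmetric]) (use K' VU Ul Vl in auto)
      also have "\<dots> = - (\<integral>x. \<psi> x *\<^sub>R v x \<partial>lebesgue_on U)" by (rule weak[OF \<psi>U])
      also have "(\<integral>x. \<psi> x *\<^sub>R v x \<partial>lebesgue_on U) = (\<integral>x. \<psi> x *\<^sub>R v x \<partial>lebesgue_on V)"
        by (rule integral_lebesgue_on_support(1)) (use K' VU Ul Vl in auto)
      also have "\<dots> = (\<integral>x. \<psi> x *\<^sub>R v' x \<partial>lebesgue_on V)"
        using v'(3) uV lm by (intro integral_cong_AE borel_measurable_scaleR) auto
      also have "\<dots> = (\<integral>x. \<psi> x *\<^sub>R v' x \<partial>lborel)"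
        by (rule integral_lebesgue_on_eq_lborel) (use v'(2) Vl in auto)
      finally show ?thesis .
    qed
    obtain N where N: "\<And>n. n \<ge> N \<Longrightarrow> \<bar>t n\<bar> < \<epsilon> / 2"
      using LIMSEQ_D[OF t(1), of "\<epsilon> / 2"] \<epsilon>(1) by auto
    define h where "h = (\<lambda>n. t (n + N))"
    have h: "h \<longlonglongrightarrow> 0" "\<And>n. h n \<noteq> 0" "\<And>n. \<bar>h n\<bar> \<le> \<epsilon> / 2"
      using LIMSEQ_ignore_initial_segment[OF t(1), of N] t(2) N
      by (auto simp: h_def intro: less_imp_le)
    have qh: "(\<lambda>n. (F (A + h n *\<^sub>R H) - F A) / h n) \<longlonglongrightarrow> dF A H" for A H
      using LIMSEQ_ignore_initial_segment[OF dF[of A H], of N] by (simp add: h_def)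
    have qhb: "\<bar>(F (A + h n *\<^sub>R H) - F A) / h n\<bar> \<le> L * norm H" for A H n
      unfolding h_def by (rule qb)
    \<comment> \<open>Cut off to \<open>V\<close> because \<open>F 0\<close> may differ from 0, in
      which case \<open>F (u' x)\<close> is not integrable over the whole space.\<close>
    define W where "W = (\<lambda>x. indicator V x * F (u' x))"
    have Wm [measurable]: "W \<in> borel_measurable borel" unfolding W_def by measurable
    have Wi: "integrable lborel W"
    proof -
      have "integrable (lebesgue_on V) (\<lambda>x. F (u' x))"
        by (intro Fu fin Vb Vl integrable_lborel_imp_lebesgue_on u')
      then have "integrable lebesgue (\<lambda>x. indicator V x *\<^sub>R F (u' x))"
        using Vl by (simp add: integrable_restrict_space)
      then show ?thesis
        by (simp add: W_def integrable_completion)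
    qed
    have Wt: "integrable lborel (\<lambda>x. W (x + s))" for s using Wi by (simp add: lborel_translate(2))
    have dWi: "integrable lborel (\<lambda>x. dF (u' x) (v' x))" by (rule dFi[OF u'(1) v'(1)])
    \<comment> \<open>This integral is evaluated twice: directly, the quotient of \<open>W\<close>
      leads to \<open>dF\<close>; after the shift has been moved to \<open>\<phi>\<close>, the
      quotient of \<open>\<phi>\<close> leads to its partial derivative.\<close>
    define I where "I = (\<lambda>n. \<integral>x. \<phi> x * ((W (x + h n *\<^sub>R ?e) - W x) / h n) \<partial>lborel)"
    have \<phi>i: "integrable lborel (\<lambda>x. \<phi> x * f x)" if "integrable lborel f" for f
      using integrable_scaleR_bounded[OF that, of \<phi> C] KC(4) by simp
    have lim1: "I \<longlonglongrightarrow> (\<integral>x. \<phi> x * dF (u' x) (v' x) \<partial>lborel)"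
    proof -
      \<comment> \<open>Two errors: \<open>?a\<close> from replacing the difference quotient of
        \<open>u'\<close> by \<open>v'\<close>, small in L^1, and \<open>?b\<close> from the
        quotient of \<open>F\<close> in the fixed direction \<open>v' x\<close>, small pointwise
        with an integrable majorant.\<close>
      let ?a = "\<lambda>n x. indicator S x * norm ((1 / h n) *\<^sub>R (u' (x + h n *\<^sub>R ?e) - u' x) - v' x)"
      let ?b = "\<lambda>n x. \<bar>(F (u' x + h n *\<^sub>R v' x) - F (u' x)) / h n - dF (u' x) (v' x)\<bar>"
      have a: "(\<lambda>n. \<integral>x. ?a n x \<partial>lborel) \<longlonglongrightarrow> 0"
        by (rule difference_quotient_L1_limit[OF u'(1) v'(1) weak' So SV h])
      have ai: "integrable lborel (?a n)" for n
      proof -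
        have "integrable lborel (\<lambda>x. indicator S x *\<^sub>R norm ((1 / h n) *\<^sub>R (u' (x + h n *\<^sub>R ?e) - u' x) - v' x))"
          using u'(1) v'(1) by (intro integrable_mult_indicator integrable_norm Bochner_Integration.integrable_diff integrable_scaleR_right)
            (auto simp: lborel_translate(2))
        then show ?thesis by simp
      qed
      have bb: "?b n x \<le> 2 * L * norm (v' x)" for n x
        using qhb[of "u' x" n "v' x"] dFb[of "u' x" "v' x"] by linarith
      have bm: "?b n \<in> borel_measurable lborel" for n
        using dWi by measurable
      have bi: "integrable lborel (?b n)" for n
      proof (rule Bochner_Integration.integrable_bound[OF _ bm])
        show "integrable lborel (\<lambda>x. 2 * L * norm (v' x))"
          using v'(1) by (intro integrable_mult_right integrable_norm)
        show "AE x in lborel. norm (?b n x) \<le> norm (2 * L * norm (v' x))"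
          using order_trans[OF bb abs_ge_self] by (intro AE_I2) simp
      qed
      have b: "(\<lambda>n. \<integral>x. ?b n x \<partial>lborel) \<longlonglongrightarrow> (\<integral>x. 0 \<partial>(lborel :: (real ^ 'm) measure))"
      proof (rule integral_dominated_convergence[where w = "\<lambda>x. 2 * L * norm (v' x)", OF _ bm])
        show "AE x in lborel. (\<lambda>n. ?b n x) \<longlonglongrightarrow> 0"
        proof (rule AE_I2)
          fix x
          show "(\<lambda>n. ?b n x) \<longlonglongrightarrow> 0"
            using tendsto_rabs[OF tendsto_diff[OF qh[of "u' x" "v' x"] tendsto_const[of "dF (u' x) (v' x)"]]] by simp
        qed
        show "integrable lborel (\<lambda>x. 2 * L * norm (v' x))"
          using v'(1) by (intro integrable_mult_right integrable_norm)
        show "AE x in lborel. norm (?b n x) \<le> 2 * L * norm (v' x)" for n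
          using bb by (intro AE_I2) simp
      qed simp
      have est: "\<bar>I n - (\<integral>x. \<phi> x * dF (u' x) (v' x) \<partial>lborel)\<bar> \<le>
          C * L * (\<integral>x. ?a n x \<partial>lborel) + C * (\<integral>x. ?b n x \<partial>lborel)" for n
      proof -
        have i1: "integrable lborel (\<lambda>x. \<phi> x * ((W (x + h n *\<^sub>R ?e) - W x) / h n))"
          using Wi Wt by (intro \<phi>i) auto
        have i2: "integrable lborel (\<lambda>x. \<phi> x * dF (u' x) (v' x))" by (rule \<phi>i[OF dWi])
        have iab1: "integrable lborel (\<lambda>x. C * L * ?a n x)" "integrable lborel (\<lambda>x. C * ?b n x)"
          by (intro integrable_mult_right ai bi)+
        note iab = Bochner_Integration.integrable_add[OF iab1]
        have e1: "(\<integral>x. C * L * ?a n x \<partial>lborel) = C * L * (\<integral>x. ?a n x \<partial>lborel)"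
          by (rule integral_mult_right_zero)
        have e2: "(\<integral>x. C * ?b n x \<partial>lborel) = C * (\<integral>x. ?b n x \<partial>lborel)"
          by (rule integral_mult_right_zero)
        have d: "I n - (\<integral>x. \<phi> x * dF (u' x) (v' x) \<partial>lborel) =
          (\<integral>x. \<phi> x * ((W (x + h n *\<^sub>R ?e) - W x) / h n) - \<phi> x * dF (u' x) (v' x) \<partial>lborel)"
          unfolding I_def by (rule Bochner_Integration.integral_diff[OF i1 i2, symmetric])
        have "norm (\<integral>x. \<phi> x * ((W (x + h n *\<^sub>R ?e) - W x) / h n) - \<phi> x * dF (u' x) (v' x) \<partial>lborel) \<le>
            (\<integral>x. C * L * ?a n x + C * ?b n x \<partial>lborel)"
        proof (rule norm_integral_le_AE)
          show "AE x in lborel. norm (\<phi> x * ((W (x + h n *\<^sub>R ?e) - W x) / h n) - \<phi> x * dF (u' x) (v' x))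
              \<le> C * L * ?a n x + C * ?b n x"
          proof (rule AE_I2)
            fix x
            show "norm (\<phi> x * ((W (x + h n *\<^sub>R ?e) - W x) / h n) - \<phi> x * dF (u' x) (v' x))
              \<le> C * L * ?a n x + C * ?b n x"
            proof (cases "x \<in> K")
              case True
              then have xS: "x \<in> S" and xV: "x \<in> V" using KS KV by auto
              have xhV: "x + h n *\<^sub>R ?e \<in> V" using SV[OF xS h(3)] .
              define D where "D = (1 / h n) *\<^sub>R (u' (x + h n *\<^sub>R ?e) - u' x)"
              have uD: "u' (x + h n *\<^sub>R ?e) = u' x + h n *\<^sub>R D"
                using h(2)[of n] by (simp add: D_def)
              have "\<bar>F (u' x + h n *\<^sub>R D) - F (u' x + h n *\<^sub>R v' x)\<bar> \<le> L * norm (h n *\<^sub>R (D - v' x))"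
                using F[of "u' x + h n *\<^sub>R D" "u' x + h n *\<^sub>R v' x"] by (simp add: scaleR_right_diff_distrib)
              then have f1: "\<bar>(F (u' x + h n *\<^sub>R D) - F (u' x + h n *\<^sub>R v' x)) / h n\<bar> \<le> L * norm (D - v' x)"
                using h(2)[of n] by (simp add: divide_simps) (simp add: algebra_simps)
              have f2: "(W (x + h n *\<^sub>R ?e) - W x) / h n - dF (u' x) (v' x) =
                (F (u' x + h n *\<^sub>R D) - F (u' x + h n *\<^sub>R v' x)) / h n +
                ((F (u' x + h n *\<^sub>R v' x) - F (u' x)) / h n - dF (u' x) (v' x))"
                using xV xhV by (simp add: W_def uD diff_divide_distrib)
              have f3: "?a n x = norm (D - v' x)" using xS by (simp add: D_def)
              have "\<bar>(W (x + h n *\<^sub>R ?e) - W x) / h n - dF (u' x) (v' x)\<bar> \<le> L * ?a n x + ?b n x"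
                unfolding f2 f3 by (rule order_trans[OF abs_triangle_ineq add_right_mono[OF f1]])
              then have "\<bar>\<phi> x\<bar> * \<bar>(W (x + h n *\<^sub>R ?e) - W x) / h n - dF (u' x) (v' x)\<bar> \<le> C * (L * ?a n x + ?b n x)"
                using KC(4)[of x] KC(3) by (intro mult_mono) auto
              then show ?thesis
                by (simp add: abs_mult[symmetric] algebra_simps)
            next
              case False
              then have "\<phi> x = 0" by (rule KC(1))
              then show ?thesis using KC(3) L by simp
            qed
          qed
        qed (rule Bochner_Integration.integrable_diff[OF i1 i2] iab)+
        also have "\<dots> = C * L * (\<integral>x. ?a n x \<partial>lborel) + C * (\<integral>x. ?b n x \<partial>lborel)"
          unfolding Bochner_Integration.integral_add[OF iab1] e1 e2 by (rule refl)
        finally show ?thesis unfolding d real_norm_def .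
      qed
      have lim0: "(\<lambda>n. C * L * (\<integral>x. ?a n x \<partial>lborel) + C * (\<integral>x. ?b n x \<partial>lborel)) \<longlonglongrightarrow> 0"
      proof (rule tendsto_add_zero)
        show "(\<lambda>n. C * L * (\<integral>x. ?a n x \<partial>lborel)) \<longlonglongrightarrow> 0"
          by (rule tendsto_mult_right_zero[OF a])
        have "(\<lambda>n. \<integral>x. ?b n x \<partial>lborel) \<longlonglongrightarrow> 0"
          using b unfolding Bochner_Integration.integral_zero .
        then show "(\<lambda>n. C * (\<integral>x. ?b n x \<partial>lborel)) \<longlonglongrightarrow> 0"
          by (rule tendsto_mult_right_zero)
      qed
      have "(\<lambda>n. I n - (\<integral>x. \<phi> x * dF (u' x) (v' x) \<partial>lborel)) \<longlonglongrightarrow> 0"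
      proof (rule Lim_null_comparison[OF always_eventually lim0], rule allI)
        show "norm (I n - (\<integral>x. \<phi> x * dF (u' x) (v' x) \<partial>lborel)) \<le>
            C * L * (\<integral>x. ?a n x \<partial>lborel) + C * (\<integral>x. ?b n x \<partial>lborel)" for n
          unfolding real_norm_def by (rule est)
      qed
      then show ?thesis by (simp add: LIM_zero_iff)
    qed
    have I_eq: "I n = (\<integral>x. ((\<phi> (x - h n *\<^sub>R ?e) - \<phi> x) / h n) * W x \<partial>lborel)" for n
    proof -
      have i: "integrable lborel (\<lambda>x. \<phi> x * W (x + h n *\<^sub>R ?e))" "integrable lborel (\<lambda>x. \<phi> x * W x)"
        by (intro \<phi>i Wi Wt)+
      have i': "integrable lborel (\<lambda>x. \<phi> (x - h n *\<^sub>R ?e) * W x)"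
        using integrable_scaleR_bounded[OF Wi, of "\<lambda>x. \<phi> (x - h n *\<^sub>R ?e)" C] KC(4) by simp
      have "I n = (\<integral>x. (\<phi> x * W (x + h n *\<^sub>R ?e) - \<phi> x * W x) / h n \<partial>lborel)"
        unfolding I_def by (simp add: right_diff_distrib)
      also have "\<dots> = ((\<integral>x. \<phi> x * W (x + h n *\<^sub>R ?e) \<partial>lborel) - (\<integral>x. \<phi> x * W x \<partial>lborel)) / h n"
        using i by simp
      also have "(\<integral>x. \<phi> x * W (x + h n *\<^sub>R ?e) \<partial>lborel) = (\<integral>x. \<phi> (x - h n *\<^sub>R ?e) * W x \<partial>lborel)"
        using lborel_translate(1)[of "\<lambda>x. \<phi> (x - h n *\<^sub>R ?e) * W x" "h n *\<^sub>R ?e"] by simp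
      also have "((\<integral>x. \<phi> (x - h n *\<^sub>R ?e) * W x \<partial>lborel) - (\<integral>x. \<phi> x * W x \<partial>lborel)) / h n =
          (\<integral>x. (\<phi> (x - h n *\<^sub>R ?e) * W x - \<phi> x * W x) / h n \<partial>lborel)"
        using i i' by simp
      finally show ?thesis by (simp add: left_diff_distrib)
    qed
    have "I \<longlonglongrightarrow> (\<integral>x. - partial_deriv k \<phi> x * W x \<partial>lborel)"
      unfolding I_eq
    proof (rule integral_dominated_convergence[where w = "\<lambda>x. C * \<bar>W x\<bar>"])
      show "AE x in lborel. (\<lambda>n. ((\<phi> (x - h n *\<^sub>R ?e) - \<phi> x) / h n) * W x) \<longlonglongrightarrow> - partial_deriv k \<phi> x * W x"
        by (intro AE_I2 tendsto_mult_right test_function_difference_quotient[OF \<phi> h(1,2)])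
      show "AE x in lborel. norm (((\<phi> (x - h n *\<^sub>R ?e) - \<phi> x) / h n) * W x) \<le> C * \<bar>W x\<bar>" for n
      proof (rule AE_I2)
        fix x
        have "\<bar>\<integral>s. partial_deriv k \<phi> (x - (s * h n) *\<^sub>R ?e) * indicator {0..1} s \<partial>lborel\<bar> \<le> (\<integral>s. C * indicator {0..1::real} s \<partial>lborel)"
        proof (rule norm_integral_le_AE[where 'v = real, unfolded real_norm_def])
          have "integrable lborel (indicator {0..1::real} :: real \<Rightarrow> real)" by simp
          from integrable_scaleR_bounded[OF this, of "\<lambda>s. partial_deriv k \<phi> (x - (s * h n) *\<^sub>R ?e)" C] KC(5)
          show "integrable lborel (\<lambda>s. partial_deriv k \<phi> (x - (s * h n) *\<^sub>R ?e) * indicator {0..1} s)"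
            by simp
          show "integrable lborel (\<lambda>s. C * indicator {0..1::real} s)" by simp
          show "AE s in lborel. \<bar>partial_deriv k \<phi> (x - (s * h n) *\<^sub>R ?e) * indicator {0..1} s\<bar> \<le> C * indicator {0..1::real} s"
            using KC(5) by (intro AE_I2) (auto simp: indicator_def)
        qed
        then have "\<bar>(\<phi> (x - h n *\<^sub>R ?e) - \<phi> x) / h n\<bar> \<le> C"
          using h(2)[of n] unfolding test_function_increment[OF \<phi>] by simp
        then show "norm (((\<phi> (x - h n *\<^sub>R ?e) - \<phi> x) / h n) * W x) \<le> C * \<bar>W x\<bar>"
          unfolding real_norm_def abs_mult by (rule mult_right_mono) simp
      qed
    qed (use Wi in \<open>auto intro!: integrable_mult_right\<close>)
    from LIMSEQ_unique[OF lim1 this] have key: "(\<integral>x. \<phi> x * dF (u' x) (v' x) \<partial>lborel) = - (\<integral>x. partial_deriv k \<phi> x * W x \<partial>lborel)"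
      by simp
    have lm: "\<phi> \<in> borel_measurable (lebesgue_on V)" "partial_deriv k \<phi> \<in> borel_measurable (lebesgue_on V)"
        "u' \<in> borel_measurable (lebesgue_on V)" "v' \<in> borel_measurable (lebesgue_on V)" "W \<in> borel_measurable (lebesgue_on V)"
      by (auto intro!: borel_measurable_lebesgue_on)
    have KCV: "partial_deriv k \<phi> x = 0" "\<phi> x = 0" if "x \<notin> V" for x
      using KC(1,2)[of x] KV that by auto
    have um: "u \<in> borel_measurable (lebesgue_on V)" "v \<in> borel_measurable (lebesgue_on V)"
      using uV by auto
    have Fum: "(\<lambda>x. F (u x)) \<in> borel_measurable (lebesgue_on V)" using um by measurable
    have "(\<integral>x. partial_deriv k \<phi> x *\<^sub>R F (u x) \<partial>lebesgue_on U) = (\<integral>x. partial_deriv k \<phi> x *\<^sub>R F (u x) \<partial>lebesgue_on V)"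
      by (rule integral_lebesgue_on_support(1)) (use KCV VU Ul Vl in auto)
    also have "\<dots> = (\<integral>x. partial_deriv k \<phi> x *\<^sub>R W x \<partial>lebesgue_on V)"
    proof (intro integral_cong_AE borel_measurable_scaleR lm Fum)
      show "AE x in lebesgue_on V. partial_deriv k \<phi> x *\<^sub>R F (u x) = partial_deriv k \<phi> x *\<^sub>R W x"
        using u'(3) AE_space by eventually_elim (simp add: W_def)
    qed
    also have "\<dots> = (\<integral>x. partial_deriv k \<phi> x *\<^sub>R W x \<partial>lborel)"
      by (rule integral_lebesgue_on_eq_lborel) (use Vl in \<open>auto simp: W_def\<close>)
    also have "\<dots> = - (\<integral>x. \<phi> x *\<^sub>R dF (u' x) (v' x) \<partial>lborel)" using key by simp
    also have "(\<integral>x. \<phi> x *\<^sub>R dF (u' x) (v' x) \<partial>lborel) = (\<integral>x. \<phi> x *\<^sub>R dF (u' x) (v' x) \<partial>lebesgue_on V)"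
    proof (rule integral_lebesgue_on_eq_lborel[symmetric])
      show "(\<lambda>x. \<phi> x *\<^sub>R dF (u' x) (v' x)) \<in> borel_measurable borel" using dWi by measurable
    qed (use KCV Vl in auto)
    also have "\<dots> = (\<integral>x. \<phi> x *\<^sub>R dF (u x) (v x) \<partial>lebesgue_on V)"
    proof (intro integral_cong_AE borel_measurable_scaleR lm dFm um)
      show "AE x in lebesgue_on V. \<phi> x *\<^sub>R dF (u' x) (v' x) = \<phi> x *\<^sub>R dF (u x) (v x)"
        using u'(3) v'(3) by eventually_elim simp
    qed
    also have "\<dots> = (\<integral>x. \<phi> x *\<^sub>R dF (u x) (v x) \<partial>lebesgue_on U)"
      by (rule integral_lebesgue_on_support(1)[symmetric]) (use KCV VU Ul Vl in auto)
    finally show ?thesis .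
  qed
  show ?thesis
    unfolding has_weak_partial_def using loc main by blast
qed

section \<open>Closure properties of weak derivatives\<close>

lemma has_weak_partial_lin:
  fixes a1 a2 b1 b2 :: "real ^ 'm \<Rightarrow> 'v::euclidean_space"
  assumes U: "open U" and 1: "has_weak_partial U k a1 b1" and 2: "has_weak_partial U k a2 b2"
  shows "has_weak_partial U k (\<lambda>x. c *\<^sub>R a1 x + d *\<^sub>R a2 x) (\<lambda>x. c *\<^sub>R b1 x + d *\<^sub>R b2 x)"
proof -
  have Ul: "U \<in> sets lebesgue" using U by auto
  have loc: "locally_integrable_on U a1" "locally_integrable_on U a2" "locally_integrable_on U b1" "locally_integrable_on U b2"
    using 1 2 by (auto simp: has_weak_partial_def)
  have "(\<integral>x. partial_deriv k \<phi> x *\<^sub>R (c *\<^sub>R a1 x + d *\<^sub>R a2 x) \<partial>lebesgue_on U) =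
      - (\<integral>x. \<phi> x *\<^sub>R (c *\<^sub>R b1 x + d *\<^sub>R b2 x) \<partial>lebesgue_on U)" if \<phi>: "\<phi> \<in> test_functions U" for \<phi>
  proof -
    obtain K C where K: "compact K" "K \<subseteq> U" and KC: "\<And>x. x \<notin> K \<Longrightarrow> \<phi> x = 0"
      "\<And>x k. x \<notin> K \<Longrightarrow> partial_deriv k \<phi> x = 0" "\<And>x. \<bar>\<phi> x\<bar> \<le> C" "\<And>k x. \<bar>partial_deriv k \<phi> x\<bar> \<le> C"
      by (rule test_functionE[OF \<phi>]) blast
    have Kl: "K \<in> sets lebesgue" using lmeasurable_compact[OF K(1)] by (rule fmeasurableD)
    have i: "integrable (lebesgue_on U) (\<lambda>x. \<psi> x *\<^sub>R f x)"
      if "locally_integrable_on U f" "\<psi> \<in> borel_measurable borel" "\<And>x. x \<notin> K \<Longrightarrow> \<psi> x = 0" "\<And>x. \<bar>\<psi> x\<bar> \<le> C"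
      for f :: "real ^ 'm \<Rightarrow> 'v" and \<psi>
    proof -
      have "integrable (lebesgue_on K) (\<lambda>x. \<psi> x *\<^sub>R f x)"
        using that by (intro integrable_scaleR_bounded[where C = C] locally_integrable_onD[OF that(1) K] borel_measurable_lebesgue_on) auto
      then show ?thesis
        by (subst integral_lebesgue_on_support(2)[of U K]) (use that K Ul Kl in auto)
    qed
    have A: "integrable (lebesgue_on U) (\<lambda>x. partial_deriv k \<phi> x *\<^sub>R a1 x)" "integrable (lebesgue_on U) (\<lambda>x. partial_deriv k \<phi> x *\<^sub>R a2 x)"
      "integrable (lebesgue_on U) (\<lambda>x. \<phi> x *\<^sub>R b1 x)" "integrable (lebesgue_on U) (\<lambda>x. \<phi> x *\<^sub>R b2 x)"
      by (rule i[OF loc(1)] i[OF loc(2)] i[OF loc(3)] i[OF loc(4)]; (rule test_function_borel[OF \<phi>] KC; assumption?))+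
    have lin: "(\<integral>x. \<psi> x *\<^sub>R (c *\<^sub>R f x + d *\<^sub>R g x) \<partial>lebesgue_on U) =
        c *\<^sub>R (\<integral>x. \<psi> x *\<^sub>R f x \<partial>lebesgue_on U) + d *\<^sub>R (\<integral>x. \<psi> x *\<^sub>R g x \<partial>lebesgue_on U)"
      if "integrable (lebesgue_on U) (\<lambda>x. \<psi> x *\<^sub>R f x)" "integrable (lebesgue_on U) (\<lambda>x. \<psi> x *\<^sub>R g x)"
      for \<psi> and f g :: "real ^ 'm \<Rightarrow> 'v"
    proof -
      have "\<psi> x *\<^sub>R (c *\<^sub>R f x + d *\<^sub>R g x) = c *\<^sub>R (\<psi> x *\<^sub>R f x) + d *\<^sub>R (\<psi> x *\<^sub>R g x)" for x
        by (simp add: scaleR_right_distrib mult.commute)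
      then show ?thesis using that by (simp del: scaleR_scaleR)
    qed
    show ?thesis
      unfolding lin[OF A(1,2)] lin[OF A(3,4)] using 1 2 \<phi> by (simp add: has_weak_partial_def)
  qed
  moreover have "locally_integrable_on U (\<lambda>x. c *\<^sub>R a1 x + d *\<^sub>R a2 x)" "locally_integrable_on U (\<lambda>x. c *\<^sub>R b1 x + d *\<^sub>R b2 x)"
    using loc by (auto simp: locally_integrable_on_def)
  ultimately show ?thesis by (simp add: has_weak_partial_def)
qed

text \<open>Lets the chain rule for primitives pass through the bounded limits of
  \<open>bounded_borel_induct\<close>. Locally integrable majorants suffice because test functions
  are supported in compact sets.\<close>

lemma has_weak_partial_dominated_limit:
  fixes a :: "nat \<Rightarrow> real ^ 'm \<Rightarrow> 'v::euclidean_space"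
  assumes U: "open U" and w: "\<And>i. has_weak_partial U k (a i) (b i)"
    and a: "\<And>x. (\<lambda>i. a i x) \<longlonglongrightarrow> a' x" "\<And>i x. norm (a i x) \<le> A x" "locally_integrable_on U A"
    and b: "\<And>x. (\<lambda>i. b i x) \<longlonglongrightarrow> b' x" "\<And>i x. norm (b i x) \<le> B x" "locally_integrable_on U B"
  shows "has_weak_partial U k a' b'"
proof -
  have Ul: "U \<in> sets lebesgue" using U by auto
  have dct: "locally_integrable_on U f'"
    and dct2: "\<And>\<psi> K C. compact K \<Longrightarrow> K \<subseteq> U \<Longrightarrow> \<psi> \<in> borel_measurable borel \<Longrightarrow> (\<And>x. x \<notin> K \<Longrightarrow> \<psi> x = 0) \<Longrightarrow>
      (\<And>x. \<bar>\<psi> x\<bar> \<le> C) \<Longrightarrow> (\<lambda>i. \<integral>x. \<psi> x *\<^sub>R f i x \<partial>lebesgue_on U) \<longlonglongrightarrow> (\<integral>x. \<psi> x *\<^sub>R f' x \<partial>lebesgue_on U)"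
    if f: "\<And>i. locally_integrable_on U (f i)" "\<And>x. (\<lambda>i. f i x) \<longlonglongrightarrow> f' x" "\<And>i x. norm (f i x) \<le> F x" "locally_integrable_on U F"
    for f :: "nat \<Rightarrow> real ^ 'm \<Rightarrow> 'v" and f' F
  proof -
    have fm: "f i \<in> borel_measurable (lebesgue_on K)" if "compact K" "K \<subseteq> U" for i K
      using locally_integrable_onD[OF f(1) that] by auto
    have f'm: "f' \<in> borel_measurable (lebesgue_on K)" if "compact K" "K \<subseteq> U" for K
      by (rule borel_measurable_LIMSEQ_metric[OF fm[OF that] f(2)])
    have f'F: "norm (f' x) \<le> F x" for x
      by (rule LIMSEQ_le_const2[OF tendsto_norm[OF f(2)]]) (use f(3) in auto)
    show "locally_integrable_on U f'"
      unfolding locally_integrable_on_def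
    proof (intro allI impI, elim conjE)
      fix K :: "(real ^ 'm) set" assume K: "compact K" "K \<subseteq> U"
      show "integrable (lebesgue_on K) f'"
        by (rule Bochner_Integration.integrable_bound[OF locally_integrable_onD[OF f(4) K] f'm[OF K]])
          (intro AE_I2 order_trans[OF f'F], simp)
    qed
    fix \<psi> :: "real ^ 'm \<Rightarrow> real" and K :: "(real ^ 'm) set" and C
    assume K: "compact K" "K \<subseteq> U" and \<psi>: "\<psi> \<in> borel_measurable borel" "\<And>x. x \<notin> K \<Longrightarrow> \<psi> x = 0" "\<And>x. \<bar>\<psi> x\<bar> \<le> C"
    have Kl: "K \<in> sets lebesgue" using lmeasurable_compact[OF K(1)] by (rule fmeasurableD)
    have toK: "(\<integral>x. \<psi> x *\<^sub>R g x \<partial>lebesgue_on U) = (\<integral>x. \<psi> x *\<^sub>R g x \<partial>lebesgue_on K)" for g :: "real ^ 'm \<Rightarrow> 'v"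
      by (rule integral_lebesgue_on_support(1)) (use \<psi> K Kl Ul in auto)
    have \<psi>m: "\<psi> \<in> borel_measurable (lebesgue_on K)" by (rule borel_measurable_lebesgue_on[OF \<psi>(1)])
    show "(\<lambda>i. \<integral>x. \<psi> x *\<^sub>R f i x \<partial>lebesgue_on U) \<longlonglongrightarrow> (\<integral>x. \<psi> x *\<^sub>R f' x \<partial>lebesgue_on U)"
      unfolding toK
    proof (rule integral_dominated_convergence[where w = "\<lambda>x. C * F x"])
      show "integrable (lebesgue_on K) (\<lambda>x. C * F x)"
        by (intro integrable_mult_right locally_integrable_onD[OF f(4) K])
      show "AE x in lebesgue_on K. (\<lambda>i. \<psi> x *\<^sub>R f i x) \<longlonglongrightarrow> \<psi> x *\<^sub>R f' x"
        by (intro AE_I2 tendsto_intros f(2))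
      show "AE x in lebesgue_on K. norm (\<psi> x *\<^sub>R f i x) \<le> C * F x" for i
      proof (rule AE_I2)
        fix x
        have "0 \<le> C" using \<psi>(3)[of 0] by linarith
        then show "norm (\<psi> x *\<^sub>R f i x) \<le> C * F x"
          using \<psi>(3)[of x] f(3)[of i x] by (simp add: mult_mono)
      qed
    qed (intro borel_measurable_scaleR \<psi>m fm[OF K] f'm[OF K])+
  qed
  have al: "\<And>i. locally_integrable_on U (a i)" and bl: "\<And>i. locally_integrable_on U (b i)"
    using w by (auto simp: has_weak_partial_def)
  have "(\<integral>x. partial_deriv k \<phi> x *\<^sub>R a' x \<partial>lebesgue_on U) = - (\<integral>x. \<phi> x *\<^sub>R b' x \<partial>lebesgue_on U)"
    if \<phi>: "\<phi> \<in> test_functions U" for \<phi>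
  proof -
    obtain K C where K: "compact K" "K \<subseteq> U" and KC: "\<And>x. x \<notin> K \<Longrightarrow> \<phi> x = 0"
      "\<And>x k. x \<notin> K \<Longrightarrow> partial_deriv k \<phi> x = 0" "\<And>x. \<bar>\<phi> x\<bar> \<le> C" "\<And>k x. \<bar>partial_deriv k \<phi> x\<bar> \<le> C"
      by (rule test_functionE[OF \<phi>]) blast
    have 1: "(\<lambda>i. \<integral>x. partial_deriv k \<phi> x *\<^sub>R a i x \<partial>lebesgue_on U) \<longlonglongrightarrow> (\<integral>x. partial_deriv k \<phi> x *\<^sub>R a' x \<partial>lebesgue_on U)"
      by (rule dct2[OF al a K test_function_borel(2)[OF \<phi>] KC(2) KC(4)])
    have 2: "(\<lambda>i. \<integral>x. \<phi> x *\<^sub>R b i x \<partial>lebesgue_on U) \<longlonglongrightarrow> (\<integral>x. \<phi> x *\<^sub>R b' x \<partial>lebesgue_on U)"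
      by (rule dct2[OF bl b K test_function_borel(1)[OF \<phi>] KC(1) KC(3)])
    have "(\<integral>x. partial_deriv k \<phi> x *\<^sub>R a i x \<partial>lebesgue_on U) = - (\<integral>x. \<phi> x *\<^sub>R b i x \<partial>lebesgue_on U)" for i
      using w[of i] \<phi> by (simp add: has_weak_partial_def)
    with 1 have "(\<lambda>i. - (\<integral>x. \<phi> x *\<^sub>R b i x \<partial>lebesgue_on U)) \<longlonglongrightarrow> (\<integral>x. partial_deriv k \<phi> x *\<^sub>R a' x \<partial>lebesgue_on U)"
      by simp
    from LIMSEQ_unique[OF this tendsto_minus[OF 2]] show ?thesis .
  qed
  then show ?thesis
    using dct[OF al a] dct[OF bl b] by (simp add: has_weak_partial_def)
qed

section \<open>Primitives of bounded Borel functions\<close>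

text \<open>With half-open intervals \<open>primitive_diff\<close> holds without null set corrections.\<close>

definition primitive :: "(real \<Rightarrow> real) \<Rightarrow> real \<Rightarrow> real" where
  "primitive g s = (\<integral>r. (indicator {0..<s} r - indicator {s..<0} r) * g r \<partial>lborel)"

lemma integrable_indicator_Ico [simp]: "integrable lborel (indicator {a..<b::real} :: real \<Rightarrow> real)"
  by (cases "a \<le> b") (auto intro!: integrable_real_indicator)

lemma primitive_integrable:
  fixes g :: "real \<Rightarrow> real"
  assumes "g \<in> borel_measurable borel" "\<And>x. \<bar>g x\<bar> \<le> C"
  shows "integrable lborel (\<lambda>r. (indicator {0..<s} r - indicator {s..<0} r) * g r)"
proof -
  have "integrable lborel (\<lambda>r. indicator {0..<s} r - indicator {s..<0} r :: real)"
    by (intro Bochner_Integration.integrable_diff integrable_indicator_Ico)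
  from integrable_scaleR_bounded[OF this, of g C] assms show ?thesis
    by (simp add: mult.commute)
qed

lemma primitive_diff:
  assumes g: "g \<in> borel_measurable borel" "\<And>x. \<bar>g x\<bar> \<le> C" and ts: "t \<le> s"
  shows "primitive g s - primitive g t = (\<integral>r. indicator {t..<s} r * g r \<partial>lborel)"
proof -
  have "primitive g s - primitive g t = (\<integral>r. (indicator {0..<s} r - indicator {s..<0} r) * g r -
      (indicator {0..<t} r - indicator {t..<0} r) * g r \<partial>lborel)"
    unfolding primitive_def using primitive_integrable[OF g, of s] primitive_integrable[OF g, of t] by simp
  also have "\<dots> = (\<integral>r. indicator {t..<s} r * g r \<partial>lborel)"
    by (rule Bochner_Integration.integral_cong) (use ts in \<open>auto simp: indicator_def\<close>)
  finally show ?thesis .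
qed

text \<open>One estimate for two purposes: \<open>c = 0\<close> gives the Lipschitz bound,
  \<open>c = g s\<close> with small \<open>e\<close> the derivative of the primitive of a continuous
  function.\<close>

lemma primitive_diff_bound:
  assumes g: "g \<in> borel_measurable borel" "\<And>x. \<bar>g x\<bar> \<le> C" and ts: "t \<le> s"
    and e: "\<And>r. t \<le> r \<Longrightarrow> r < s \<Longrightarrow> \<bar>g r - c\<bar> \<le> e"
  shows "\<bar>primitive g s - primitive g t - (s - t) * c\<bar> \<le> e * (s - t)"
proof -
  have i0: "integrable lborel (indicator {t..<s} :: real \<Rightarrow> real)" by simp
  have i: "integrable lborel (\<lambda>r. indicator {t..<s} r * g r)"
    using integrable_scaleR_bounded[OF i0 _ g(2)] g(1) by (simp add: mult.commute)
  have ic: "integrable lborel (\<lambda>r. indicator {t..<s} r * c)" using i0 by simp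
  have ind: "(\<integral>r. indicator {t..<s} r * c \<partial>lborel) = (s - t) * c" for c :: real
    using ts by simp
  have "primitive g s - primitive g t - (s - t) * c = (\<integral>r. indicator {t..<s} r * g r - indicator {t..<s} r * c \<partial>lborel)"
    unfolding Bochner_Integration.integral_diff[OF i ic] ind primitive_diff[OF g ts] by (rule refl)
  moreover have "norm (\<integral>r. indicator {t..<s} r * g r - indicator {t..<s} r * c \<partial>lborel) \<le> (\<integral>r. indicator {t..<s} r * e \<partial>lborel)"
  proof (rule norm_integral_le_AE)
    show "AE r in lborel. norm (indicator {t..<s} r * g r - indicator {t..<s} r * c) \<le> indicator {t..<s} r * e"
      using e by (intro AE_I2) (auto simp: indicator_def)
  qed (use i ic i0 in auto)
  ultimately show ?thesis unfolding ind by (simp only: real_norm_def mult.commute)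
qed

lemma primitive_lipschitz:
  assumes g: "g \<in> borel_measurable borel" "\<And>x. \<bar>g x\<bar> \<le> C"
  shows "\<bar>primitive g s - primitive g t\<bar> \<le> C * \<bar>s - t\<bar>"
proof (cases "t \<le> s")
  case True
  then show ?thesis using primitive_diff_bound[OF g True, of 0 C] g(2) by simp
next
  case False
  then show ?thesis using primitive_diff_bound[OF g, of s t 0 C] g(2) by (simp add: abs_minus_commute)
qed

lemma primitive_0 [simp]: "primitive g 0 = 0"
  by (simp add: primitive_def)

lemma primitive_has_derivative:
  assumes g: "continuous_on UNIV g" "\<And>x. \<bar>g x\<bar> \<le> C"
  shows "(primitive g has_real_derivative g s) (at s)"
  unfolding DERIV_def LIM_def
proof (intro allI impI)
  fix e :: real assume e: "e > 0"
  have gm: "g \<in> borel_measurable borel" by (rule borel_measurable_continuous_onI[OF g(1)])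
  obtain d where d: "d > 0" "\<And>r. dist r s < d \<Longrightarrow> dist (g r) (g s) < e / 2"
    using g(1) e unfolding continuous_on_iff by (metis UNIV_I half_gt_zero)
  have "dist ((primitive g (s + h) - primitive g s) / h) (g s) < e" if h: "h \<noteq> 0" "\<bar>h\<bar> < d" for h
  proof -
    have b: "\<bar>primitive g (s + h) - primitive g s - h * g s\<bar> \<le> e / 2 * \<bar>h\<bar>"
    proof (cases "h > 0")
      case True
      have "\<bar>g r - g s\<bar> \<le> e / 2" if "s \<le> r" "r < s + h" for r
        using d(2)[of r] that h True by (simp add: dist_real_def)
      from primitive_diff_bound[where t = s and s = "s + h" and c = "g s" and e = "e / 2", OF gm g(2) _ this] True
      show ?thesis by simp
    next
      case False
      have "\<bar>g r - g s\<bar> \<le> e / 2" if "s + h \<le> r" "r < s" for r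
        using d(2)[of r] that h False by (simp add: dist_real_def)
      have "\<bar>primitive g s - primitive g (s + h) - (s - (s + h)) * g s\<bar> \<le> e / 2 * (s - (s + h))"
        using primitive_diff_bound[where t = "s + h" and s = s and c = "g s" and e = "e / 2", OF gm g(2)]
          \<open>\<And>r. s + h \<le> r \<Longrightarrow> r < s \<Longrightarrow> \<bar>g r - g s\<bar> \<le> e / 2\<close> False by simp
      moreover have "primitive g s - primitive g (s + h) - (s - (s + h)) * g s = - (primitive g (s + h) - primitive g s - h * g s)"
        by simp
      moreover have "s - (s + h) = \<bar>h\<bar>" using False by simp
      ultimately show ?thesis by (metis abs_minus_cancel)
    qed
    have "(primitive g (s + h) - primitive g s) / h - g s = (primitive g (s + h) - primitive g s - h * g s) / h"
      using h by (simp add: field_simps)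
    then have "\<bar>(primitive g (s + h) - primitive g s) / h - g s\<bar> \<le> e / 2"
      using b h by (simp add: pos_divide_le_eq)
    then show ?thesis using e by (simp add: dist_real_def)
  qed
  then show "\<exists>d>0. \<forall>x. x \<noteq> 0 \<and> dist x 0 < d \<longrightarrow> dist ((primitive g (s + x) - primitive g s) / x) (g s) < e"
    using d(1) by (auto simp: dist_real_def)
qed

lemma weak_partial_primitive_continuous:
  fixes u v :: "real ^ 'm \<Rightarrow> real"
  assumes U: "open U" and uv: "has_weak_partial U k u v"
    and g: "continuous_on UNIV g" "\<And>x. \<bar>g x\<bar> \<le> C"
  shows "has_weak_partial U k (\<lambda>x. primitive g (u x)) (\<lambda>x. g (u x) * v x)"
proof (rule weak_partial_directional_chain[OF U uv, where t = "\<lambda>n. 1 / real (Suc n)" and dF = "\<lambda>a h. g a * h"])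
  have gm: "g \<in> borel_measurable borel" by (rule borel_measurable_continuous_onI[OF g(1)])
  show "\<bar>primitive g x - primitive g y\<bar> \<le> C * norm (x - y)" for x y
    using primitive_lipschitz[OF gm g(2)] by simp
  show "(\<lambda>n. 1 / real (Suc n)) \<longlonglongrightarrow> 0" by (rule LIMSEQ_Suc[OF lim_1_over_n])
  show "(\<lambda>n. (primitive g (a + (1 / real (Suc n)) *\<^sub>R h) - primitive g a) / (1 / real (Suc n))) \<longlonglongrightarrow> g a * h" for a h
  proof -
    have "((\<lambda>r. primitive g (a + r * h)) has_real_derivative g a * h) (at 0)"
      by (rule DERIV_chain2[where g = "\<lambda>r. a + r * h" and f = "primitive g"])
        (auto intro!: derivative_eq_intros primitive_has_derivative[OF g])
    then have "((\<lambda>r. (primitive g (a + r * h) - primitive g a) / r) \<longlongrightarrow> g a * h) (at 0)"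
      by (simp add: DERIV_def)
    moreover have "(\<lambda>n. 1 / real (Suc n)) \<longlonglongrightarrow> 0" by (rule LIMSEQ_Suc[OF lim_1_over_n])
    ultimately have "((\<lambda>r. (primitive g (a + r * h) - primitive g a) / r) \<circ> (\<lambda>n. 1 / real (Suc n))) \<longlonglongrightarrow> g a * h"
      unfolding tendsto_at_iff_sequentially by auto
    then show ?thesis by (simp add: o_def)
  qed
qed simp

text \<open>The rule holds for every Borel density of a given primitive. Two such densities differ
  on a null set only, and by uniqueness \<open>v\<close> vanishes almost everywhere on the preimage
  of that set, so the choice of \<open>g\<close> at exceptional points does no harm. The proof
  extends the rule from continuous \<open>g\<close> by \<open>bounded_borel_induct\<close>.\<close>

lemma weak_partial_primitive:
  fixes u v :: "real ^ 'm \<Rightarrow> real"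
  assumes U: "open U" and uv: "has_weak_partial U k u v"
    and g: "g \<in> borel_measurable borel" "\<And>x. \<bar>g x\<bar> \<le> C"
  shows "has_weak_partial U k (\<lambda>x. primitive g (u x)) (\<lambda>x. g (u x) * v x)"
proof -
  define P where "P = (\<lambda>g :: real \<Rightarrow> real. g \<in> borel_measurable borel \<and> (\<exists>C. \<forall>x. \<bar>g x\<bar> \<le> C) \<and>
     has_weak_partial U k (\<lambda>x. primitive g (u x)) (\<lambda>x. g (u x) * v x))"
  have loc: "locally_integrable_on U u" "locally_integrable_on U v"
    using uv by (auto simp: has_weak_partial_def)
  have lin: "P (\<lambda>x. a * f x + b * g x)" if P: "P f" "P g" for a b f g
  proof -
    obtain C1 C2 where C: "\<And>x. \<bar>f x\<bar> \<le> C1" "\<And>x. \<bar>g x\<bar> \<le> C2"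
      using P by (auto simp: P_def)
    have m: "f \<in> borel_measurable borel" "g \<in> borel_measurable borel"
      using P by (auto simp: P_def)
    have "\<bar>a * f x + b * g x\<bar> \<le> \<bar>a\<bar> * C1 + \<bar>b\<bar> * C2" for x
      using C[of x] by (intro order_trans[OF abs_triangle_ineq] add_mono) (auto simp: abs_mult mult_left_mono)
    moreover have "primitive (\<lambda>x. a * f x + b * g x) s = a * primitive f s + b * primitive g s" for s
    proof -
      have "(indicator {0..<s} r - indicator {s..<0} r) * (a * f r + b * g r) =
         a * ((indicator {0..<s} r - indicator {s..<0} r) * f r) + b * ((indicator {0..<s} r - indicator {s..<0} r) * g r)" for r :: real
        by (simp add: algebra_simps)
      then show ?thesis
        unfolding primitive_def using primitive_integrable[OF m(1) C(1), of s] primitive_integrable[OF m(2) C(2), of s] by simp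
    qed
    moreover have "(a * f (u x) + b * g (u x)) * v x = a * (f (u x) * v x) + b * (g (u x) * v x)" for x
      by (simp add: algebra_simps)
    moreover have "has_weak_partial U k (\<lambda>x. a *\<^sub>R primitive f (u x) + b *\<^sub>R primitive g (u x)) (\<lambda>x. a *\<^sub>R (f (u x) * v x) + b *\<^sub>R (g (u x) * v x))"
      by (rule has_weak_partial_lin[OF U]) (use P in \<open>auto simp: P_def\<close>)
    ultimately show ?thesis
      using m unfolding P_def by auto
  qed
  have lim: "P g" if f: "\<And>i::nat. P (f i)" and fC: "\<And>i x. \<bar>f i x\<bar> \<le> C" and fg: "\<And>x. (\<lambda>i. f i x) \<longlonglongrightarrow> g x"
    for f g C
  proof -
    have C0: "C \<ge> 0" using fC[of 0 0] by linarith
    have gC: "\<bar>g x\<bar> \<le> C" for x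
      by (rule LIMSEQ_le_const2[OF tendsto_rabs[OF fg[of x]]]) (use fC in auto)
    have fm: "f i \<in> borel_measurable borel" for i using f by (simp add: P_def)
    have gm: "g \<in> borel_measurable borel"
      by (rule borel_measurable_LIMSEQ_metric[OF fm fg])
    have pl: "(\<lambda>i. primitive (f i) s) \<longlonglongrightarrow> primitive g s" for s
      unfolding primitive_def
    proof (rule integral_dominated_convergence[where w = "\<lambda>r. C * \<bar>indicator {0..<s} r - indicator {s..<0} r\<bar>"])
      show "integrable lborel (\<lambda>r. C * \<bar>indicator {0..<s} r - indicator {s..<0} r\<bar>)"
        by (intro integrable_mult_right integrable_abs Bochner_Integration.integrable_diff integrable_indicator_Ico)
      show "AE r in lborel. (\<lambda>i. (indicator {0..<s} r - indicator {s..<0} r) * f i r) \<longlonglongrightarrow> (indicator {0..<s} r - indicator {s..<0} r) * g r"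
        by (intro AE_I2 tendsto_intros fg)
      show "AE r in lborel. norm ((indicator {0..<s} r - indicator {s..<0} r) * f i r) \<le> C * \<bar>indicator {0..<s} r - indicator {s..<0} r\<bar>" for i
        using fC[of i] by (intro AE_I2) (simp add: abs_mult mult.commute mult_right_mono)
    qed (use fm gm in auto)
    have bnd: "norm (primitive (f i) (u x)) \<le> C * norm (u x)" for i x
      using primitive_lipschitz[OF fm fC, of i "u x" 0] by simp
    have "has_weak_partial U k (\<lambda>x. primitive g (u x)) (\<lambda>x. g (u x) * v x)"
    proof (rule has_weak_partial_dominated_limit[OF U _ pl bnd])
      show "has_weak_partial U k (\<lambda>x. primitive (f i) (u x)) (\<lambda>x. f i (u x) * v x)" for i
        using f by (simp add: P_def)
      show "(\<lambda>i. f i (u x) * v x) \<longlonglongrightarrow> g (u x) * v x" for x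
        by (intro tendsto_intros fg)
      show "norm (f i (u x) * v x) \<le> C * norm (v x)" for i x
        using fC[of i "u x"] by (simp add: abs_mult mult_right_mono)
      show "locally_integrable_on U (\<lambda>x. C * norm (u x))" "locally_integrable_on U (\<lambda>x. C * norm (v x))"
        using loc by (auto simp: locally_integrable_on_def)
    qed
    then show ?thesis using gm gC unfolding P_def by blast
  qed
  have cont: "P f" if "continuous_on UNIV f" "\<And>x. \<bar>f x\<bar> \<le> C" for f C
    using weak_partial_primitive_continuous[OF U uv that] that borel_measurable_continuous_onI[OF that(1)]
    unfolding P_def by blast
  \<comment> \<open>The indicator of an open set is an increasing limit of truncated multiples of
    the distance to the complement. The whole line is separate since \<open>infdist\<close> to the
    empty set is 0 by convention.\<close>
  have op: "P (indicator S)" if S: "open S" for S :: "real set"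
  proof (cases "S = UNIV")
    case True
    then have "indicator S = (\<lambda>x. 1 :: real)" by (auto simp: indicator_def)
    then show ?thesis using cont[of "\<lambda>x. 1" 1] by simp
  next
    case False
    then have ne: "- S \<noteq> {}" by auto
    let ?f = "\<lambda>n x. min 1 (real n * infdist x (- S))"
    show ?thesis
    proof (rule lim)
      show "\<bar>?f n x\<bar> \<le> 1" for n x by (simp add: infdist_nonneg)
      show "P (?f n)" for n
        by (rule cont[of _ 1]) (auto intro!: continuous_intros simp: infdist_nonneg)
      show "(\<lambda>n. ?f n x) \<longlonglongrightarrow> indicator S x" for x
      proof (cases "x \<in> S")
        case True
        have "infdist x (- S) > 0"
          using in_closed_iff_infdist_zero[OF _ ne, of x] S True infdist_nonneg[of x "- S"] by (force simp: closed_Compl)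
        then obtain N where N: "real N * infdist x (- S) \<ge> 1"
          by (meson less_imp_le reals_Archimedean3)
        have "eventually (\<lambda>n. ?f n x = 1) sequentially"
        proof (rule eventually_sequentiallyI[of N])
          fix n assume "N \<le> n"
          then have "real N * infdist x (- S) \<le> real n * infdist x (- S)"
            by (intro mult_right_mono) (auto simp: infdist_nonneg)
          then show "?f n x = 1" using N by simp
        qed
        then show ?thesis using True by (simp add: tendsto_eventually)
      next
        case False
        then show ?thesis by (simp add: infdist_zero)
      qed
    qed
  qed
  have "P g"
    by (rule bounded_borel_induct[of P, OF op lin lim g])
  then show ?thesis by (simp add: P_def)
qed

section \<open>Lipschitz functions as primitives\<close>

lemma measure_interval_measure_Ioc:
  assumes "mono p" "continuous_on UNIV p" "a \<le> b"
  shows "emeasure (interval_measure p) {a<..b} = ennreal (p b - p a)"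
  using assms
  by (intro emeasure_interval_measure_Ioc)
    (auto simp: mono_def continuous_on_eq_continuous_at continuous_at_imp_continuous_within)

text \<open>Agreement on half-open intervals extends to Borel sets because these intervals form an
  intersection-stable generator. Everything is cut to one bounded interval, as complements can be
  subtracted only from finite measures.\<close>

lemma interval_measure_sum:
  fixes p q :: "real \<Rightarrow> real"
  assumes p: "mono p" "continuous_on UNIV p" and q: "mono q" "continuous_on UNIV q"
    and pq: "\<And>x. p x + q x = c * x" and ab: "a \<le> b" and X: "X \<in> sets borel"
  shows "measure (interval_measure p) (X \<inter> {a<..b}) + measure (interval_measure q) (X \<inter> {a<..b}) =
           c * measure lborel (X \<inter> {a<..b})"
proof -
  let ?p = "interval_measure p" and ?q = "interval_measure q" and ?I = "{a<..b}"
  have fin: "emeasure ?p (X \<inter> ?I) \<noteq> \<infinity>" "emeasure ?q (X \<inter> ?I) \<noteq> \<infinity>" "emeasure lborel (X \<inter> ?I) \<noteq> \<infinity>"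
    if "X \<in> sets borel" for X
  proof -
    have "emeasure ?p (X \<inter> ?I) \<le> emeasure ?p ?I" "emeasure ?q (X \<inter> ?I) \<le> emeasure ?q ?I"
      "emeasure lborel (X \<inter> ?I) \<le> emeasure lborel ?I"
      by (auto intro!: emeasure_mono)
    then show "emeasure ?p (X \<inter> ?I) \<noteq> \<infinity>" "emeasure ?q (X \<inter> ?I) \<noteq> \<infinity>" "emeasure lborel (X \<inter> ?I) \<noteq> \<infinity>"
      using ab by (auto simp: measure_interval_measure_Ioc[OF p] measure_interval_measure_Ioc[OF q] top_unique)
  qed
  have Ioc: "measure ?p {s<..t} + measure ?q {s<..t} = c * measure lborel {s<..t}" if "s \<le> t" for s t
  proof -
    have "measure ?p {s<..t} = p t - p s" "measure ?q {s<..t} = q t - q s"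
      using that p(1) q(1) by (auto simp: measure_def measure_interval_measure_Ioc[OF p] measure_interval_measure_Ioc[OF q] mono_def)
    moreover have "(p t + q t) - (p s + q s) = c * (t - s)" unfolding pq by (simp add: algebra_simps)
    ultimately show ?thesis using that by simp
  qed
  let ?G = "range (\<lambda>(s, t). {s<..t::real})"
  have sG: "sigma_sets UNIV ?G = sets borel"
    by (subst borel_sigma_sets_Ioc) simp
  have "{s<..t} \<inter> {s'<..t'} = {max s s'<..min t t'}" for s t s' t' :: real by auto
  then have "Int_stable ?G" "?G \<subseteq> Pow UNIV"
    unfolding Int_stable_def by auto
  moreover have "X \<in> sigma_sets UNIV ?G" unfolding sG by (rule X)
  ultimately show ?thesis
  proof (induction rule: sigma_sets_induct_disjoint)
    case (basic X)
    then obtain s t where X: "X = {s<..t}" by auto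
    have eq: "X \<inter> ?I = {max s a<..min t b}" by (auto simp: X)
    show ?case
    proof (cases "max s a \<le> min t b")
      case True
      show ?thesis unfolding eq by (rule Ioc[OF True])
    next
      case False
      then have e: "{max s a<..min t b} = {}" by auto
      show ?thesis unfolding eq e by simp
    qed
  next
    case empty
    show ?case by simp
  next
    case (compl X)
    have Xb: "X \<in> sets borel" using compl(1) unfolding sG .
    have D: "measure M (?I - X \<inter> ?I) = measure M ?I - measure M (X \<inter> ?I)"
      if "sets M = sets borel" "emeasure M ?I \<noteq> \<infinity>" for M
      by (rule measure_Diff) (use that Xb in auto)
    have I: "emeasure ?p ?I \<noteq> \<infinity>" "emeasure ?q ?I \<noteq> \<infinity>" "emeasure lborel ?I \<noteq> \<infinity>"
      using fin[of UNIV] by simp_all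
    have eq: "(UNIV - X) \<inter> ?I = ?I - X \<inter> ?I" by auto
    show ?case
      unfolding eq D[OF sets_interval_measure I(1)] D[OF sets_interval_measure I(2)] D[OF sets_lborel I(3)]
      using compl(2) Ioc[OF ab] by (simp only: right_diff_distrib)
  next
    case (union A)
    have Ab: "A i \<in> sets borel" for i using union(2) unfolding sG by auto
    have sums: "(\<lambda>i. measure M (A i \<inter> ?I)) sums measure M ((\<Union>i. A i) \<inter> ?I)"
      if "sets M = sets borel" "emeasure M ((\<Union>i. A i) \<inter> ?I) \<noteq> \<infinity>" for M
    proof -
      have "(\<lambda>i. measure M (A i \<inter> ?I)) sums measure M (\<Union>i. A i \<inter> ?I)"
      proof (rule measure_UNION)
        show "range (\<lambda>i. A i \<inter> ?I) \<subseteq> sets M" using that(1) Ab by auto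
        show "disjoint_family (\<lambda>i. A i \<inter> ?I)" using union(1) unfolding disjoint_family_on_def by blast
        show "emeasure M (\<Union>i. A i \<inter> ?I) \<noteq> \<infinity>" using that(2) by simp
      qed
      then show ?thesis by simp
    qed
    have U: "(\<Union>i. A i) \<in> sets borel" using Ab by auto
    have "(\<lambda>i. measure ?p (A i \<inter> ?I) + measure ?q (A i \<inter> ?I)) sums
        (measure ?p ((\<Union>i. A i) \<inter> ?I) + measure ?q ((\<Union>i. A i) \<inter> ?I))"
      by (intro sums_add sums) (use fin[OF U] in auto)
    moreover have "(\<lambda>i. c * measure lborel (A i \<inter> ?I)) sums (c * measure lborel ((\<Union>i. A i) \<inter> ?I))"
      by (intro sums_mult sums) (use fin[OF U] in auto)
    ultimately show ?case using sums_unique2 unfolding union(3) by blast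
  qed
qed

text \<open>The interval measures of \<open>p\<close> and of \<open>C x - p\<close> add up to \<open>C\<close> times Lebesgue measure, so the first is
  absolutely continuous with density at most \<open>C\<close>.\<close>

lemma mono_lipschitz_density:
  fixes p :: "real \<Rightarrow> real"
  assumes p: "mono p" and Lip: "\<And>x y. \<bar>p x - p y\<bar> \<le> C * \<bar>x - y\<bar>"
  obtains g where "g \<in> borel_measurable borel" "\<And>x. 0 \<le> g x" "\<And>x. g x \<le> C"
    "\<And>a b. a \<le> b \<Longrightarrow> p b - p a = (\<integral>x. indicator {a..<b} x * g x \<partial>lborel)"
proof -
  have C: "C \<ge> 0" using Lip[of 1 0] by simp
  have cont: "continuous_on UNIV f" if "\<And>x y. \<bar>f x - f y\<bar> \<le> K * \<bar>x - y\<bar>" "K \<ge> 0" for f :: "real \<Rightarrow> real" and K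
  proof -
    have "K-lipschitz_on UNIV f" using that by (intro lipschitz_onI) (auto simp: dist_real_def)
    then show ?thesis by (rule lipschitz_on_continuous_on)
  qed
  have pc: "continuous_on UNIV p" by (rule cont[OF Lip C])
  define q where "q = (\<lambda>x. C * x - p x)"
  have qm: "mono q"
  proof (rule monoI)
    fix x y :: real assume "x \<le> y"
    then show "q x \<le> q y" using Lip[of y x] by (simp add: q_def algebra_simps)
  qed
  have qc: "continuous_on UNIV q" unfolding q_def by (intro continuous_intros pc)
  have pq: "p x + q x = C * x" for x by (simp add: q_def)
  let ?\<mu> = "interval_measure p"
  define I where "I = (\<lambda>n::nat. {- real n<..real n})"
  have finI: "emeasure ?\<mu> (X \<inter> I n) \<noteq> \<infinity>" "emeasure lborel (X \<inter> I n) \<noteq> \<infinity>" if "X \<in> sets borel" for X n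
  proof -
    have "emeasure ?\<mu> (X \<inter> I n) \<le> emeasure ?\<mu> (I n)" "emeasure lborel (X \<inter> I n) \<le> emeasure lborel (I n)"
      by (rule emeasure_mono; simp add: I_def)+
    moreover have "emeasure ?\<mu> (I n) < \<infinity>" "emeasure lborel (I n) < \<infinity>"
      by (auto simp: I_def measure_interval_measure_Ioc[OF p pc])
    ultimately show "emeasure ?\<mu> (X \<inter> I n) \<noteq> \<infinity>" "emeasure lborel (X \<inter> I n) \<noteq> \<infinity>"
      by auto
  qed
  have le: "emeasure ?\<mu> (X \<inter> I n) \<le> ennreal C * emeasure lborel (X \<inter> I n)" if X: "X \<in> sets borel" for X n
  proof -
    have "measure ?\<mu> (X \<inter> I n) \<le> C * measure lborel (X \<inter> I n)"
    proof -
      have "- real n \<le> real n" by simp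
      from interval_measure_sum[OF p pc qm qc pq this X]
        measure_nonneg[of "interval_measure q" "X \<inter> {- real n<..real n}"]
      show ?thesis unfolding I_def by linarith
    qed
    then show ?thesis
      using finI[OF X, of n] C by (simp add: emeasure_eq_ennreal_measure ennreal_mult[symmetric] ennreal_leI)
  qed
  have Icov: "(\<Union>n. X \<inter> I n) = X" for X
  proof -
    have "\<exists>n. x \<in> I n" for x
    proof -
      obtain n where "\<bar>x\<bar> < real n" using reals_Archimedean2 by blast
      then show ?thesis by (intro exI[of _ n]) (auto simp: I_def)
    qed
    then show ?thesis by blast
  qed
  have ac: "absolutely_continuous lborel ?\<mu>"
    unfolding absolutely_continuous_def
  proof
    fix X assume X: "X \<in> null_sets (lborel :: real measure)"
    then have Xb: "X \<in> sets borel" by auto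
    have "X \<inter> I n \<in> null_sets ?\<mu>" for n
    proof -
      have "emeasure lborel (X \<inter> I n) = 0"
        by (rule emeasure_eq_0[OF null_setsD2[OF X] null_setsD1[OF X]]) simp
      then have "emeasure ?\<mu> (X \<inter> I n) = 0" using le[OF Xb, of n] by simp
      then show ?thesis using Xb by (intro null_setsI) (simp_all add: I_def)
    qed
    then have "(\<Union>n. X \<inter> I n) \<in> null_sets ?\<mu>" by (rule null_sets_UN)
    then show "X \<in> null_sets ?\<mu>" unfolding Icov .
  qed
  obtain h where h: "h \<in> borel_measurable lborel" "density lborel h = ?\<mu>"
    using sigma_finite_measure.Radon_Nikodym[OF sigma_finite_lborel ac] by auto
  have hm [measurable]: "h \<in> borel_measurable borel" using h(1) by simp
  have hX: "emeasure ?\<mu> X = (\<integral>\<^sup>+x. h x * indicator X x \<partial>lborel)" if "X \<in> sets borel" for X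
    unfolding h(2)[symmetric] by (rule emeasure_density) (use that in auto)
  have "AE x in lborel. x \<in> I n \<longrightarrow> h x \<le> ennreal C" for n
  proof -
    \<comment> \<open>Where the density exceeds \<open>C\<close>, the integral of the excess is 0 by
      \<open>le\<close>, so the excess is concentrated on a null set. Cutting to \<open>I n\<close>
      keeps both integrals finite.\<close>
    define X where "X = {x. h x > ennreal C}"
    have X [measurable]: "X \<in> sets borel" unfolding X_def by measurable
    have Im [measurable]: "I n \<in> sets borel" by (simp add: I_def)
    have eq1: "(\<integral>\<^sup>+x. h x * indicator (X \<inter> I n) x \<partial>lborel) = emeasure ?\<mu> (X \<inter> I n)"
      by (rule hX[symmetric]) measurable
    have eq2: "(\<integral>\<^sup>+x. ennreal C * indicator (X \<inter> I n) x \<partial>lborel) = ennreal C * emeasure lborel (X \<inter> I n)"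
      by (rule nn_integral_cmult_indicator) measurable
    have "(\<integral>\<^sup>+x. h x * indicator (X \<inter> I n) x - ennreal C * indicator (X \<inter> I n) x \<partial>lborel) =
       (\<integral>\<^sup>+x. h x * indicator (X \<inter> I n) x \<partial>lborel) - (\<integral>\<^sup>+x. ennreal C * indicator (X \<inter> I n) x \<partial>lborel)"
    proof (rule nn_integral_diff)
      show "(\<integral>\<^sup>+x. ennreal C * indicator (X \<inter> I n) x \<partial>lborel) \<noteq> \<infinity>"
        unfolding eq2 using finI(2)[OF X, of n] by (simp add: ennreal_mult_eq_top_iff)
      show "AE x in lborel. ennreal C * indicator (X \<inter> I n) x \<le> h x * indicator (X \<inter> I n) x"
        by (intro AE_I2) (auto simp: indicator_def X_def)
    qed measurable
    also have "\<dots> = 0"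
      unfolding eq1 eq2 using le[OF X, of n] finI(1)[OF X, of n] by (simp add: diff_eq_0_iff_ennreal less_top)
    finally have "AE x in lborel. h x * indicator (X \<inter> I n) x - ennreal C * indicator (X \<inter> I n) x = 0"
      by (subst (asm) nn_integral_0_iff_AE) measurable
    then show ?thesis
    proof eventually_elim
      case (elim x)
      show ?case
      proof
        assume x: "x \<in> I n"
        show "h x \<le> ennreal C"
        proof (rule ccontr)
          assume "\<not> h x \<le> ennreal C"
          then have "x \<in> X \<inter> I n" and gt: "h x > ennreal C" using x by (auto simp: X_def)
          then have "h x - ennreal C = 0" using elim by simp
          then show False using gt by (metis diff_gr0_ennreal ennreal_less_top less_irrefl)
        qed
      qed
    qed
  qed
  then have "AE x in lborel. \<forall>n. x \<in> I n \<longrightarrow> h x \<le> ennreal C"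
    by (subst AE_all_countable) blast
  then have hC: "AE x in lborel. h x \<le> ennreal C"
  proof eventually_elim
    case (elim x)
    then show ?case using Icov[of UNIV] by auto
  qed
  \<comment> \<open>The density is at most \<open>C\<close> almost everywhere; the minimum makes it
    real and bounded at every point.\<close>
  define g where "g = (\<lambda>x. min C (enn2real (h x)))"
  have gm [measurable]: "g \<in> borel_measurable borel" unfolding g_def by measurable
  have g0: "0 \<le> g x" "g x \<le> C" for x using C by (auto simp: g_def)
  have hg: "AE x in lborel. h x = ennreal (g x)"
    using hC
  proof eventually_elim
    case (elim x)
    then have "enn2real (h x) \<le> C" using C by (simp add: enn2real_leI)
    moreover have "ennreal (enn2real (h x)) = h x" using elim by (intro ennreal_enn2real) (auto simp: le_less_trans)
    ultimately show ?case by (simp add: g_def min_def)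
  qed
  have "p b - p a = (\<integral>x. indicator {a..<b} x * g x \<partial>lborel)" if ab: "a \<le> b" for a b
  proof -
    have i: "integrable lborel (\<lambda>x. indicator {a..<b} x * g x)"
      using integrable_scaleR_bounded[OF integrable_indicator_Ico[of a b], of g C] g0 by (simp add: mult.commute)
    have "ennreal (p b - p a) = emeasure ?\<mu> {a<..b}"
      by (rule measure_interval_measure_Ioc[OF p pc ab, symmetric])
    also have "\<dots> = (\<integral>\<^sup>+x. h x * indicator {a<..b} x \<partial>lborel)" by (rule hX) simp
    also have "\<dots> = (\<integral>\<^sup>+x. ennreal (indicator {a..<b} x * g x) \<partial>lborel)"
    proof (rule nn_integral_cong_AE)
      \<comment> \<open>The interval measure is known on \<open>{a<..b}\<close>, whereas
        \<open>primitive\<close> uses \<open>{a..<b}\<close>; the two endpoints form a null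
        set.\<close>
      show "AE x in lborel. h x * indicator {a<..b} x = ennreal (indicator {a..<b} x * g x)"
        using hg AE_lborel_singleton[of a] AE_lborel_singleton[of b]
        by eventually_elim (auto simp: indicator_def)
    qed
    also have "\<dots> = ennreal (\<integral>x. indicator {a..<b} x * g x \<partial>lborel)"
      by (rule nn_integral_eq_integral[OF i]) (use g0 in auto)
    finally show ?thesis
      using monoD[OF p ab] g0 by (subst (asm) ennreal_inj) (auto intro!: integral_nonneg_AE)
  qed
  then show ?thesis using that[of g] g0 gm by blast
qed

text \<open>Adding \<open>L * x\<close> makes \<open>f\<close> increasing with Lipschitz constant
  \<open>2 * L\<close>, so there is a density with values in \<open>{0..2 * L}\<close>. Subtracting
  \<open>L\<close> from it returns to \<open>f\<close> and centres the bound at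
  \<open>L\<close>.\<close>

lemma lipschitz_eq_primitive:
  fixes f :: "real \<Rightarrow> real"
  assumes Lip: "\<And>x y. \<bar>f x - f y\<bar> \<le> L * \<bar>x - y\<bar>"
  obtains g where "g \<in> borel_measurable borel" "\<And>x. \<bar>g x\<bar> \<le> L" "\<And>x. f x = f 0 + primitive g x"
proof -
  define p where "p = (\<lambda>x. f x + L * x)"
  have L: "L \<ge> 0" using Lip[of 1 0] by simp
  have pm: "mono p"
  proof (rule monoI)
    fix x y :: real assume "x \<le> y"
    then show "p x \<le> p y" using Lip[of y x] by (simp add: p_def algebra_simps)
  qed
  have pL: "\<bar>p x - p y\<bar> \<le> 2 * L * \<bar>x - y\<bar>" for x y
  proof -
    have "\<bar>p x - p y\<bar> = \<bar>(f x - f y) + L * (x - y)\<bar>" by (simp add: p_def algebra_simps)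
    also have "\<dots> \<le> \<bar>f x - f y\<bar> + \<bar>L * (x - y)\<bar>" by (rule abs_triangle_ineq)
    also have "\<dots> \<le> L * \<bar>x - y\<bar> + L * \<bar>x - y\<bar>"
      using Lip[of x y] L by (simp add: abs_mult)
    finally show ?thesis by simp
  qed
  obtain g where g: "g \<in> borel_measurable borel" "\<And>x. 0 \<le> g x" "\<And>x. g x \<le> 2 * L"
    "\<And>a b. a \<le> b \<Longrightarrow> p b - p a = (\<integral>x. indicator {a..<b} x * g x \<partial>lborel)"
    by (rule mono_lipschitz_density[OF pm pL]) blast
  define g' where "g' = (\<lambda>x. g x - L)"
  have g'm: "g' \<in> borel_measurable borel" unfolding g'_def using g(1) by measurable
  have g'L: "\<bar>g' x\<bar> \<le> L" for x using g(2,3)[of x] by (simp add: g'_def abs_le_iff)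
  have diff: "primitive g' b - primitive g' a = f b - f a" if ab: "a \<le> b" for a b
  proof -
    have i: "integrable lborel (\<lambda>x. indicator {a..<b} x * g x)"
      using integrable_scaleR_bounded[OF integrable_indicator_Ico[of a b], of g "2 * L"] g by (simp add: mult.commute)
    have "primitive g' b - primitive g' a = (\<integral>x. indicator {a..<b} x * g' x \<partial>lborel)"
      by (rule primitive_diff[OF g'm g'L ab])
    also have "\<dots> = (\<integral>x. indicator {a..<b} x * g x - indicator {a..<b} x * L \<partial>lborel)"
      by (simp add: g'_def right_diff_distrib)
    also have "\<dots> = (\<integral>x. indicator {a..<b} x * g x \<partial>lborel) - (\<integral>x. indicator {a..<b} x * L \<partial>lborel)"
      by (rule Bochner_Integration.integral_diff[OF i]) simp
    also have "(\<integral>x. indicator {a..<b} x * L \<partial>lborel) = (b - a) * L" using ab by simp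
    also have "(\<integral>x. indicator {a..<b} x * g x \<partial>lborel) = p b - p a" by (rule g(4)[OF ab, symmetric])
    finally show ?thesis by (simp add: p_def algebra_simps)
  qed
  have "f x = f 0 + primitive g' x" for x
    using diff[of 0 x] diff[of x 0] by (cases "0 \<le> x") auto
  then show ?thesis using that g'm g'L by blast
qed

section \<open>Differences of convex Lipschitz functions\<close>

text \<open>An infimum instead of a limit: for convex \<open>F\<close> the quotients decrease as
  \<open>t\<close> decreases to 0, so both agree, and the infimum makes upper semicontinuity
  immediate.\<close>

definition dir_deriv :: "('v::euclidean_space \<Rightarrow> real) \<Rightarrow> 'v \<Rightarrow> 'v \<Rightarrow> real" where
  "dir_deriv F A H = (INF t\<in>{0<..}. (F (A + t *\<^sub>R H) - F A) / t)"

locale convex_lipschitz =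
  fixes F :: "'v::euclidean_space \<Rightarrow> real" and L :: real
  assumes convex: "convex_on UNIV F" and lipschitz: "\<bar>F x - F y\<bar> \<le> L * norm (x - y)"
begin

lemma quotient_bound: "\<bar>(F (A + t *\<^sub>R H) - F A) / t\<bar> \<le> L * norm H" if "t \<noteq> 0"
  using lipschitz[of "A + t *\<^sub>R H" A] that by (simp add: divide_simps) (simp add: algebra_simps)

lemma quotient_bdd_below: "bdd_below ((\<lambda>t. (F (A + t *\<^sub>R H) - F A) / t) ` {0<..})"
proof (rule bdd_belowI2)
  fix t :: real assume "t \<in> {0<..}"
  then have "t \<noteq> 0" by simp
  then show "- (L * norm H) \<le> (F (A + t *\<^sub>R H) - F A) / t"
    using quotient_bound[of t A H] by linarith
qed

lemma quotient_mono:
  assumes "0 < s" "s \<le> t"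
  shows "(F (A + s *\<^sub>R H) - F A) / s \<le> (F (A + t *\<^sub>R H) - F A) / t"
proof -
  have t: "t > 0" using assms by simp
  have "F ((1 - s / t) *\<^sub>R A + (s / t) *\<^sub>R (A + t *\<^sub>R H)) \<le> (1 - s / t) * F A + (s / t) * F (A + t *\<^sub>R H)"
    using assms t by (intro convex_onD[OF convex]) auto
  moreover have "(1 - s / t) *\<^sub>R A + (s / t) *\<^sub>R (A + t *\<^sub>R H) = A + s *\<^sub>R H"
    using t by (simp add: algebra_simps)
  ultimately have "F (A + s *\<^sub>R H) \<le> (1 - s / t) * F A + (s / t) * F (A + t *\<^sub>R H)"
    by (simp only:)
  then have "F (A + s *\<^sub>R H) - F A \<le> (s / t) * (F (A + t *\<^sub>R H) - F A)"
    by (simp add: algebra_simps)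
  then show ?thesis
    using assms(1) t by (simp add: field_simps)
qed

lemma dir_deriv_le: "dir_deriv F A H \<le> (F (A + t *\<^sub>R H) - F A) / t" if "t > 0"
  unfolding dir_deriv_def using that by (intro cINF_lower quotient_bdd_below) auto

lemma dir_deriv_less:
  assumes "dir_deriv F A H < y"
  obtains t where "t > 0" "(F (A + t *\<^sub>R H) - F A) / t < y"
  using assms unfolding dir_deriv_def
  by (subst (asm) cINF_less_iff) (use quotient_bdd_below in auto)

lemma quotient_limit:
  assumes t: "t \<longlonglongrightarrow> 0" "\<And>n. t n > 0"
  shows "(\<lambda>n. (F (A + t n *\<^sub>R H) - F A) / t n) \<longlonglongrightarrow> dir_deriv F A H"
proof (rule order_tendstoI)
  fix y assume "y < dir_deriv F A H"
  then show "\<forall>\<^sub>F n in sequentially. y < (F (A + t n *\<^sub>R H) - F A) / t n"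
    using dir_deriv_le[OF t(2)] by (intro always_eventually allI) (rule less_le_trans)
next
  fix y assume "dir_deriv F A H < y"
  then obtain s where s: "s > 0" "(F (A + s *\<^sub>R H) - F A) / s < y" by (rule dir_deriv_less)
  have "\<forall>\<^sub>F n in sequentially. t n < s" using order_tendstoD(2)[OF t(1) s(1)] .
  then show "\<forall>\<^sub>F n in sequentially. (F (A + t n *\<^sub>R H) - F A) / t n < y"
  proof eventually_elim
    case (elim n)
    then show ?case using quotient_mono[OF t(2)[of n], of s A H] s(2) by simp
  qed
qed

lemma quotient_limit_neg:
  assumes t: "t \<longlonglongrightarrow> 0" "\<And>n. t n > 0"
  shows "(\<lambda>n. (F (A + (- t n) *\<^sub>R H) - F A) / (- t n)) \<longlonglongrightarrow> - dir_deriv F A (- H)"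
  using tendsto_minus[OF quotient_limit[OF t, of A "- H"]] by simp

lemma dir_deriv_bound: "\<bar>dir_deriv F A H\<bar> \<le> L * norm H"
proof (rule LIMSEQ_le_const2)
  have t: "(\<lambda>n. 1 / real (Suc n)) \<longlonglongrightarrow> 0" by (rule LIMSEQ_Suc[OF lim_1_over_n])
  show "(\<lambda>n. \<bar>(F (A + (1 / real (Suc n)) *\<^sub>R H) - F A) / (1 / real (Suc n))\<bar>) \<longlonglongrightarrow> \<bar>dir_deriv F A H\<bar>"
    by (intro tendsto_rabs quotient_limit t) simp
  show "\<exists>N. \<forall>n\<ge>N. \<bar>(F (A + (1 / real (Suc n)) *\<^sub>R H) - F A) / (1 / real (Suc n))\<bar> \<le> L * norm H"
    by (intro exI allI impI quotient_bound) simp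
qed

text \<open>Convexity at \<open>A\<close> as the midpoint of \<open>A + t *\<^sub>R H\<close> and
  \<open>A - t *\<^sub>R H\<close>. Equality here means that \<open>F\<close> has a two-sided
  derivative at \<open>A\<close> in the direction \<open>H\<close>.\<close>

lemma dir_deriv_opposite: "- dir_deriv F A (- H) \<le> dir_deriv F A H"
proof -
  define t where "t = (\<lambda>n. 1 / real (Suc n))"
  have t: "t \<longlonglongrightarrow> 0" "\<And>n. t n > 0"
    using LIMSEQ_Suc[OF lim_1_over_n] by (auto simp: t_def)
  show ?thesis
  proof (rule LIMSEQ_le[OF tendsto_minus[OF quotient_limit[OF t, of A "- H"]] quotient_limit[OF t, of A H]], intro exI allI impI)
    fix n
    have "F ((1 - 1/2) *\<^sub>R (A + t n *\<^sub>R H) + (1/2) *\<^sub>R (A + t n *\<^sub>R - H)) \<le> (1 - 1/2) * F (A + t n *\<^sub>R H) + (1/2) * F (A + t n *\<^sub>R - H)"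
      by (rule convex_onD[OF convex]) auto
    moreover have "(1 - 1/2) *\<^sub>R (A + t n *\<^sub>R H) + (1/2) *\<^sub>R (A + t n *\<^sub>R - H) = A"
      by (simp add: algebra_simps flip: scaleR_left_distrib)
    ultimately have "2 * F A \<le> F (A + t n *\<^sub>R H) + F (A + t n *\<^sub>R - H)" by simp
    then show "- ((F (A + t n *\<^sub>R - H) - F A) / t n) \<le> (F (A + t n *\<^sub>R H) - F A) / t n"
      using t(2)[of n] by (simp add: divide_simps)
  qed
qed

lemma continuous: "continuous_on UNIV F"
proof -
  have "L \<ge> 0"
    using lipschitz[of "SOME b. b \<in> Basis" 0] norm_some_Basis[where 'a='v] by simp
  then have "L-lipschitz_on UNIV F" using lipschitz by (intro lipschitz_onI) (auto simp: dist_norm)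
  then show ?thesis by (rule lipschitz_on_continuous_on)
qed

lemma borel [measurable]: "F \<in> borel_measurable borel"
  by (rule borel_measurable_continuous_onI[OF continuous])

text \<open>A single \<open>t\<close> whose quotient at \<open>(a, h)\<close> lies below
  \<open>y\<close> works for all nearby points, because the quotient with fixed \<open>t\<close> is
  continuous and dominates the directional derivative.\<close>

lemma dir_deriv_upper_semicontinuous:
  assumes A: "A \<longlonglongrightarrow> a" and H: "H \<longlonglongrightarrow> h" and y: "dir_deriv F a h < y"
  shows "\<forall>\<^sub>F n in sequentially. dir_deriv F (A n) (H n) < y"
proof -
  obtain t where t: "t > 0" "(F (a + t *\<^sub>R h) - F a) / t < y" using y by (rule dir_deriv_less)
  have lim: "(\<lambda>n. F (X n)) \<longlonglongrightarrow> F x" if "X \<longlonglongrightarrow> x" for X x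
    using continuous_on_tendsto_compose[OF continuous that] by simp
  have "(\<lambda>n. (F (A n + t *\<^sub>R H n) - F (A n)) / t) \<longlonglongrightarrow> (F (a + t *\<^sub>R h) - F a) / t"
    using t(1) by (intro tendsto_intros lim A H) auto
  from order_tendstoD(2)[OF this t(2)] show ?thesis
  proof eventually_elim
    case (elim n)
    then show ?case using dir_deriv_le[OF t(1), of "A n" "H n"] by simp
  qed
qed

text \<open>Upper semicontinuity in the direction \<open>h\<close> bounds the limit from above; in
  the direction \<open>- h\<close>, combined with \<open>dir_deriv_opposite\<close>, it bounds the
  limit from below. The hypothesis \<open>eq\<close> makes the two bounds meet.\<close>

lemma dir_deriv_tendsto:
  assumes A: "A \<longlonglongrightarrow> a" and H: "H \<longlonglongrightarrow> h" and eq: "dir_deriv F a h = - dir_deriv F a (- h)"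
  shows "(\<lambda>n. dir_deriv F (A n) (H n)) \<longlonglongrightarrow> dir_deriv F a h"
proof (rule order_tendstoI)
  fix y assume "dir_deriv F a h < y"
  then show "\<forall>\<^sub>F n in sequentially. dir_deriv F (A n) (H n) < y"
    by (rule dir_deriv_upper_semicontinuous[OF A H])
next
  fix y assume "y < dir_deriv F a h"
  then have "dir_deriv F a (- h) < - y" using eq by simp
  from dir_deriv_upper_semicontinuous[OF A tendsto_minus[OF H] this]
  show "\<forall>\<^sub>F n in sequentially. y < dir_deriv F (A n) (H n)"
  proof eventually_elim
    case (elim n)
    then show ?case using dir_deriv_opposite[of "A n" "H n"] by linarith
  qed
qed

lemma weak_partial_chain:
  fixes u v :: "real ^ 'm \<Rightarrow> 'v"
  assumes U: "open U" and uv: "has_weak_partial U k u v"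
  shows "has_weak_partial U k (\<lambda>x. F (u x)) (\<lambda>x. dir_deriv F (u x) (v x))"
    and "has_weak_partial U k (\<lambda>x. F (u x)) (\<lambda>x. - dir_deriv F (u x) (- v x))"
proof -
  define t where "t = (\<lambda>n. 1 / real (Suc n))"
  have t: "t \<longlonglongrightarrow> 0" "\<And>n. t n > 0"
    using LIMSEQ_Suc[OF lim_1_over_n] by (auto simp: t_def)
  have t0: "\<And>n. t n \<noteq> 0" using t(2) by (metis less_irrefl)
  show "has_weak_partial U k (\<lambda>x. F (u x)) (\<lambda>x. dir_deriv F (u x) (v x))"
    by (rule weak_partial_directional_chain[OF U uv lipschitz t(1) t0 quotient_limit[OF t]])
  have t': "(\<lambda>n. - t n) \<longlonglongrightarrow> 0" using tendsto_minus[OF t(1)] by simp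
  have t0': "\<And>n. - t n \<noteq> 0" using t0 by simp
  show "has_weak_partial U k (\<lambda>x. F (u x)) (\<lambda>x. - dir_deriv F (u x) (- v x))"
    by (rule weak_partial_directional_chain[where dF = "\<lambda>A H. - dir_deriv F A (- H)", OF U uv lipschitz t' t0' quotient_limit_neg[OF t]])
qed

end

section \<open>Uniqueness of weak derivatives and convergence of powers\<close>

lemma has_weak_partial_unique:
  fixes u v w :: "real ^ 'm \<Rightarrow> 'v::euclidean_space"
  assumes U: "open U" and v: "has_weak_partial U k u v" and w: "has_weak_partial U k u w"
  shows "AE x in lebesgue_on U. v x = w x"
proof -
  have 0: "has_weak_partial U k (\<lambda>x. 1 *\<^sub>R u x + (- 1) *\<^sub>R u x) (\<lambda>x. 1 *\<^sub>R v x + (- 1) *\<^sub>R w x)"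
    by (rule has_weak_partial_lin[OF U v w])
  have "AE x in lebesgue_on U. 1 *\<^sub>R v x + (- 1) *\<^sub>R w x = 0"
  proof (rule test_zero_imp_AE_zero[OF U])
    show "locally_integrable_on U (\<lambda>x. 1 *\<^sub>R v x + (- 1) *\<^sub>R w x)"
      using 0 by (simp add: has_weak_partial_def)
    show "(\<integral>x. \<phi> x *\<^sub>R (1 *\<^sub>R v x + (- 1) *\<^sub>R w x) \<partial>lebesgue_on U) = 0" if "\<phi> \<in> test_functions U" for \<phi>
      using 0 that by (simp add: has_weak_partial_def)
  qed
  then show ?thesis by eventually_elim simp
qed

lemma powr_add_le:
  fixes a b q :: real
  assumes "a \<ge> 0" "b \<ge> 0" "q \<ge> 0"
  shows "(a + b) powr q \<le> 2 powr q * (a powr q + b powr q)"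
proof -
  have "(a + b) powr q \<le> (2 * max a b) powr q"
    using assms by (intro powr_mono2) auto
  also have "\<dots> = 2 powr q * (max a b) powr q" using assms by (simp add: powr_mult)
  also have "\<dots> \<le> 2 powr q * (a powr q + b powr q)"
    by (intro mult_left_mono) (auto simp: max_def)
  finally show ?thesis .
qed

text \<open>The dominating functions vary with \<open>n\<close>; ordinary dominated convergence applies to the excess
  of \<open>\<bar>X n x\<bar>\<close> over \<open>c * norm (Y n x)\<close>.\<close>

lemma integral_powr_dominated_limit:
  fixes X :: "nat \<Rightarrow> 'a \<Rightarrow> real" and Y :: "nat \<Rightarrow> 'a \<Rightarrow> 'w::euclidean_space"
  assumes q: "q \<ge> 1" and X: "\<And>n. X n \<in> borel_measurable M" and Xlim: "AE x in M. (\<lambda>n. X n x) \<longlonglongrightarrow> 0"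
    and bound: "\<And>n x. \<bar>X n x\<bar> \<le> c * norm (Y n x) + b x" and c: "c \<ge> 0"
    and Y: "\<And>n. Y n \<in> borel_measurable M" "\<And>n. integrable M (\<lambda>x. norm (Y n x) powr q)"
      "(\<lambda>n. \<integral>x. norm (Y n x) powr q \<partial>M) \<longlonglongrightarrow> 0"
    and b: "b \<in> borel_measurable M" "\<And>x. b x \<ge> 0" "integrable M (\<lambda>x. b x powr q)"
  shows "(\<lambda>n. \<integral>x. \<bar>X n x\<bar> powr q \<partial>M) \<longlonglongrightarrow> 0"
proof -
  define Z where "Z = (\<lambda>n x. max 0 (\<bar>X n x\<bar> - c * norm (Y n x)))"
  have Zm: "Z n \<in> borel_measurable M" for n unfolding Z_def using X Y(1) by measurable
  have Zb: "0 \<le> Z n x" "Z n x \<le> b x" for n x using bound[of n x] b(2)[of x] by (auto simp: Z_def)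
  have ZX: "Z n x \<le> \<bar>X n x\<bar>" for n x using c by (simp add: Z_def)
  have Zi: "integrable M (\<lambda>x. Z n x powr q)" for n
    by (rule Bochner_Integration.integrable_bound[OF b(3)])
      (use Zm q Zb in \<open>auto intro!: AE_I2 powr_mono2\<close>)
  have Zlim: "(\<lambda>n. \<integral>x. Z n x powr q \<partial>M) \<longlonglongrightarrow> (\<integral>x. 0 \<partial>M)"
  proof (rule integral_dominated_convergence[where w = "\<lambda>x. b x powr q"])
    show "AE x in M. (\<lambda>n. Z n x powr q) \<longlonglongrightarrow> 0"
      using Xlim
    proof eventually_elim
      case (elim x)
      have "(\<lambda>n. Z n x) \<longlonglongrightarrow> 0"
        by (rule tendsto_sandwich[OF _ _ tendsto_const tendsto_rabs_zero[OF elim]]) (use Zb ZX in auto)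
      then show ?case using q by (intro tendsto_zero_powrI[where b = q]) (auto simp: Zb)
    qed
    show "AE x in M. norm (Z n x powr q) \<le> b x powr q" for n
      using Zb q by (intro AE_I2) (auto intro!: powr_mono2)
  qed (use Zm b in auto)
  have est: "\<bar>X n x\<bar> powr q \<le> 2 powr q * (Z n x powr q + c powr q * norm (Y n x) powr q)" for n x
  proof -
    have "\<bar>X n x\<bar> \<le> Z n x + c * norm (Y n x)" by (simp add: Z_def)
    then have "\<bar>X n x\<bar> powr q \<le> (Z n x + c * norm (Y n x)) powr q"
      using q by (intro powr_mono2) auto
    also have "\<dots> \<le> 2 powr q * (Z n x powr q + (c * norm (Y n x)) powr q)"
      using c q Zb by (intro powr_add_le) auto
    finally show ?thesis using c by (simp add: powr_mult)
  qed
  have i: "integrable M (\<lambda>x. 2 powr q * (Z n x powr q + c powr q * norm (Y n x) powr q))" for n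
    using Zi Y(2) by simp
  have Xi: "integrable M (\<lambda>x. \<bar>X n x\<bar> powr q)" for n
    by (rule Bochner_Integration.integrable_bound[OF i[of n]])
      (use X est in \<open>auto intro!: AE_I2 order_trans[OF est]\<close>)
  have "(\<lambda>n. 2 powr q * ((\<integral>x. Z n x powr q \<partial>M) + c powr q * (\<integral>x. norm (Y n x) powr q \<partial>M))) \<longlonglongrightarrow>
      2 powr q * (0 + c powr q * 0)"
    using Zlim Y(3) by (intro tendsto_intros) auto
  then have lim0: "(\<lambda>n. 2 powr q * ((\<integral>x. Z n x powr q \<partial>M) + c powr q * (\<integral>x. norm (Y n x) powr q \<partial>M))) \<longlonglongrightarrow> 0"
    by simp
  show ?thesis
  proof (rule tendsto_sandwich[OF _ _ tendsto_const lim0])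
    show "\<forall>\<^sub>F n in sequentially. 0 \<le> (\<integral>x. \<bar>X n x\<bar> powr q \<partial>M)" by simp
    show "\<forall>\<^sub>F n in sequentially. (\<integral>x. \<bar>X n x\<bar> powr q \<partial>M) \<le>
        2 powr q * ((\<integral>x. Z n x powr q \<partial>M) + c powr q * (\<integral>x. norm (Y n x) powr q \<partial>M))"
    proof (rule always_eventually, rule allI)
      fix n
      have "(\<integral>x. \<bar>X n x\<bar> powr q \<partial>M) \<le> (\<integral>x. 2 powr q * (Z n x powr q + c powr q * norm (Y n x) powr q) \<partial>M)"
        by (rule integral_mono[OF Xi i est])
      also have "\<dots> = 2 powr q * ((\<integral>x. Z n x powr q \<partial>M) + c powr q * (\<integral>x. norm (Y n x) powr q \<partial>M))"
        using Zi Y(2) by simp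
      finally show "(\<integral>x. \<bar>X n x\<bar> powr q \<partial>M) \<le>
        2 powr q * ((\<integral>x. Z n x powr q \<partial>M) + c powr q * (\<integral>x. norm (Y n x) powr q \<partial>M))" .
    qed
  qed
qed

text \<open>Replaces Hoelder's inequality on a finite measure space: the constant term contributes
  \<open>d\<close> times the total measure, which can be made small, and the coefficient of the
  power depends on \<open>d\<close> and \<open>q\<close> only.\<close>

lemma le_add_powr:
  fixes a d q :: real
  assumes "a \<ge> 0" "d > 0" "q \<ge> 1"
  shows "a \<le> d + d powr (1 - q) * a powr q"
proof (cases "a \<le> d")
  case True
  then show ?thesis by (simp add: add_increasing2)
next
  case False
  have "a = a powr (1 - q) * a powr q"
    using False assms by (simp flip: powr_add)
  also have "\<dots> \<le> d powr (1 - q) * a powr q"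
    using False assms by (intro mult_right_mono powr_mono2') auto
  finally show ?thesis using assms(2) by linarith
qed

lemma powr_integrable_imp_integrable:
  fixes f :: "'a \<Rightarrow> 'w::euclidean_space"
  assumes M: "finite_measure M" and q: "q \<ge> 1" and f: "f \<in> borel_measurable M" "integrable M (\<lambda>x. norm (f x) powr q)"
  shows "integrable M f"
proof (rule Bochner_Integration.integrable_bound[OF _ f(1)])
  show "integrable M (\<lambda>x. 1 + 1 powr (1 - q) * norm (f x) powr q)"
    using f(2) finite_measure.integrable_const[OF M] by (intro Bochner_Integration.integrable_add integrable_mult_right)
  show "AE x in M. norm (f x) \<le> norm (1 + 1 powr (1 - q) * norm (f x) powr q)"
    using le_add_powr[of _ 1 q] q by (intro AE_I2) (metis abs_ge_self norm_ge_zero order_trans real_norm_def zero_less_one)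
qed

lemma powr_limit_imp_L1_limit:
  fixes f :: "nat \<Rightarrow> 'a \<Rightarrow> 'w::euclidean_space"
  assumes M: "finite_measure M" and q: "q \<ge> 1"
    and f: "\<And>n. f n \<in> borel_measurable M" "\<And>n. integrable M (\<lambda>x. norm (f n x) powr q)"
      "(\<lambda>n. \<integral>x. norm (f n x) powr q \<partial>M) \<longlonglongrightarrow> 0"
  shows "(\<lambda>n. \<integral>x. norm (f n x) \<partial>M) \<longlonglongrightarrow> 0"
proof (rule LIMSEQ_I)
  fix e :: real assume e: "e > 0"
  define m where "m = measure M (space M)"
  have m: "m \<ge> 0" by (simp add: m_def)
  define d where "d = e / (2 * (m + 1))"
  have d: "d > 0" using e m by (simp add: d_def)
  have dm: "d * m < e / 2"
  proof -
    have "d * m < d * (m + 1)" using d by (intro mult_strict_left_mono) auto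
    also have "\<dots> = e / 2" using m by (simp add: d_def field_simps)
    finally show ?thesis .
  qed
  have "(\<lambda>n. d powr (1 - q) * (\<integral>x. norm (f n x) powr q \<partial>M)) \<longlonglongrightarrow> 0"
    by (rule tendsto_mult_right_zero[OF f(3)])
  then obtain N where N: "\<And>n. n \<ge> N \<Longrightarrow> norm (d powr (1 - q) * (\<integral>x. norm (f n x) powr q \<partial>M)) < e / 2"
    using LIMSEQ_D[of _ 0 "e / 2"] e by fastforce
  show "\<exists>N. \<forall>n\<ge>N. norm ((\<integral>x. norm (f n x) \<partial>M) - 0) < e"
  proof (intro exI allI impI)
    fix n assume n: "n \<ge> N"
    have ic: "integrable M (\<lambda>x. d)" by (rule finite_measure.integrable_const[OF M])
    have "(\<integral>x. norm (f n x) \<partial>M) \<le> (\<integral>x. d + d powr (1 - q) * norm (f n x) powr q \<partial>M)"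
      using powr_integrable_imp_integrable[OF M q f(1,2)] f(2) ic d q
      by (intro integral_mono le_add_powr) auto
    also have "\<dots> = d * m + d powr (1 - q) * (\<integral>x. norm (f n x) powr q \<partial>M)"
      using f(2) ic by (simp add: m_def)
    also have "\<dots> < e" using N[OF n] dm by simp
    finally show "norm ((\<integral>x. norm (f n x) \<partial>M) - 0) < e" by simp
  qed
qed

lemma (in convex_lipschitz) dir_deriv_measurable [measurable]:
  assumes [measurable]: "a \<in> borel_measurable M" "b \<in> borel_measurable M"
  shows "(\<lambda>x. dir_deriv F (a x) (b x)) \<in> borel_measurable M"
proof (rule borel_measurable_LIMSEQ_metric)
  define t where "t = (\<lambda>n. 1 / real (Suc n))"
  have t: "t \<longlonglongrightarrow> 0" "\<And>n. t n > 0"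
    using LIMSEQ_Suc[OF lim_1_over_n] by (auto simp: t_def)
  show "(\<lambda>x. (F (a x + t n *\<^sub>R b x) - F (a x)) / t n) \<in> borel_measurable M" for n
    by measurable
  show "(\<lambda>n. (F (a x + t n *\<^sub>R b x) - F (a x)) / t n) \<longlonglongrightarrow> dir_deriv F (a x) (b x)" for x
    by (rule quotient_limit[OF t])
qed

section \<open>Weak and strong limits of compositions\<close>

text \<open>For a test function, the derivative of \<open>primitive g\<close> composed with
  \<open>wn n\<close> moves to the test function, after which L^1 convergence and the Lipschitz
  bound of \<open>primitive g\<close> suffice; continuity of \<open>g\<close> plays no part. Keeping
  the limit \<open>dw\<close> as last factor supplies the integrable majorant that extends the limit
  to bounded multipliers.\<close>

lemma weak_limit_composition:
  fixes w dw :: "real ^ 'm \<Rightarrow> real" and wn dwn :: "nat \<Rightarrow> real ^ 'm \<Rightarrow> real"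
  assumes U: "open U"
    and w: "has_weak_partial U k w dw" and wn: "\<And>n. has_weak_partial U k (wn n) (dwn n)"
    and iw: "integrable (lebesgue_on U) w" "\<And>n. integrable (lebesgue_on U) (wn n)"
    and id: "integrable (lebesgue_on U) dw" "\<And>n. integrable (lebesgue_on U) (dwn n)"
    and lw: "(\<lambda>n. \<integral>x. \<bar>wn n x - w x\<bar> \<partial>lebesgue_on U) \<longlonglongrightarrow> 0"
    and ld: "(\<lambda>n. \<integral>x. \<bar>dwn n x - dw x\<bar> \<partial>lebesgue_on U) \<longlonglongrightarrow> 0"
    and g: "g \<in> borel_measurable borel" "\<And>x. \<bar>g x\<bar> \<le> C"
    and \<psi>: "\<psi> \<in> borel_measurable (lebesgue_on U)" "\<And>x. \<bar>\<psi> x\<bar> \<le> D"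
  shows "(\<lambda>n. \<integral>x. \<psi> x * ((g (wn n x) - g (w x)) * dw x) \<partial>lebesgue_on U) \<longlonglongrightarrow> 0"
proof -
  let ?M = "lebesgue_on U"
  note [measurable] = borel_measurable_integrable[OF iw(1)] borel_measurable_integrable[OF iw(2)]
    borel_measurable_integrable[OF id(1)] borel_measurable_integrable[OF id(2)] g(1) \<psi>(1)
  have C: "C \<ge> 0" using g(2)[of 0] by linarith
  have pm [measurable]: "primitive g \<in> borel_measurable borel"
  proof -
    have "C-lipschitz_on UNIV (primitive g)"
      using primitive_lipschitz[OF g] C by (intro lipschitz_onI) (auto simp: dist_real_def)
    then show ?thesis by (intro borel_measurable_continuous_onI lipschitz_on_continuous_on)
  qed
  have pi: "integrable ?M (\<lambda>x. primitive g (f x))" if "integrable ?M f" for f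
  proof (rule Bochner_Integration.integrable_bound[of _ "\<lambda>x. C * f x"])
    show "AE x in ?M. norm (primitive g (f x)) \<le> norm (C * f x)"
      using primitive_lipschitz[OF g, of "f _" 0] C by (intro AE_I2) (simp add: abs_mult)
  qed (use that borel_measurable_integrable[OF that] in auto)
  have gi: "integrable ?M (\<lambda>x. g (f x) * h x)" if "integrable ?M h" "f \<in> borel_measurable ?M" for f h
    using integrable_scaleR_bounded[OF that(1), of "\<lambda>x. g (f x)" C] that(2) g by simp
  have test: "(\<lambda>n. \<integral>x. \<phi> x *\<^sub>R ((g (wn n x) - g (w x)) * dw x) \<partial>?M) \<longlonglongrightarrow> 0" if \<phi>: "\<phi> \<in> test_functions U" for \<phi>
  proof -
    obtain K B where KB: "B \<ge> 0" "\<And>x. \<bar>\<phi> x\<bar> \<le> B" "\<And>k x. \<bar>partial_deriv k \<phi> x\<bar> \<le> B"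
      by (rule test_functionE[OF \<phi>]) blast
    have bm [measurable]: "\<phi> \<in> borel_measurable ?M" "partial_deriv k \<phi> \<in> borel_measurable ?M"
      using test_function_borel[OF \<phi>] by (auto intro: borel_measurable_lebesgue_on)
    have bi: "integrable ?M (\<lambda>x. \<phi> x * f x)" "integrable ?M (\<lambda>x. partial_deriv k \<phi> x * f x)" if "integrable ?M f" for f
      using integrable_scaleR_bounded[OF that bm(1) KB(2)] integrable_scaleR_bounded[OF that bm(2) KB(3)] by simp_all
    have mono: "(\<integral>x. c * f x \<partial>?M) = c * (\<integral>x. f x \<partial>?M)" for c and f :: "real ^ 'm \<Rightarrow> real" by simp
    \<comment> \<open>Exchanging \<open>dw\<close> for \<open>dwn n\<close> beside
      \<open>g (wn n x)\<close> produces the last integral; the rest is integration by parts for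
      both compositions.\<close>
    have eq: "(\<integral>x. \<phi> x *\<^sub>R ((g (wn n x) - g (w x)) * dw x) \<partial>?M) =
        - (\<integral>x. partial_deriv k \<phi> x * (primitive g (wn n x) - primitive g (w x)) \<partial>?M)
        - (\<integral>x. \<phi> x * (g (wn n x) * (dwn n x - dw x)) \<partial>?M)" for n
    proof -
      have 1: "(\<integral>x. partial_deriv k \<phi> x * primitive g (wn n x) \<partial>?M) = - (\<integral>x. \<phi> x * (g (wn n x) * dwn n x) \<partial>?M)"
        using weak_partial_primitive[OF U wn g, of n] \<phi> by (simp add: has_weak_partial_def)
      have 2: "(\<integral>x. partial_deriv k \<phi> x * primitive g (w x) \<partial>?M) = - (\<integral>x. \<phi> x * (g (w x) * dw x) \<partial>?M)"
        using weak_partial_primitive[OF U w g] \<phi> by (simp add: has_weak_partial_def)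
      have i: "integrable ?M (\<lambda>x. \<phi> x * (g (wn n x) * dwn n x))" "integrable ?M (\<lambda>x. \<phi> x * (g (w x) * dw x))"
        "integrable ?M (\<lambda>x. \<phi> x * (g (wn n x) * dw x))"
        by (intro bi gi id; measurable)+
      have j: "integrable ?M (\<lambda>x. partial_deriv k \<phi> x * primitive g (wn n x))" "integrable ?M (\<lambda>x. partial_deriv k \<phi> x * primitive g (w x))"
        by (intro bi pi iw)+
      have "(\<integral>x. \<phi> x *\<^sub>R ((g (wn n x) - g (w x)) * dw x) \<partial>?M) =
          (\<integral>x. \<phi> x * (g (wn n x) * dw x) \<partial>?M) - (\<integral>x. \<phi> x * (g (w x) * dw x) \<partial>?M)"
        using i by (simp add: algebra_simps flip: Bochner_Integration.integral_diff)
      moreover have "(\<integral>x. partial_deriv k \<phi> x * (primitive g (wn n x) - primitive g (w x)) \<partial>?M) =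
          (\<integral>x. partial_deriv k \<phi> x * primitive g (wn n x) \<partial>?M) - (\<integral>x. partial_deriv k \<phi> x * primitive g (w x) \<partial>?M)"
        using j by (simp add: algebra_simps flip: Bochner_Integration.integral_diff)
      moreover have "(\<integral>x. \<phi> x * (g (wn n x) * (dwn n x - dw x)) \<partial>?M) =
          (\<integral>x. \<phi> x * (g (wn n x) * dwn n x) \<partial>?M) - (\<integral>x. \<phi> x * (g (wn n x) * dw x) \<partial>?M)"
        using i by (simp add: algebra_simps flip: Bochner_Integration.integral_diff)
      ultimately show ?thesis unfolding 1 2 by simp
    qed
    have l1: "(\<lambda>n. \<integral>x. partial_deriv k \<phi> x * (primitive g (wn n x) - primitive g (w x)) \<partial>?M) \<longlonglongrightarrow> 0"
    proof (rule Lim_null_comparison[OF always_eventually tendsto_mult_right_zero[OF lw, of "B * C"]], rule allI)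
      fix n
      have "norm (\<integral>x. partial_deriv k \<phi> x * (primitive g (wn n x) - primitive g (w x)) \<partial>?M) \<le>
          (\<integral>x. (B * C) * \<bar>wn n x - w x\<bar> \<partial>?M)"
      proof (rule norm_integral_le_AE)
        show "AE x in ?M. norm (partial_deriv k \<phi> x * (primitive g (wn n x) - primitive g (w x))) \<le> B * C * \<bar>wn n x - w x\<bar>"
          using KB primitive_lipschitz[OF g] C
          by (intro AE_I2) (simp add: abs_mult mult.assoc mult_mono)
        show "integrable ?M (\<lambda>x. partial_deriv k \<phi> x * (primitive g (wn n x) - primitive g (w x)))"
          by (intro bi Bochner_Integration.integrable_diff pi iw)
        show "integrable ?M (\<lambda>x. B * C * \<bar>wn n x - w x\<bar>)"
          by (intro integrable_mult_right integrable_abs Bochner_Integration.integrable_diff iw)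
      qed
      then show "norm (\<integral>x. partial_deriv k \<phi> x * (primitive g (wn n x) - primitive g (w x)) \<partial>?M) \<le>
          B * C * (\<integral>x. \<bar>wn n x - w x\<bar> \<partial>?M)" unfolding mono .
    qed
    have l2: "(\<lambda>n. \<integral>x. \<phi> x * (g (wn n x) * (dwn n x - dw x)) \<partial>?M) \<longlonglongrightarrow> 0"
    proof (rule Lim_null_comparison[OF always_eventually tendsto_mult_right_zero[OF ld, of "B * C"]], rule allI)
      fix n
      have "norm (\<integral>x. \<phi> x * (g (wn n x) * (dwn n x - dw x)) \<partial>?M) \<le> (\<integral>x. (B * C) * \<bar>dwn n x - dw x\<bar> \<partial>?M)"
      proof (rule norm_integral_le_AE)
        show "AE x in ?M. norm (\<phi> x * (g (wn n x) * (dwn n x - dw x))) \<le> B * C * \<bar>dwn n x - dw x\<bar>"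
          using KB g(2) C
          by (intro AE_I2) (simp add: abs_mult mult.assoc mult_mono mult_right_mono)
        show "integrable ?M (\<lambda>x. \<phi> x * (g (wn n x) * (dwn n x - dw x)))"
          by (intro bi gi Bochner_Integration.integrable_diff id) measurable
        show "integrable ?M (\<lambda>x. B * C * \<bar>dwn n x - dw x\<bar>)"
          by (intro integrable_mult_right integrable_abs Bochner_Integration.integrable_diff id)
      qed
      then show "norm (\<integral>x. \<phi> x * (g (wn n x) * (dwn n x - dw x)) \<partial>?M) \<le>
          B * C * (\<integral>x. \<bar>dwn n x - dw x\<bar> \<partial>?M)" unfolding mono .
    qed
    from tendsto_diff[OF tendsto_minus[OF l1] l2] show ?thesis unfolding eq by simp
  qed
  have "(\<lambda>n. \<integral>x. \<psi> x *\<^sub>R ((g (wn n x) - g (w x)) * dw x) \<partial>?M) \<longlonglongrightarrow> 0"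
  proof (rule test_limit_bounded[OF U, where w = "\<lambda>x. 2 * C * \<bar>dw x\<bar>" and C = D])
    show "integrable ?M (\<lambda>x. 2 * C * \<bar>dw x\<bar>)" using id(1) by (intro integrable_mult_right integrable_abs)
    show "(\<lambda>x. (g (wn n x) - g (w x)) * dw x) \<in> borel_measurable ?M" for n by measurable
    show "AE x in ?M. norm ((g (wn n x) - g (w x)) * dw x) \<le> 2 * C * \<bar>dw x\<bar>" for n
    proof (rule AE_I2)
      fix x
      have "\<bar>g (wn n x) - g (w x)\<bar> \<le> 2 * C" using g(2)[of "wn n x"] g(2)[of "w x"] by linarith
      then show "norm ((g (wn n x) - g (w x)) * dw x) \<le> 2 * C * \<bar>dw x\<bar>"
        by (simp add: abs_mult mult_right_mono)
    qed
  qed (use test \<psi> in auto)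
  then show ?thesis by simp
qed

text \<open>Expand \<open>(g\<^sub>n - g)\<^sup>2 = (g\<^sub>n\<^sup>2 - g\<^sup>2) - 2 g (g\<^sub>n - g)\<close> and apply the weak limits of \<open>g\<^sup>2\<close> and of \<open>g\<close>.\<close>

lemma composition_square_limit:
  fixes w dw :: "real ^ 'm \<Rightarrow> real" and wn dwn :: "nat \<Rightarrow> real ^ 'm \<Rightarrow> real"
  assumes U: "open U"
    and w: "has_weak_partial U k w dw" and wn: "\<And>n. has_weak_partial U k (wn n) (dwn n)"
    and iw: "integrable (lebesgue_on U) w" "\<And>n. integrable (lebesgue_on U) (wn n)"
    and id: "integrable (lebesgue_on U) dw" "\<And>n. integrable (lebesgue_on U) (dwn n)"
    and lw: "(\<lambda>n. \<integral>x. \<bar>wn n x - w x\<bar> \<partial>lebesgue_on U) \<longlonglongrightarrow> 0"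
    and ld: "(\<lambda>n. \<integral>x. \<bar>dwn n x - dw x\<bar> \<partial>lebesgue_on U) \<longlonglongrightarrow> 0"
    and g: "g \<in> borel_measurable borel" "\<And>x. \<bar>g x\<bar> \<le> C"
  shows "(\<lambda>n. \<integral>x. (g (wn n x) - g (w x))\<^sup>2 * \<bar>dw x\<bar> \<partial>lebesgue_on U) \<longlonglongrightarrow> 0"
    and "integrable (lebesgue_on U) (\<lambda>x. (g (wn n x) - g (w x))\<^sup>2 * \<bar>dw x\<bar>)"
proof -
  let ?M = "lebesgue_on U"
  note [measurable] = borel_measurable_integrable[OF iw(1)] borel_measurable_integrable[OF iw(2)]
    borel_measurable_integrable[OF id(1)] borel_measurable_integrable[OF id(2)] g(1)
  have C: "C \<ge> 0" using g(2)[of 0] by linarith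
  \<comment> \<open>As a bounded multiplier, the sign turns \<open>dw\<close> into its absolute
    value.\<close>
  define s where "s = (\<lambda>x. sgn (dw x))"
  have sm [measurable]: "s \<in> borel_measurable ?M" unfolding s_def by measurable
  have s1: "\<bar>s x\<bar> \<le> 1" "s x * dw x = \<bar>dw x\<bar>" for x by (auto simp: s_def sgn_if)
  have A: "(\<lambda>n. \<integral>x. (g (w x) * s x) * ((g (wn n x) - g (w x)) * dw x) \<partial>?M) \<longlonglongrightarrow> 0"
  proof (rule weak_limit_composition[OF U w wn iw id lw ld g])
    show "\<bar>g (w x) * s x\<bar> \<le> C * 1" for x
      unfolding abs_mult using g(2) s1(1) C by (intro mult_mono) auto
  qed measurable
  have B: "(\<lambda>n. \<integral>x. s x * (((g (wn n x))\<^sup>2 - (g (w x))\<^sup>2) * dw x) \<partial>?M) \<longlonglongrightarrow> 0"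
  proof (rule weak_limit_composition[OF U w wn iw id lw ld, where g = "\<lambda>x. (g x)\<^sup>2" and C = "C\<^sup>2"])
    show "\<bar>(g x)\<^sup>2\<bar> \<le> C\<^sup>2" for x
      using g(2)[of x] C by (simp add: abs_le_square_iff[symmetric])
    show "\<bar>s x\<bar> \<le> 1" for x by (rule s1)
  qed measurable
  have iA: "integrable ?M (\<lambda>x. (g (w x) * s x) * ((g (wn n x) - g (w x)) * dw x))" for n
  proof -
    have "integrable ?M (\<lambda>x. ((g (w x) * s x) * (g (wn n x) - g (w x))) *\<^sub>R dw x)"
    proof (rule integrable_scaleR_bounded[OF id(1)])
      fix x
      have "\<bar>g (wn n x) - g (w x)\<bar> \<le> 2 * C" using g(2)[of "wn n x"] g(2)[of "w x"] by linarith
      moreover have "\<bar>g (w x) * s x\<bar> \<le> C * 1"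
        unfolding abs_mult using g(2) s1(1) C by (intro mult_mono) auto
      ultimately show "\<bar>(g (w x) * s x) * (g (wn n x) - g (w x))\<bar> \<le> (C * 1) * (2 * C)"
        unfolding abs_mult[of "g (w x) * s x"] using C by (intro mult_mono) auto
    qed measurable
    then show ?thesis by (simp add: mult.assoc)
  qed
  have iB: "integrable ?M (\<lambda>x. s x * (((g (wn n x))\<^sup>2 - (g (w x))\<^sup>2) * dw x))" for n
  proof -
    have "integrable ?M (\<lambda>x. (s x * ((g (wn n x))\<^sup>2 - (g (w x))\<^sup>2)) *\<^sub>R dw x)"
    proof (rule integrable_scaleR_bounded[OF id(1)])
      fix x
      have "(g y)\<^sup>2 \<le> C\<^sup>2" for y
        using g(2)[of y] C by (simp add: abs_le_square_iff[symmetric])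
      from this[of "wn n x"] this[of "w x"]
      have "\<bar>(g (wn n x))\<^sup>2 - (g (w x))\<^sup>2\<bar> \<le> C\<^sup>2"
        using zero_le_power2[of "g (wn n x)"] zero_le_power2[of "g (w x)"] by linarith
      then show "\<bar>s x * ((g (wn n x))\<^sup>2 - (g (w x))\<^sup>2)\<bar> \<le> 1 * C\<^sup>2"
        unfolding abs_mult using s1(1)[of x] by (intro mult_mono) auto
    qed measurable
    then show ?thesis by (simp add: mult.assoc)
  qed
  have eq: "(g (wn n x) - g (w x))\<^sup>2 * \<bar>dw x\<bar> = s x * (((g (wn n x))\<^sup>2 - (g (w x))\<^sup>2) * dw x) -
      2 * ((g (w x) * s x) * ((g (wn n x) - g (w x)) * dw x))" for n x
    unfolding s1(2)[symmetric] by (simp add: power2_eq_square algebra_simps)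
  show "integrable ?M (\<lambda>x. (g (wn n x) - g (w x))\<^sup>2 * \<bar>dw x\<bar>)"
    unfolding eq by (intro Bochner_Integration.integrable_diff integrable_mult_right iA iB)
  have "(\<integral>x. (g (wn n x) - g (w x))\<^sup>2 * \<bar>dw x\<bar> \<partial>?M) = (\<integral>x. s x * (((g (wn n x))\<^sup>2 - (g (w x))\<^sup>2) * dw x) \<partial>?M)
      - 2 * (\<integral>x. (g (w x) * s x) * ((g (wn n x) - g (w x)) * dw x) \<partial>?M)" for n
    unfolding eq using iA iB by (subst Bochner_Integration.integral_diff) auto
  moreover have "(\<lambda>n. (\<integral>x. s x * (((g (wn n x))\<^sup>2 - (g (w x))\<^sup>2) * dw x) \<partial>?M)
      - 2 * (\<integral>x. (g (w x) * s x) * ((g (wn n x) - g (w x)) * dw x) \<partial>?M)) \<longlonglongrightarrow> 0 - 2 * 0"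
    by (intro tendsto_intros A B)
  ultimately show "(\<lambda>n. \<integral>x. (g (wn n x) - g (w x))\<^sup>2 * \<bar>dw x\<bar> \<partial>?M) \<longlonglongrightarrow> 0" by simp
qed

section \<open>Membership in L^q\<close>

lemma in_LqD:
  assumes "in_Lq U q f"
  shows "f \<in> borel_measurable (lebesgue_on U)" "integrable (lebesgue_on U) (\<lambda>x. norm (f x) powr q)"
  using assms by (auto simp: in_Lq_def)

text \<open>Two functions and a constant cover all later uses: differences, Lipschitz images, and
  derivatives of compositions.\<close>

lemma in_Lq_bound:
  fixes f :: "real ^ 'm \<Rightarrow> 'w::euclidean_space" and a :: "real ^ 'm \<Rightarrow> 'a::euclidean_space" and b :: "real ^ 'm \<Rightarrow> 'b::euclidean_space"
  assumes M: "finite_measure (lebesgue_on U)" and q: "q \<ge> 1" and f: "f \<in> borel_measurable (lebesgue_on U)"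
    and a: "in_Lq U q a" and b: "in_Lq U q b"
    and le: "\<And>x. x \<in> U \<Longrightarrow> norm (f x) \<le> c * norm (a x) + (d * norm (b x) + e)"
    and pos: "c \<ge> 0" "d \<ge> 0" "e \<ge> 0"
  shows "in_Lq U q f"
  unfolding in_Lq_def
proof
  let ?h = "\<lambda>x. 2 powr q * (c powr q * norm (a x) powr q + 2 powr q * (d powr q * norm (b x) powr q + e powr q))"
  show "integrable (lebesgue_on U) (\<lambda>x. norm (f x) powr q)"
  proof (rule Bochner_Integration.integrable_bound)
    show "integrable (lebesgue_on U) ?h"
      using in_LqD(2)[OF a] in_LqD(2)[OF b] finite_measure.integrable_const[OF M]
      by (intro integrable_mult_right Bochner_Integration.integrable_add)
    show "(\<lambda>x. norm (f x) powr q) \<in> borel_measurable (lebesgue_on U)" using f by measurable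
    show "AE x in lebesgue_on U. norm (norm (f x) powr q) \<le> norm (?h x)"
    proof (rule AE_I2)
      fix x assume "x \<in> space (lebesgue_on U)"
      then have x: "x \<in> U" by simp
      have "norm (f x) powr q \<le> (c * norm (a x) + (d * norm (b x) + e)) powr q"
        using le[OF x] q by (intro powr_mono2) auto
      also have "\<dots> \<le> 2 powr q * ((c * norm (a x)) powr q + (d * norm (b x) + e) powr q)"
        using pos q by (intro powr_add_le) auto
      also have "\<dots> \<le> 2 powr q * ((c * norm (a x)) powr q + 2 powr q * ((d * norm (b x)) powr q + e powr q))"
        using pos q by (intro mult_left_mono add_left_mono powr_add_le) auto
      also have "\<dots> = ?h x" using pos by (simp add: powr_mult)
      finally show "norm (norm (f x) powr q) \<le> norm (?h x)" by simp
    qed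
  qed
qed (rule f)

lemma in_Lq_diff:
  fixes a b :: "real ^ 'm \<Rightarrow> 'a::euclidean_space"
  assumes M: "finite_measure (lebesgue_on U)" and q: "q \<ge> 1" and a: "in_Lq U q a" and b: "in_Lq U q b"
  shows "in_Lq U q (\<lambda>x. a x - b x)"
proof (rule in_Lq_bound[OF M q _ a b, of _ 1 1 0])
  show "(\<lambda>x. a x - b x) \<in> borel_measurable (lebesgue_on U)"
    using in_LqD(1)[OF a] in_LqD(1)[OF b] by measurable
qed (auto intro: norm_triangle_ineq4)

lemma in_Lq_integrable:
  fixes a :: "real ^ 'm \<Rightarrow> 'a::euclidean_space"
  assumes M: "finite_measure (lebesgue_on U)" and q: "q \<ge> 1" and a: "in_Lq U q a"
  shows "integrable (lebesgue_on U) a"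
  by (rule powr_integrable_imp_integrable[OF M q in_LqD[OF a]])

section \<open>Composition with differences of convex functions\<close>

locale dc_function = F1: convex_lipschitz F1 L1 + F2: convex_lipschitz F2 L2
  for F1 F2 :: "'v::euclidean_space \<Rightarrow> real" and L1 L2 :: real
begin

definition dc :: "'v \<Rightarrow> real" where "dc A = F1 A - F2 A"

text \<open>A difference of upper semicontinuous functions need not be semicontinuous, so
  convergence is proved for the two terms separately.\<close>

definition dc_deriv :: "'v \<Rightarrow> 'v \<Rightarrow> real" where "dc_deriv A H = dir_deriv F1 A H - dir_deriv F2 A H"

lemma dc_measurable [measurable]: "dc \<in> borel_measurable borel"
  unfolding dc_def by measurable

lemma dc_deriv_measurable [measurable]:
  "a \<in> borel_measurable M \<Longrightarrow> b \<in> borel_measurable M \<Longrightarrow> (\<lambda>x. dc_deriv (a x) (b x)) \<in> borel_measurable M"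
  unfolding dc_deriv_def
  by (intro borel_measurable_diff F1.dir_deriv_measurable F2.dir_deriv_measurable)

lemma L_nonneg: "L1 + L2 \<ge> 0"
  using F1.lipschitz[of "SOME b. b \<in> Basis" 0] F2.lipschitz[of "SOME b. b \<in> Basis" 0] norm_some_Basis[where 'a='v]
  by simp

lemma dc_lipschitz: "\<bar>dc x - dc y\<bar> \<le> (L1 + L2) * norm (x - y)"
proof -
  have "\<bar>dc x - dc y\<bar> \<le> \<bar>F1 x - F1 y\<bar> + \<bar>F2 x - F2 y\<bar>" by (simp add: dc_def)
  also have "\<dots> \<le> (L1 + L2) * norm (x - y)"
    using F1.lipschitz[of x y] F2.lipschitz[of x y] by (simp add: distrib_right)
  finally show ?thesis .
qed

lemma dc_deriv_bound: "\<bar>dc_deriv A H\<bar> \<le> (L1 + L2) * norm H"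
proof -
  have "\<bar>dc_deriv A H\<bar> \<le> \<bar>dir_deriv F1 A H\<bar> + \<bar>dir_deriv F2 A H\<bar>" by (simp add: dc_deriv_def)
  also have "\<dots> \<le> (L1 + L2) * norm H"
    using F1.dir_deriv_bound[of A H] F2.dir_deriv_bound[of A H] by (simp add: distrib_right)
  finally show ?thesis .
qed

lemma dc_weak_partial:
  fixes A B :: "real ^ 'm \<Rightarrow> 'v"
  assumes U: "open U" and w: "has_weak_partial U k A B"
  shows "has_weak_partial U k (\<lambda>x. dc (A x)) (\<lambda>x. dc_deriv (A x) (B x))"
  using has_weak_partial_lin[OF U F1.weak_partial_chain(1)[OF U w] F2.weak_partial_chain(1)[OF U w], of 1 "-1"]
  by (simp add: dc_def dc_deriv_def)

text \<open>Three successive extractions are made: for \<open>An\<close>, for \<open>Bn\<close>, and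
  for the weighted squares that control \<open>g\<close>. The resulting pointwise convergence
  becomes convergence in L^q because the integrands are dominated in terms of
  \<open>Bn\<close>.\<close>

lemma dc_subsequence:
  fixes A B :: "real ^ 'm \<Rightarrow> 'v" and An Bn :: "nat \<Rightarrow> real ^ 'm \<Rightarrow> 'v"
  assumes U: "open U" and M: "finite_measure (lebesgue_on U)" and q: "q \<ge> 1"
    and w: "has_weak_partial U k A B" and wn: "\<And>n. has_weak_partial U k (An n) (Bn n)"
    and A: "in_Lq U q A" and B: "in_Lq U q B" and An: "\<And>n. in_Lq U q (An n)" and Bn: "\<And>n. in_Lq U q (Bn n)"
    and lA: "(\<lambda>n. \<integral>x. norm (An n x - A x) powr q \<partial>lebesgue_on U) \<longlonglongrightarrow> 0"
    and lB: "(\<lambda>n. \<integral>x. norm (Bn n x - B x) powr q \<partial>lebesgue_on U) \<longlonglongrightarrow> 0"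
    and g: "g \<in> borel_measurable borel" "\<And>x. \<bar>g x\<bar> \<le> C"
  shows "\<exists>r. strict_mono r \<and> (\<lambda>n. \<integral>x. \<bar>g (dc (An (r n) x)) * dc_deriv (An (r n) x) (Bn (r n) x) -
            g (dc (A x)) * dc_deriv (A x) (B x)\<bar> powr q \<partial>lebesgue_on U) \<longlonglongrightarrow> 0"
proof -
  let ?M = "lebesgue_on U" and ?L = "L1 + L2"
  have C: "C \<ge> 0" using g(2)[of 0] by linarith
  have AA: "in_Lq U q (\<lambda>x. An n x - A x)" and BB: "in_Lq U q (\<lambda>x. Bn n x - B x)" for n
    by (intro in_Lq_diff[OF M q] A B An Bn)+
  have lA1: "(\<lambda>n. \<integral>x. norm (An n x - A x) \<partial>?M) \<longlonglongrightarrow> 0"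
    by (rule powr_limit_imp_L1_limit[OF M q in_LqD(1)[OF AA] in_LqD(2)[OF AA] lA])
  have lB1: "(\<lambda>n. \<integral>x. norm (Bn n x - B x) \<partial>?M) \<longlonglongrightarrow> 0"
    by (rule powr_limit_imp_L1_limit[OF M q in_LqD(1)[OF BB] in_LqD(2)[OF BB] lB])
  note iA = in_Lq_integrable[OF M q A] and iB = in_Lq_integrable[OF M q B]
    and iAn = in_Lq_integrable[OF M q An] and iBn = in_Lq_integrable[OF M q Bn]
  obtain r1 where r1: "strict_mono r1" "AE x in ?M. (\<lambda>n. An (r1 n) x - A x) \<longlonglongrightarrow> 0"
    using tendsto_L1_AE_subseq[OF in_Lq_integrable[OF M q AA] lA1] by blast
  have "(\<lambda>n. \<integral>x. norm (Bn (r1 n) x - B x) \<partial>?M) \<longlonglongrightarrow> 0"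
    using LIMSEQ_subseq_LIMSEQ[OF lB1 r1(1)] by (simp add: o_def)
  then obtain r2 where r2: "strict_mono r2" "AE x in ?M. (\<lambda>n. Bn (r1 (r2 n)) x - B x) \<longlonglongrightarrow> 0"
    using tendsto_L1_AE_subseq[OF in_Lq_integrable[OF M q BB]] by blast
  define r3 where "r3 = r1 \<circ> r2"
  have r3: "strict_mono r3" unfolding r3_def using r1(1) r2(1) by (rule strict_mono_o)
  define a b where "a = (\<lambda>n. An (r3 n))" and "b = (\<lambda>n. Bn (r3 n))"
  have aA: "AE x in ?M. (\<lambda>n. a n x) \<longlonglongrightarrow> A x"
    using r1(2)
  proof eventually_elim
    case (elim x)
    from LIMSEQ_subseq_LIMSEQ[OF elim r2(1)] show ?case
      by (simp add: a_def r3_def o_def LIM_zero_iff)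
  qed
  have bB: "AE x in ?M. (\<lambda>n. b n x) \<longlonglongrightarrow> B x"
    using r2(2) by eventually_elim (simp add: b_def r3_def o_def LIM_zero_iff)
  note [measurable] = in_LqD(1)[OF A] in_LqD(1)[OF B] in_LqD(1)[OF An] in_LqD(1)[OF Bn] g(1)
  have am [measurable]: "a n \<in> borel_measurable ?M" "b n \<in> borel_measurable ?M" for n by (auto simp: a_def b_def)
  define dw where "dw = (\<lambda>x. dc_deriv (A x) (B x))"
  define dwn where "dwn = (\<lambda>n x. dc_deriv (a n x) (b n x))"
  have dwm [measurable]: "dw \<in> borel_measurable ?M" "dwn n \<in> borel_measurable ?M" for n
    unfolding dw_def dwn_def by measurable
  \<comment> \<open>Both one-sided derivatives are weak derivatives of the same function, so
    uniqueness supplies the hypothesis of \<open>dir_deriv_tendsto\<close>.\<close>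
  have AE1: "AE x in ?M. dir_deriv F1 (A x) (B x) = - dir_deriv F1 (A x) (- B x)"
    by (rule has_weak_partial_unique[OF U F1.weak_partial_chain[OF U w]])
  have AE2: "AE x in ?M. dir_deriv F2 (A x) (B x) = - dir_deriv F2 (A x) (- B x)"
    by (rule has_weak_partial_unique[OF U F2.weak_partial_chain[OF U w]])
  have dlim: "AE x in ?M. (\<lambda>n. dwn n x - dw x) \<longlonglongrightarrow> 0"
    using aA bB AE1 AE2
  proof eventually_elim
    case (elim x)
    have "(\<lambda>n. dwn n x) \<longlonglongrightarrow> dw x"
      unfolding dwn_def dw_def dc_deriv_def
      by (intro tendsto_diff F1.dir_deriv_tendsto F2.dir_deriv_tendsto elim)
    then show ?case by (simp add: LIM_zero)
  qed
  have lb: "(\<lambda>n. \<integral>x. norm (b n x - B x) powr q \<partial>?M) \<longlonglongrightarrow> 0"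
    using LIMSEQ_subseq_LIMSEQ[OF lB r3] by (simp add: o_def b_def)
  have lb1: "(\<lambda>n. \<integral>x. norm (b n x - B x) \<partial>?M) \<longlonglongrightarrow> 0"
    using LIMSEQ_subseq_LIMSEQ[OF lB1 r3] by (simp add: o_def b_def)
  have la1: "(\<lambda>n. \<integral>x. norm (a n x - A x) \<partial>?M) \<longlonglongrightarrow> 0"
    using LIMSEQ_subseq_LIMSEQ[OF lA1 r3] by (simp add: o_def a_def)
  have bBq: "in_Lq U q (\<lambda>x. b n x - B x)" for n unfolding b_def by (rule BB)
  have nb: "norm (b n x) \<le> norm (b n x - B x) + norm (B x)" for n x
    by (metis add.commute norm_triangle_sub)
  have bnd: "\<bar>dwn n x\<bar> + \<bar>dw x\<bar> \<le> ?L * norm (b n x - B x) + 2 * ?L * norm (B x)" for n x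
  proof -
    have "\<bar>dwn n x\<bar> \<le> ?L * norm (b n x)" "\<bar>dw x\<bar> \<le> ?L * norm (B x)"
      unfolding dwn_def dw_def by (rule dc_deriv_bound)+
    moreover have "?L * norm (b n x) \<le> ?L * (norm (b n x - B x) + norm (B x))"
      by (rule mult_left_mono[OF nb L_nonneg])
    moreover have "?L * (norm (b n x - B x) + norm (B x)) = ?L * norm (b n x - B x) + ?L * norm (B x)"
      by (rule distrib_left)
    moreover have "2 * ?L * norm (B x) = ?L * norm (B x) + ?L * norm (B x)" by (simp only: mult_2 distrib_right)
    ultimately show ?thesis by linarith
  qed
  have ld: "(\<lambda>n. \<integral>x. \<bar>dwn n x - dw x\<bar> \<partial>?M) \<longlonglongrightarrow> 0"
  proof -
    \<comment> \<open>The dominated limit at exponent 1; \<open>composition_square_limit\<close>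
      asks for L^1 convergence of the derivatives.\<close>
    have "(\<lambda>n. \<integral>x. \<bar>dwn n x - dw x\<bar> powr 1 \<partial>?M) \<longlonglongrightarrow> 0"
    proof (rule integral_powr_dominated_limit[where Y = "\<lambda>n x. b n x - B x" and c = ?L and b = "\<lambda>x. 2 * ?L * norm (B x)"])
      show "\<bar>dwn n x - dw x\<bar> \<le> ?L * norm (b n x - B x) + 2 * ?L * norm (B x)" for n x
        using bnd[of n x] by linarith
      show "integrable ?M (\<lambda>x. norm (b n x - B x) powr 1)" for n
        using in_Lq_integrable[OF M q bBq, of n] by simp
      show "(\<lambda>n. \<integral>x. norm (b n x - B x) powr 1 \<partial>?M) \<longlonglongrightarrow> 0" using lb1 by simp
      have "integrable ?M (\<lambda>x. 2 * ?L * norm (B x))" using iB by (intro integrable_mult_right integrable_norm)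
      then show "integrable ?M (\<lambda>x. (2 * ?L * norm (B x)) powr 1)" using L_nonneg by simp
    qed (use dlim L_nonneg in auto)
    then show ?thesis by simp
  qed
  have iw: "integrable ?M (\<lambda>x. dc (f x))" if f: "integrable ?M f" for f
  proof (rule Bochner_Integration.integrable_bound[of _ "\<lambda>x. \<bar>dc 0\<bar> + ?L * norm (f x)"])
    show "integrable ?M (\<lambda>x. \<bar>dc 0\<bar> + ?L * norm (f x))"
      using f finite_measure.integrable_const[OF M] by (intro Bochner_Integration.integrable_add integrable_mult_right integrable_norm)
    show "(\<lambda>x. dc (f x)) \<in> borel_measurable ?M" using borel_measurable_integrable[OF f] by measurable
    show "AE x in ?M. norm (dc (f x)) \<le> norm (\<bar>dc 0\<bar> + ?L * norm (f x))"
      using dc_lipschitz[of _ 0] by (intro AE_I2) (smt (verit, best) diff_zero real_norm_def)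
  qed
  have idw: "integrable ?M (\<lambda>x. dc_deriv (f x) (h x))" if f: "integrable ?M f" "integrable ?M h" for f h
  proof (rule Bochner_Integration.integrable_bound[of _ "\<lambda>x. ?L * norm (h x)"])
    show "(\<lambda>x. dc_deriv (f x) (h x)) \<in> borel_measurable ?M"
      using f[THEN borel_measurable_integrable] by measurable
    show "AE x in ?M. norm (dc_deriv (f x) (h x)) \<le> norm (?L * norm (h x))"
      using dc_deriv_bound L_nonneg by (intro AE_I2) (auto simp: abs_mult)
  qed (use f in \<open>intro integrable_mult_right integrable_norm\<close>)
  have ia: "integrable ?M (a n)" "integrable ?M (b n)" for n unfolding a_def b_def by (rule iAn iBn)+
  have lw: "(\<lambda>n. \<integral>x. \<bar>dc (a n x) - dc (A x)\<bar> \<partial>?M) \<longlonglongrightarrow> 0"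
  proof (rule tendsto_sandwich[OF _ _ tendsto_const tendsto_mult_right_zero[OF la1, of ?L]])
    show "\<forall>\<^sub>F n in sequentially. 0 \<le> (\<integral>x. \<bar>dc (a n x) - dc (A x)\<bar> \<partial>?M)" by simp
    show "\<forall>\<^sub>F n in sequentially. (\<integral>x. \<bar>dc (a n x) - dc (A x)\<bar> \<partial>?M) \<le> ?L * (\<integral>x. norm (a n x - A x) \<partial>?M)"
    proof (rule always_eventually, rule allI)
      fix n
      have "(\<integral>x. \<bar>dc (a n x) - dc (A x)\<bar> \<partial>?M) \<le> (\<integral>x. ?L * norm (a n x - A x) \<partial>?M)"
        using ia iA by (intro integral_mono dc_lipschitz integrable_abs Bochner_Integration.integrable_diff iw
            integrable_mult_right integrable_norm)
      then show "(\<integral>x. \<bar>dc (a n x) - dc (A x)\<bar> \<partial>?M) \<le> ?L * (\<integral>x. norm (a n x - A x) \<partial>?M)" by simp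
    qed
  qed
  have wpn: "has_weak_partial U k (\<lambda>x. dc (a n x)) (dwn n)" for n
    unfolding dwn_def a_def b_def by (rule dc_weak_partial[OF U wn])
  have wp: "has_weak_partial U k (\<lambda>x. dc (A x)) dw"
    unfolding dw_def by (rule dc_weak_partial[OF U w])
  \<comment> \<open>The weight is essential: where \<open>dw\<close> vanishes,
    \<open>g (dc (a n x))\<close> need not converge at all, but there the limit derivative is 0 as
    well.\<close>
  let ?S = "\<lambda>n x. (g (dc (a n x)) - g (dc (A x)))\<^sup>2 * \<bar>dw x\<bar>"
  have idw': "integrable ?M dw" "integrable ?M (dwn n)" for n
    unfolding dw_def dwn_def by (rule idw iA iB ia)+
  have sq: "(\<lambda>n. \<integral>x. ?S n x \<partial>?M) \<longlonglongrightarrow> 0" and sqi: "\<And>n. integrable ?M (?S n)"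
    by (rule composition_square_limit[OF U wp wpn iw[OF iA] iw[OF ia(1)] idw' lw ld g])+
  have sqn: "(\<lambda>n. \<integral>x. norm (?S n x) \<partial>?M) \<longlonglongrightarrow> 0" using sq by simp
  obtain r4 where r4: "strict_mono r4" "AE x in ?M. (\<lambda>n. ?S (r4 n) x) \<longlonglongrightarrow> 0"
    using tendsto_L1_AE_subseq[where u = ?S, OF sqi sqn] by blast
  define r where "r = r3 \<circ> r4"
  have r: "strict_mono r" unfolding r_def using r3 r4(1) by (rule strict_mono_o)
  let ?D = "\<lambda>n x. g (dc (a (r4 n) x)) * dwn (r4 n) x - g (dc (A x)) * dw x"
  have Dlim: "AE x in ?M. (\<lambda>n. ?D n x) \<longlonglongrightarrow> 0"
    using r4(2) dlim
  proof eventually_elim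
    case (elim x)
    have d: "(\<lambda>n. dwn (r4 n) x - dw x) \<longlonglongrightarrow> 0"
      using LIMSEQ_subseq_LIMSEQ[OF elim(2) r4(1)] by (simp add: o_def)
    \<comment> \<open>One more factor \<open>\<bar>dw x\<bar>\<close> completes the square, so the
      root gives convergence of the product itself without dividing by \<open>dw x\<close>.\<close>
    have "(\<lambda>n. sqrt (?S (r4 n) x * \<bar>dw x\<bar>)) \<longlonglongrightarrow> sqrt (0 * \<bar>dw x\<bar>)"
      by (intro tendsto_intros elim(1))
    moreover have "sqrt (?S (r4 n) x * \<bar>dw x\<bar>) = \<bar>(g (dc (a (r4 n) x)) - g (dc (A x))) * dw x\<bar>" for n
    proof -
      have "?S (r4 n) x * \<bar>dw x\<bar> = ((g (dc (a (r4 n) x)) - g (dc (A x))) * dw x)\<^sup>2"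
        by (simp add: power2_eq_square abs_mult_self_eq mult.assoc)
      then show ?thesis by simp
    qed
    ultimately have 1: "(\<lambda>n. (g (dc (a (r4 n) x)) - g (dc (A x))) * dw x) \<longlonglongrightarrow> 0"
      by (simp add: tendsto_rabs_zero_iff)
    have 2: "(\<lambda>n. g (dc (a (r4 n) x)) * (dwn (r4 n) x - dw x)) \<longlonglongrightarrow> 0"
    proof (rule Lim_null_comparison[OF always_eventually tendsto_mult_right_zero[OF tendsto_rabs_zero[OF d], of C]], rule allI)
      show "norm (g (dc (a (r4 n) x)) * (dwn (r4 n) x - dw x)) \<le> C * \<bar>dwn (r4 n) x - dw x\<bar>" for n
        using g(2) by (simp add: abs_mult mult_right_mono)
    qed
    \<comment> \<open>The first summand tends to 0 because \<open>g\<close> is bounded and the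
      derivatives converge, the second by the square root argument.\<close>
    have "?D n x = g (dc (a (r4 n) x)) * (dwn (r4 n) x - dw x) + (g (dc (a (r4 n) x)) - g (dc (A x))) * dw x" for n
      by (simp add: algebra_simps)
    then show ?case using tendsto_add[OF 2 1] by simp
  qed
  have CL: "C * ?L \<ge> 0" using C L_nonneg by simp
  have "(\<lambda>n. \<integral>x. \<bar>?D n x\<bar> powr q \<partial>?M) \<longlonglongrightarrow> 0"
  proof (rule integral_powr_dominated_limit[OF q _ Dlim, where Y = "\<lambda>n x. b (r4 n) x - B x" and c = "C * ?L" and b = "\<lambda>x. C * (2 * ?L) * norm (B x)"])
    show "\<bar>?D n x\<bar> \<le> C * ?L * norm (b (r4 n) x - B x) + C * (2 * ?L) * norm (B x)" for n x
    proof -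
      have "\<bar>?D n x\<bar> \<le> \<bar>g (dc (a (r4 n) x)) * dwn (r4 n) x\<bar> + \<bar>g (dc (A x)) * dw x\<bar>"
        by (rule abs_triangle_ineq4)
      also have "\<dots> \<le> C * \<bar>dwn (r4 n) x\<bar> + C * \<bar>dw x\<bar>"
        using g(2) unfolding abs_mult by (intro add_mono mult_right_mono) auto
      also have "\<dots> = C * (\<bar>dwn (r4 n) x\<bar> + \<bar>dw x\<bar>)" by (simp add: distrib_left)
      also have "\<dots> \<le> C * (?L * norm (b (r4 n) x - B x) + 2 * ?L * norm (B x))"
        by (rule mult_left_mono[OF bnd C])
      finally show ?thesis by (simp add: algebra_simps)
    qed
    show "integrable ?M (\<lambda>x. norm (b (r4 n) x - B x) powr q)" for n by (rule in_LqD(2)[OF bBq])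
    show "(\<lambda>n. \<integral>x. norm (b (r4 n) x - B x) powr q \<partial>?M) \<longlonglongrightarrow> 0"
      using LIMSEQ_subseq_LIMSEQ[OF lb r4(1)] by (simp add: o_def)
    have "C * (2 * ?L) \<ge> 0" using C L_nonneg by simp
    then show "integrable ?M (\<lambda>x. (C * (2 * ?L) * norm (B x)) powr q)"
      using in_LqD(2)[OF B] by (simp add: powr_mult)
    show "0 \<le> C * (2 * ?L) * norm (B x)" for x using C L_nonneg by simp
  qed (use CL in auto)
  then show ?thesis
    using r by (intro exI[of _ r]) (simp add: dwn_def dw_def a_def b_def r_def o_def)
qed

end

section \<open>Representatives of weak derivatives and the Sobolev norm\<close>

text \<open>Needed because \<open>A x\<close> lies in \<open>V\<close> for \<open>x\<close> in
  \<open>U\<close> only, so the composition is a difference of convex functions of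
  \<open>A x\<close> there and possibly nowhere else.\<close>

lemma has_weak_partial_cong:
  fixes u u' v :: "real ^ 'm \<Rightarrow> 'v::euclidean_space"
  assumes eq: "\<And>x. x \<in> U \<Longrightarrow> u x = u' x" and w: "has_weak_partial U k u v"
  shows "has_weak_partial U k u' v"
proof -
  have "integrable (lebesgue_on K) u \<longleftrightarrow> integrable (lebesgue_on K) u'" if "K \<subseteq> U" for K
    using eq that by (intro Bochner_Integration.integrable_cong) auto
  then have "locally_integrable_on U u'"
    using w unfolding has_weak_partial_def locally_integrable_on_def by blast
  moreover have "(\<integral>x. partial_deriv k \<phi> x *\<^sub>R u x \<partial>lebesgue_on U) = (\<integral>x. partial_deriv k \<phi> x *\<^sub>R u' x \<partial>lebesgue_on U)" for \<phi>
    using eq by (intro Bochner_Integration.integral_cong) auto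
  ultimately show ?thesis
    using w unfolding has_weak_partial_def by auto
qed

lemma has_weak_partial_const:
  fixes u v :: "real ^ 'm \<Rightarrow> 'v::euclidean_space"
  assumes "open U" and "has_weak_partial U k u v"
  shows "has_weak_partial U k (\<lambda>x. c :: real) (\<lambda>x. 0)"
  by (rule weak_partial_directional_chain[OF assms, where F = "\<lambda>_. c" and dF = "\<lambda>_ _. 0" and L = 0 and t = "\<lambda>n. 1 / real (Suc n)"])
    (simp, rule LIMSEQ_Suc[OF lim_1_over_n], simp_all)

lemma weak_partial_AE_eq:
  assumes U: "open U" and w: "has_weak_partial U k u v"
  shows "AE x in lebesgue_on U. v x = weak_partial U k u x"
proof -
  have "has_weak_partial U k u (weak_partial U k u)"
    unfolding weak_partial_def by (rule someI[of "\<lambda>h. has_weak_partial U k u h", OF w])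
  then show ?thesis by (rule has_weak_partial_unique[OF U w])
qed

text \<open>Completeness of Lebesgue measure carries measurability across the null set. Applied to
  the representative chosen by \<open>weak_partial\<close>.\<close>

lemma borel_measurable_lebesgue_on_AE:
  fixes f g :: "'a::euclidean_space \<Rightarrow> 'b::euclidean_space"
  assumes U: "U \<in> sets lebesgue" and f: "f \<in> borel_measurable (lebesgue_on U)"
    and eq: "AE x in lebesgue_on U. f x = g x"
  shows "g \<in> borel_measurable (lebesgue_on U)"
proof -
  have "(\<lambda>x. if x \<in> U then f x else 0) \<in> borel_measurable lebesgue"
    by (rule borel_measurable_if_I[OF f U])
  moreover have "AE x in lebesgue. (if x \<in> U then f x else 0) = (if x \<in> U then g x else 0)"
    using eq U by (subst (asm) AE_restrict_space_iff) auto
  ultimately have "(\<lambda>x. if x \<in> U then g x else 0) \<in> borel_measurable lebesgue"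
    by (rule borel_measurable_AE)
  then have "(\<lambda>x. if x \<in> U then g x else 0) \<in> borel_measurable (lebesgue_on U)"
    by (rule measurable_restrict_space1)
  then show ?thesis
    by (rule measurable_cong[THEN iffD1, rotated]) simp
qed

lemma Lq_norm_cong_AE:
  fixes f g :: "real ^ 'm \<Rightarrow> 'v::euclidean_space"
  assumes U: "U \<in> sets lebesgue" and f: "f \<in> borel_measurable (lebesgue_on U)"
    and eq: "AE x in lebesgue_on U. f x = g x"
  shows "Lq_norm U q f = Lq_norm U q g"
proof -
  have [measurable]: "g \<in> borel_measurable (lebesgue_on U)" "f \<in> borel_measurable (lebesgue_on U)"
    by (rule borel_measurable_lebesgue_on_AE[OF U f eq], rule f)
  have "(\<integral>x. norm (f x) powr q \<partial>lebesgue_on U) = (\<integral>x. norm (g x) powr q \<partial>lebesgue_on U)"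
    by (rule integral_cong_AE) (use eq in auto)
  then show ?thesis by (simp add: Lq_norm_def)
qed

text \<open>Frees the Sobolev norm from the choice in \<open>weak_partial\<close>: any measurable
  weak derivative computes it.\<close>

lemma Lq_norm_weak_partial:
  fixes u v :: "real ^ 'm \<Rightarrow> 'v::euclidean_space"
  assumes U: "open U" and w: "has_weak_partial U k u v" and v: "v \<in> borel_measurable (lebesgue_on U)"
  shows "Lq_norm U q (weak_partial U k u) = Lq_norm U q v"
  using Lq_norm_cong_AE[OF _ v weak_partial_AE_eq[OF U w]] U by auto

lemma Lq_norm_nonneg: "Lq_norm U q f \<ge> 0"
  by (simp add: Lq_norm_def)

lemma Lq_norm_tendsto_0_iff:
  fixes f :: "nat \<Rightarrow> real ^ 'm \<Rightarrow> 'v::euclidean_space"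
  assumes "q \<ge> 1"
  shows "(\<lambda>n. Lq_norm U q (f n)) \<longlonglongrightarrow> 0 \<longleftrightarrow>
    (\<lambda>n. \<integral>x. norm (f n x) powr q \<partial>lebesgue_on U) \<longlonglongrightarrow> 0"
proof
  assume "(\<lambda>n. Lq_norm U q (f n)) \<longlonglongrightarrow> 0"
  then have "(\<lambda>n. Lq_norm U q (f n) powr q) \<longlonglongrightarrow> 0"
    using assms by (intro tendsto_zero_powrI[where b = q]) (auto simp: Lq_norm_nonneg)
  moreover have "Lq_norm U q (f n) powr q = (\<integral>x. norm (f n x) powr q \<partial>lebesgue_on U)" for n
    using assms by (simp add: Lq_norm_def powr_powr)
  ultimately show "(\<lambda>n. \<integral>x. norm (f n x) powr q \<partial>lebesgue_on U) \<longlonglongrightarrow> 0" by simp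
next
  assume "(\<lambda>n. \<integral>x. norm (f n x) powr q \<partial>lebesgue_on U) \<longlonglongrightarrow> 0"
  then show "(\<lambda>n. Lq_norm U q (f n)) \<longlonglongrightarrow> 0"
    unfolding Lq_norm_def using assms by (intro tendsto_zero_powrI[where b = "1 / q"]) auto
qed

text \<open>Turns extractions into convergence of the whole sequence: a subsequence bounded away
  from \<open>l\<close> could have no further subsequence that tends to \<open>l\<close>.\<close>

lemma LIMSEQ_subsequence_principle:
  fixes X :: "nat \<Rightarrow> real"
  assumes "\<And>r :: nat \<Rightarrow> nat. strict_mono r \<Longrightarrow> \<exists>s :: nat \<Rightarrow> nat. strict_mono s \<and> (\<lambda>n. X (r (s n))) \<longlonglongrightarrow> l"
  shows "X \<longlonglongrightarrow> l"
proof (rule ccontr)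
  assume "\<not> X \<longlonglongrightarrow> l"
  then obtain e where e: "e > 0" "\<And>N. \<exists>n\<ge>N. e \<le> norm (X n - l)"
    unfolding LIMSEQ_iff by (meson not_less)
  then have "infinite {n. e \<le> norm (X n - l)}"
    unfolding infinite_nat_iff_unbounded_le by blast
  then obtain r :: "nat \<Rightarrow> nat" where r: "strict_mono r" "\<And>n. r n \<in> {n. e \<le> norm (X n - l)}"
    using infinite_enumerate by blast
  obtain s where s: "(\<lambda>n. X (r (s n))) \<longlonglongrightarrow> l" using assms[OF r(1)] by blast
  obtain N where "\<And>n. n \<ge> N \<Longrightarrow> norm (X (r (s n)) - l) < e" using LIMSEQ_D[OF s e(1)] by blast
  then have "norm (X (r (s N)) - l) < e" by simp
  with r(2)[of "s N"] show False by simp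
qed

section \<open>The operator between Sobolev spaces\<close>

text \<open>\<open>V\<close> will be the whole matrix space or the set of Hermitian matrices. The
  decomposition of \<open>s\<close> is required on \<open>V\<close> alone, whereas \<open>F1\<close>
  and \<open>F2\<close> are convex on the full Euclidean space, so directions never have to be
  restricted to \<open>V\<close>.\<close>

locale dc_sobolev = dc_function F1 F2 L1 L2
  for F1 F2 :: "'v::euclidean_space \<Rightarrow> real" and L1 L2 +
  fixes U :: "(real ^ 'm) set" and q :: real and V :: "'v set" and s :: "'v \<Rightarrow> real" and f :: "real \<Rightarrow> real" and L
  assumes U: "open U" and bU: "bounded U" and q: "1 \<le> q"
    and s: "\<And>A. A \<in> V \<Longrightarrow> s A = F1 A - F2 A"
    and f: "\<And>x y. \<bar>f x - f y\<bar> \<le> L * \<bar>x - y\<bar>"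
begin

lemma U_lebesgue: "U \<in> sets lebesgue"
  using U by auto

lemma finite_measure_U: "finite_measure (lebesgue_on U)"
  using bU U_lebesgue bounded_set_imp_lmeasurable by (intro finite_measure_lebesgue_on) auto

lemma f_const_nonneg: "L \<ge> 0"
  using f[of 1 0] by simp

lemma sobolevD:
  assumes "A \<in> sobolev U q V"
  shows "in_Lq U q A" and "\<exists>B. in_Lq U q B \<and> has_weak_partial U k A B"
    and "x \<in> U \<Longrightarrow> A x \<in> V"
  using assms unfolding sobolev_def by blast+

lemma composition_eq: "A \<in> sobolev U q V \<Longrightarrow> x \<in> U \<Longrightarrow> (f \<circ> s \<circ> A) x = f (dc (A x))"
  using sobolevD(3) s by (simp add: dc_def)

lemma f_dc_lipschitz: "\<bar>f (dc a) - f (dc b)\<bar> \<le> L * (L1 + L2) * norm (a - b)"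
proof -
  have "\<bar>f (dc a) - f (dc b)\<bar> \<le> L * \<bar>dc a - dc b\<bar>" by (rule f)
  also have "\<dots> \<le> L * ((L1 + L2) * norm (a - b))" by (intro mult_left_mono dc_lipschitz f_const_nonneg)
  finally show ?thesis by (simp add: mult.assoc)
qed

lemma f_measurable [measurable]: "f \<in> borel_measurable borel"
proof -
  have "L-lipschitz_on UNIV f" using f f_const_nonneg by (intro lipschitz_onI) (auto simp: dist_real_def)
  then show ?thesis by (intro borel_measurable_continuous_onI lipschitz_on_continuous_on)
qed

lemma composition_measurable:
  assumes A: "A \<in> sobolev U q V"
  shows "(f \<circ> s \<circ> A) \<in> borel_measurable (lebesgue_on U)"
proof -
  have [measurable]: "A \<in> borel_measurable (lebesgue_on U)" using in_LqD(1)[OF sobolevD(1)[OF A]] .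
  have "(\<lambda>x. f (dc (A x))) \<in> borel_measurable (lebesgue_on U)" by measurable
  then show ?thesis
    by (rule measurable_cong[THEN iffD1, rotated]) (use composition_eq[OF A] in simp)
qed

lemma composition_in_Lq:
  assumes A: "A \<in> sobolev U q V"
  shows "in_Lq U q (f \<circ> s \<circ> A)"
proof (rule in_Lq_bound[OF finite_measure_U q composition_measurable[OF A] sobolevD(1)[OF A] sobolevD(1)[OF A]])
  show "L * (L1 + L2) \<ge> 0" using f_const_nonneg L_nonneg by simp
  fix x assume x: "x \<in> U"
  have "\<bar>f (dc (A x))\<bar> \<le> L * (L1 + L2) * norm (A x) + \<bar>f (dc 0)\<bar>"
    using f_dc_lipschitz[of "A x" 0] unfolding diff_zero by linarith
  then show "norm ((f \<circ> s \<circ> A) x) \<le> L * (L1 + L2) * norm (A x) + (0 * norm (A x) + \<bar>f (dc 0)\<bar>)"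
    using composition_eq[OF A x] by simp
qed auto

text \<open>A single \<open>g\<close> serves all \<open>A\<close>, \<open>B\<close> and
  \<open>k\<close>. The comparison of \<open>An\<close> with \<open>A\<close> rests on this
  uniformity.\<close>

lemma chain_rule:
  obtains g where "g \<in> borel_measurable borel" "\<And>x. \<bar>g x\<bar> \<le> L"
    "\<And>A B k. A \<in> sobolev U q V \<Longrightarrow> has_weak_partial U k A B \<Longrightarrow>
       has_weak_partial U k (f \<circ> s \<circ> A) (\<lambda>x. g (dc (A x)) * dc_deriv (A x) (B x))"
proof -
  obtain g where g: "g \<in> borel_measurable borel" "\<And>x. \<bar>g x\<bar> \<le> L" "\<And>x. f x = f 0 + primitive g x"
    by (rule lipschitz_eq_primitive[OF f]) blast
  have "has_weak_partial U k (f \<circ> s \<circ> A) (\<lambda>x. g (dc (A x)) * dc_deriv (A x) (B x))"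
    if A: "A \<in> sobolev U q V" and B: "has_weak_partial U k A B" for A B k
  proof (rule has_weak_partial_cong)
    have "has_weak_partial U k (\<lambda>x. primitive g (dc (A x))) (\<lambda>x. g (dc (A x)) * dc_deriv (A x) (B x))"
      by (rule weak_partial_primitive[OF U dc_weak_partial[OF U B] g(1,2)])
    from has_weak_partial_lin[OF U this has_weak_partial_const[OF U B, of "f 0"], of 1 1]
    show "has_weak_partial U k (\<lambda>x. f 0 + primitive g (dc (A x))) (\<lambda>x. g (dc (A x)) * dc_deriv (A x) (B x))"
      by (simp add: add.commute)
    show "f 0 + primitive g (dc (A x)) = (f \<circ> s \<circ> A) x" if "x \<in> U" for x
      unfolding composition_eq[OF A that] by (rule g(3)[symmetric])
  qed
  then show ?thesis using that g(1,2) by blast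
qed

lemma weak_partial_in_Lq:
  assumes A: "in_Lq U q A" and B: "in_Lq U q B" and g: "g \<in> borel_measurable borel" "\<And>x. \<bar>g x\<bar> \<le> L"
  shows "in_Lq U q (\<lambda>x. g (dc (A x)) * dc_deriv (A x) (B x))"
proof (rule in_Lq_bound[OF finite_measure_U q _ B B])
  have [measurable]: "A \<in> borel_measurable (lebesgue_on U)" "B \<in> borel_measurable (lebesgue_on U)"
    using in_LqD(1) A B by auto
  note [measurable] = g(1)
  show "(\<lambda>x. g (dc (A x)) * dc_deriv (A x) (B x)) \<in> borel_measurable (lebesgue_on U)" by measurable
  show "L * (L1 + L2) \<ge> 0" using f_const_nonneg L_nonneg by simp
  fix x
  have "\<bar>g (dc (A x))\<bar> * \<bar>dc_deriv (A x) (B x)\<bar> \<le> L * ((L1 + L2) * norm (B x))"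
    using f_const_nonneg by (intro mult_mono g(2) dc_deriv_bound) auto
  then show "norm (g (dc (A x)) * dc_deriv (A x) (B x)) \<le> L * (L1 + L2) * norm (B x) + (0 * norm (B x) + 0)"
    by (simp add: abs_mult mult.assoc)
qed auto

lemma well_defined: "sobolev_well_defined U q V (UNIV :: real set) (\<lambda>A. f \<circ> s \<circ> A)"
  unfolding sobolev_well_defined_def
proof (intro conjI ballI impI)
  fix A assume A: "A \<in> sobolev U q V"
  obtain g where g: "g \<in> borel_measurable borel" "\<And>x. \<bar>g x\<bar> \<le> L"
    and gw: "\<And>A B k. A \<in> sobolev U q V \<Longrightarrow> has_weak_partial U k A B \<Longrightarrow>
       has_weak_partial U k (f \<circ> s \<circ> A) (\<lambda>x. g (dc (A x)) * dc_deriv (A x) (B x))"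
    by (rule chain_rule) blast
  have "\<exists>h. in_Lq U q h \<and> has_weak_partial U k (f \<circ> s \<circ> A) h" for k
  proof -
    obtain B where B: "in_Lq U q B" "has_weak_partial U k A B" using sobolevD(2)[OF A] by blast
    then show ?thesis
      using weak_partial_in_Lq[OF sobolevD(1)[OF A] B(1) g] gw[OF A B(2)] by blast
  qed
  then show "f \<circ> s \<circ> A \<in> sobolev U q UNIV"
    using composition_in_Lq[OF A] by (simp add: sobolev_def)
next
  fix A A' :: "real ^ 'm \<Rightarrow> 'v" assume "AE x in lebesgue_on U. A x = A' x"
  then show "AE x in lebesgue_on U. (f \<circ> s \<circ> A) x = (f \<circ> s \<circ> A') x"
    by eventually_elim simp
qed

text \<open>The two parts of the norm behave differently: for the function itself the Lipschitz
  bound gives a linear estimate, while the derivatives converge without any rate, by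
  \<open>dc_subsequence\<close> applied to every subsequence.\<close>

lemma sequentially_continuous:
  assumes A: "A \<in> sobolev U q V" and An: "\<And>n. An n \<in> sobolev U q V"
    and lim: "(\<lambda>n. sobolev_norm U q (\<lambda>x. An n x - A x)) \<longlonglongrightarrow> 0"
  shows "(\<lambda>n. sobolev_norm U q (\<lambda>x. (f \<circ> s \<circ> An n) x - (f \<circ> s \<circ> A) x)) \<longlonglongrightarrow> 0"
proof -
  let ?M = "lebesgue_on U"
  obtain g where g: "g \<in> borel_measurable borel" "\<And>x. \<bar>g x\<bar> \<le> L"
    and gw: "\<And>A B k. A \<in> sobolev U q V \<Longrightarrow> has_weak_partial U k A B \<Longrightarrow>
       has_weak_partial U k (f \<circ> s \<circ> A) (\<lambda>x. g (dc (A x)) * dc_deriv (A x) (B x))"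
    by (rule chain_rule) blast
  have Aq: "in_Lq U q A" "\<And>n. in_Lq U q (An n)" by (intro sobolevD(1) A An)+
  have dq: "in_Lq U q (\<lambda>x. An n x - A x)" for n by (intro in_Lq_diff[OF finite_measure_U q] Aq)
  have lA: "(\<lambda>n. Lq_norm U q (\<lambda>x. An n x - A x)) \<longlonglongrightarrow> 0"
    by (rule tendsto_sandwich[OF _ _ tendsto_const lim]; intro always_eventually allI)
      (simp_all add: sobolev_norm_def Lq_norm_nonneg sum_nonneg)
  have "(\<lambda>n. Lq_norm U q (\<lambda>x. (f \<circ> s \<circ> An n) x - (f \<circ> s \<circ> A) x)) \<longlonglongrightarrow> 0"
  proof -
    let ?c = "L * (L1 + L2)"
    have c: "?c \<ge> 0" using f_const_nonneg L_nonneg by simp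
    have l: "(\<lambda>n. \<integral>x. norm (An n x - A x) powr q \<partial>?M) \<longlonglongrightarrow> 0"
      using lA unfolding Lq_norm_tendsto_0_iff[OF q] .
    have "(\<lambda>n. \<integral>x. norm ((f \<circ> s \<circ> An n) x - (f \<circ> s \<circ> A) x) powr q \<partial>?M) \<longlonglongrightarrow> 0"
    proof (rule tendsto_sandwich[OF _ _ tendsto_const tendsto_mult_right_zero[OF l, of "?c powr q"]])
      show "\<forall>\<^sub>F n in sequentially. 0 \<le> (\<integral>x. norm ((f \<circ> s \<circ> An n) x - (f \<circ> s \<circ> A) x) powr q \<partial>?M)" by simp
      show "\<forall>\<^sub>F n in sequentially. (\<integral>x. norm ((f \<circ> s \<circ> An n) x - (f \<circ> s \<circ> A) x) powr q \<partial>?M)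
          \<le> ?c powr q * (\<integral>x. norm (An n x - A x) powr q \<partial>?M)"
      proof (rule always_eventually, rule allI)
        fix n
        have "(\<integral>x. norm ((f \<circ> s \<circ> An n) x - (f \<circ> s \<circ> A) x) powr q \<partial>?M) \<le> (\<integral>x. ?c powr q * norm (An n x - A x) powr q \<partial>?M)"
        proof (rule integral_mono)
          show "integrable ?M (\<lambda>x. norm ((f \<circ> s \<circ> An n) x - (f \<circ> s \<circ> A) x) powr q)"
            by (rule in_LqD(2)[OF in_Lq_diff[OF finite_measure_U q composition_in_Lq[OF An] composition_in_Lq[OF A]]])
          show "integrable ?M (\<lambda>x. ?c powr q * norm (An n x - A x) powr q)"
            by (intro integrable_mult_right in_LqD(2)[OF dq])
          fix x assume "x \<in> space ?M"
          then have x: "x \<in> U" by simp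
          have "norm ((f \<circ> s \<circ> An n) x - (f \<circ> s \<circ> A) x) \<le> ?c * norm (An n x - A x)"
            unfolding composition_eq[OF An x] composition_eq[OF A x] real_norm_def by (rule f_dc_lipschitz)
          then have "norm ((f \<circ> s \<circ> An n) x - (f \<circ> s \<circ> A) x) powr q \<le> (?c * norm (An n x - A x)) powr q"
            using q by (intro powr_mono2) auto
          then show "norm ((f \<circ> s \<circ> An n) x - (f \<circ> s \<circ> A) x) powr q \<le> ?c powr q * norm (An n x - A x) powr q"
            using c by (simp only: powr_mult norm_ge_zero)
        qed
        then show "(\<integral>x. norm ((f \<circ> s \<circ> An n) x - (f \<circ> s \<circ> A) x) powr q \<partial>?M)
          \<le> ?c powr q * (\<integral>x. norm (An n x - A x) powr q \<partial>?M)" by (simp only: integral_mult_right_zero)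
      qed
    qed
    then show ?thesis unfolding Lq_norm_tendsto_0_iff[OF q] .
  qed
  moreover have "(\<lambda>n. Lq_norm U q (weak_partial U k (\<lambda>x. (f \<circ> s \<circ> An n) x - (f \<circ> s \<circ> A) x))) \<longlonglongrightarrow> 0" for k
  proof -
    obtain B where B: "in_Lq U q B" "has_weak_partial U k A B" using sobolevD(2)[OF A] by blast
    have "\<forall>n. \<exists>B. in_Lq U q B \<and> has_weak_partial U k (An n) B" using sobolevD(2)[OF An] by blast
    from choice[OF this] obtain Bn where Bn: "\<And>n. in_Lq U q (Bn n)" "\<And>n. has_weak_partial U k (An n) (Bn n)" by blast
    have wd: "has_weak_partial U k (\<lambda>x. a x - a' x) (\<lambda>x. b x - b' x)"
      if "has_weak_partial U k a b" "has_weak_partial U k a' b'" for a b a' b' :: "real ^ 'm \<Rightarrow> 'w::euclidean_space"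
      using has_weak_partial_lin[OF U that, of 1 "-1"] by simp
    \<comment> \<open>\<open>weak_partial\<close> picks a representative for the difference
      independently of \<open>Bn\<close> and \<open>B\<close>; linearity and uniqueness identify it
      up to a null set, which the norm ignores.\<close>
    have eqB: "Lq_norm U q (weak_partial U k (\<lambda>x. An n x - A x)) = Lq_norm U q (\<lambda>x. Bn n x - B x)" for n
      by (rule Lq_norm_weak_partial[OF U wd[OF Bn(2) B(2)] in_LqD(1)[OF in_Lq_diff[OF finite_measure_U q Bn(1) B(1)]]])
    have lB: "(\<lambda>n. Lq_norm U q (\<lambda>x. Bn n x - B x)) \<longlonglongrightarrow> 0"
    proof (rule tendsto_sandwich[OF _ _ tendsto_const lim])
      show "\<forall>\<^sub>F n in sequentially. 0 \<le> Lq_norm U q (\<lambda>x. Bn n x - B x)" by (simp add: Lq_norm_nonneg)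
      show "\<forall>\<^sub>F n in sequentially. Lq_norm U q (\<lambda>x. Bn n x - B x) \<le> sobolev_norm U q (\<lambda>x. An n x - A x)"
      proof (rule always_eventually, rule allI)
        fix n
        have "Lq_norm U q (weak_partial U k (\<lambda>x. An n x - A x)) \<le> (\<Sum>k\<in>UNIV. Lq_norm U q (weak_partial U k (\<lambda>x. An n x - A x)))"
          by (rule member_le_sum) (auto simp: Lq_norm_nonneg)
        then show "Lq_norm U q (\<lambda>x. Bn n x - B x) \<le> sobolev_norm U q (\<lambda>x. An n x - A x)"
          unfolding eqB[symmetric] sobolev_norm_def using Lq_norm_nonneg[of U q "\<lambda>x. An n x - A x"] by linarith
      qed
    qed
    define D where "D = (\<lambda>(A :: real ^ 'm \<Rightarrow> 'v) (B :: real ^ 'm \<Rightarrow> 'v) x. g (dc (A x)) * dc_deriv (A x) (B x) :: real)"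
    have Dq: "in_Lq U q (D A B)" "in_Lq U q (D (An n) (Bn n))" for n
      unfolding D_def by (intro weak_partial_in_Lq Aq B Bn g)+
    have Dw: "has_weak_partial U k (f \<circ> s \<circ> A) (D A B)" "has_weak_partial U k (f \<circ> s \<circ> An n) (D (An n) (Bn n))" for n
      unfolding D_def by (intro gw A An B Bn)+
    have eqD: "Lq_norm U q (weak_partial U k (\<lambda>x. (f \<circ> s \<circ> An n) x - (f \<circ> s \<circ> A) x)) = Lq_norm U q (\<lambda>x. D (An n) (Bn n) x - D A B x)" for n
      by (rule Lq_norm_weak_partial[OF U wd[OF Dw(2) Dw(1)] in_LqD(1)[OF in_Lq_diff[OF finite_measure_U q Dq(2) Dq(1)]]])
    have lA': "(\<lambda>n. \<integral>x. norm (An n x - A x) powr q \<partial>?M) \<longlonglongrightarrow> 0"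
      using lA unfolding Lq_norm_tendsto_0_iff[OF q] .
    have lB': "(\<lambda>n. \<integral>x. norm (Bn n x - B x) powr q \<partial>?M) \<longlonglongrightarrow> 0"
      using lB unfolding Lq_norm_tendsto_0_iff[OF q] .
    have "(\<lambda>n. \<integral>x. norm (D (An n) (Bn n) x - D A B x) powr q \<partial>?M) \<longlonglongrightarrow> 0"
    proof (rule LIMSEQ_subsequence_principle)
      fix r :: "nat \<Rightarrow> nat" assume r: "strict_mono r"
      have "(\<lambda>n. \<integral>x. norm (An (r n) x - A x) powr q \<partial>?M) \<longlonglongrightarrow> 0" "(\<lambda>n. \<integral>x. norm (Bn (r n) x - B x) powr q \<partial>?M) \<longlonglongrightarrow> 0"
        using LIMSEQ_subseq_LIMSEQ[OF lA' r] LIMSEQ_subseq_LIMSEQ[OF lB' r] by (simp_all add: o_def)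
      from dc_subsequence[where An = "\<lambda>n. An (r n)" and Bn = "\<lambda>n. Bn (r n)", OF U finite_measure_U q B(2) Bn(2) Aq(1) B(1) Aq(2) Bn(1) this g]
      show "\<exists>s. strict_mono s \<and> (\<lambda>n. \<integral>x. norm (D (An (r (s n))) (Bn (r (s n))) x - D A B x) powr q \<partial>?M) \<longlonglongrightarrow> 0"
        by (simp add: D_def)
    qed
    then show ?thesis unfolding eqD Lq_norm_tendsto_0_iff[OF q] .
  qed
  ultimately have "(\<lambda>n. Lq_norm U q (\<lambda>x. (f \<circ> s \<circ> An n) x - (f \<circ> s \<circ> A) x) +
      (\<Sum>k\<in>UNIV. Lq_norm U q (weak_partial U k (\<lambda>x. (f \<circ> s \<circ> An n) x - (f \<circ> s \<circ> A) x)))) \<longlonglongrightarrow> 0 + (\<Sum>k\<in>(UNIV :: 'm set). 0)"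
    by (intro tendsto_add tendsto_sum)
  then show ?thesis by (simp add: sobolev_norm_def)
qed

lemma continuous: "sobolev_continuous U q V (\<lambda>A. f \<circ> s \<circ> A)"
  unfolding sobolev_continuous_def
proof (intro ballI allI impI)
  fix A and \<epsilon> :: real assume A: "A \<in> sobolev U q V" and \<epsilon>: "\<epsilon> > 0"
  show "\<exists>\<delta>>0. \<forall>h\<in>sobolev U q V. sobolev_norm U q (\<lambda>x. h x - A x) < \<delta> \<longrightarrow>
      sobolev_norm U q (\<lambda>x. (f \<circ> s \<circ> h) x - (f \<circ> s \<circ> A) x) < \<epsilon>"
  proof (rule ccontr)
    assume neg: "\<not> ?thesis"
    have "\<forall>n. \<exists>h. h \<in> sobolev U q V \<and> sobolev_norm U q (\<lambda>x. h x - A x) < 1 / real (Suc n) \<and>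
        \<not> sobolev_norm U q (\<lambda>x. (f \<circ> s \<circ> h) x - (f \<circ> s \<circ> A) x) < \<epsilon>"
    proof
      fix n
      have "1 / real (Suc n) > 0" by simp
      with neg show "\<exists>h. h \<in> sobolev U q V \<and> sobolev_norm U q (\<lambda>x. h x - A x) < 1 / real (Suc n) \<and>
        \<not> sobolev_norm U q (\<lambda>x. (f \<circ> s \<circ> h) x - (f \<circ> s \<circ> A) x) < \<epsilon>" by blast
    qed
    from choice[OF this] obtain An where An: "\<And>n. An n \<in> sobolev U q V"
      "\<And>n. sobolev_norm U q (\<lambda>x. An n x - A x) < 1 / real (Suc n)"
      "\<And>n. \<not> sobolev_norm U q (\<lambda>x. (f \<circ> s \<circ> An n) x - (f \<circ> s \<circ> A) x) < \<epsilon>" by blast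
    have lim: "(\<lambda>n. sobolev_norm U q (\<lambda>x. An n x - A x)) \<longlonglongrightarrow> 0"
    proof (rule tendsto_sandwich[OF _ _ tendsto_const LIMSEQ_Suc[OF lim_1_over_n]])
      show "\<forall>\<^sub>F n in sequentially. 0 \<le> sobolev_norm U q (\<lambda>x. An n x - A x)"
        by (intro always_eventually allI) (simp add: sobolev_norm_def Lq_norm_nonneg sum_nonneg)
      show "\<forall>\<^sub>F n in sequentially. sobolev_norm U q (\<lambda>x. An n x - A x) \<le> 1 / real (Suc n)"
        using An(2) by (intro always_eventually allI less_imp_le)
    qed
    from order_tendstoD(2)[OF sequentially_continuous[OF A An(1) lim] \<epsilon>] An(3)
    show False by (auto simp: eventually_sequentially)
  qed
qed

end

section \<open>Sums of the largest eigenvalues and singular values\<close>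

text \<open>Antilinear in the first argument. Its real part is the inner product of the underlying
  real Euclidean space, which links complex orthogonality with real linear functionals.\<close>

definition cinner :: "complex ^ 'n \<Rightarrow> complex ^ 'n \<Rightarrow> complex" where
  "cinner x y = (\<Sum>i\<in>UNIV. cnj (x $ i) * y $ i)"

lemma Re_cinner: "Re (cinner x y) = x \<bullet> y"
  by (simp add: cinner_def inner_vec_def inner_complex_def)

lemma cinner_commute: "cinner y x = cnj (cinner x y)"
  by (simp add: cinner_def mult.commute)

lemma cinner_add_right: "cinner x (y + z) = cinner x y + cinner x z"
  and cinner_scale_right: "cinner x (c *s y) = c * cinner x y"
  and cinner_scale_left: "cinner (c *s x) y = cnj c * cinner x y"
  and cinner_zero_right [simp]: "cinner x 0 = 0"
  by (simp_all add: cinner_def algebra_simps sum.distrib sum_subtractf sum_distrib_left)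

lemma cinner_scaleR_right: "cinner x (r *\<^sub>R y) = of_real r * cinner x y"
  and cinner_scaleR_left: "cinner (r *\<^sub>R x) y = of_real r * cinner x y"
  unfolding cinner_def sum_distrib_left vector_scaleR_component
  by (simp_all add: scaleR_conv_of_real mult_ac)

lemma cinner_sum_right: "cinner x (\<Sum>i\<in>I. f i) = (\<Sum>i\<in>I. cinner x (f i))"
  by (induction I rule: infinite_finite_induct) (simp_all add: cinner_add_right)

lemma cinner_sum_left: "cinner (\<Sum>i\<in>I. f i) x = (\<Sum>i\<in>I. cinner (f i) x)"
  unfolding cinner_commute[of _ x] cinner_sum_right by simp

lemma sum_mult_cnj: "(\<Sum>i\<in>I. z i * cnj (z i)) = of_real (\<Sum>i\<in>I. (cmod (z i))\<^sup>2)"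
  by (simp add: complex_norm_square del: of_real_power)

lemma cinner_self: "cinner x x = of_real ((norm x)\<^sup>2)"
proof -
  have "cinner x x = of_real (\<Sum>i\<in>UNIV. (norm (x $ i))\<^sup>2)"
    unfolding cinner_def sum_mult_cnj[symmetric] by (simp add: mult.commute)
  also have "(\<Sum>i\<in>UNIV. (norm (x $ i))\<^sup>2) = (norm x)\<^sup>2"
    by (simp add: norm_vec_def L2_set_def sum_nonneg)
  finally show ?thesis .
qed

lemma cinner_adjoint: "cinner x (A *v y) = cinner (conj_transpose A *v x) y"
proof -
  have "cinner x (A *v y) = (\<Sum>i\<in>UNIV. \<Sum>j\<in>UNIV. cnj (x $ i) * (A $ i $ j * y $ j))"
    by (simp add: cinner_def matrix_vector_mult_def sum_distrib_left)
  also have "\<dots> = (\<Sum>j\<in>UNIV. \<Sum>i\<in>UNIV. cnj (x $ i) * (A $ i $ j * y $ j))"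
    by (rule sum.swap)
  also have "\<dots> = cinner (conj_transpose A *v x) y"
    by (simp add: cinner_def matrix_vector_mult_def conj_transpose_def sum_distrib_left mult_ac)
  finally show ?thesis .
qed

lemma conj_transpose_mult: "conj_transpose (A ** B) = conj_transpose B ** conj_transpose A"
  by (simp add: conj_transpose_def matrix_matrix_mult_def vec_eq_iff mult.commute)

lemma conj_transpose_involutive [simp]: "conj_transpose (conj_transpose A) = A"
  by (simp add: conj_transpose_def vec_eq_iff)

lemma linear_matrix_vector_mult:
  fixes A :: "complex ^ 'd ^ 'D"
  shows "linear ((*v) A)"
proof (rule linearI)
  show "A *v (x + y) = A *v x + A *v y" for x y by (rule matrix_vector_right_distrib)
  show "A *v (r *\<^sub>R x) = r *\<^sub>R (A *v x)" for r x
    by (simp add: matrix_vector_mult_def vec_eq_iff scaleR_sum_right)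
qed

lemma norm_matrix_vector_mult_le:
  fixes A :: "complex ^ 'd ^ 'D"
  shows "norm (A *v x) \<le> norm A * norm x"
proof -
  have row: "norm ((A *v x) $ i) \<le> norm (A $ i) * norm x" for i
  proof -
    have "norm ((A *v x) $ i) \<le> (\<Sum>j\<in>UNIV. norm (A $ i $ j) * norm (x $ j))"
      unfolding matrix_vector_mult_def by (simp add: order_trans[OF norm_sum] norm_mult)
    also have "\<dots> \<le> L2_set (\<lambda>j. norm (A $ i $ j)) UNIV * L2_set (\<lambda>j. norm (x $ j)) UNIV"
      using L2_set_mult_ineq[of "\<lambda>j. norm (A $ i $ j)" "\<lambda>j. norm (x $ j)" UNIV] by simp
    finally show ?thesis by (simp add: norm_vec_def)
  qed
  have "norm (A *v x) \<le> L2_set (\<lambda>i. norm (A $ i) * norm x) UNIV"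
    unfolding norm_vec_def[of "A *v x"] by (intro L2_set_mono row) auto
  also have "\<dots> = norm A * norm x"
    unfolding norm_vec_def[of A] by (simp add: L2_set_left_distrib)
  finally show ?thesis .
qed

text \<open>The vectors are indexed by \<open>'d\<close> itself, so their number is the dimension
  and orthonormality alone makes them a basis.\<close>

definition orthonormal_basis :: "('d \<Rightarrow> complex ^ 'd) \<Rightarrow> bool" where
  "orthonormal_basis e \<longleftrightarrow> (\<forall>l m. cinner (e l) (e m) = (if l = m then 1 else 0))"

lemma orthonormal_basis_norm: "orthonormal_basis e \<Longrightarrow> norm (e l) = 1"
proof -
  assume "orthonormal_basis e"
  then have "of_real ((norm (e l))\<^sup>2) = (1 :: complex)"
    using cinner_self[of "e l"] by (simp add: orthonormal_basis_def)
  then have "(norm (e l))\<^sup>2 = 1" using of_real_eq_1_iff by blast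
  then show ?thesis using power2_eq_1_iff[of "norm (e l)"] norm_ge_zero[of "e l"] by linarith
qed

text \<open>For the square matrix with columns \<open>e l\<close>, the left inverse
  \<open>conj_transpose P\<close> is also a right inverse; applied to \<open>x\<close> this is the
  expansion.\<close>

lemma orthonormal_basis_expansion:
  fixes e :: "'d \<Rightarrow> complex ^ 'd"
  assumes e: "orthonormal_basis e"
  shows "x = (\<Sum>l\<in>UNIV. cinner (e l) x *s e l)"
proof -
  define P :: "complex ^ 'd ^ 'd" where "P = (\<chi> i l. e l $ i)"
  have "conj_transpose P ** P = mat 1"
    using e by (simp add: P_def conj_transpose_def matrix_matrix_mult_def mat_def vec_eq_iff orthonormal_basis_def cinner_def)
  then have "P ** conj_transpose P = mat 1" by (simp add: matrix_left_right_inverse)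
  then have "x = P *v (conj_transpose P *v x)"
    by (simp add: matrix_vector_mul_assoc)
  also have "conj_transpose P *v x = (\<chi> l. cinner (e l) x)"
    by (simp add: P_def conj_transpose_def matrix_vector_mult_def cinner_def vec_eq_iff)
  also have "P *v (\<chi> l. cinner (e l) x) = (\<Sum>l\<in>UNIV. cinner (e l) x *s e l)"
    by (simp add: P_def matrix_vector_mult_def vec_eq_iff mult.commute)
  finally show ?thesis .
qed

lemma parseval:
  fixes e :: "'d \<Rightarrow> complex ^ 'd"
  assumes e: "orthonormal_basis e"
  shows "(\<Sum>l\<in>UNIV. (cmod (cinner (e l) x))\<^sup>2) = (norm x)\<^sup>2"
proof -
  have "of_real ((norm x)\<^sup>2) = cinner x (\<Sum>l\<in>UNIV. cinner (e l) x *s e l)"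
    using orthonormal_basis_expansion[OF e, of x] cinner_self[of x] by simp
  also have "\<dots> = (\<Sum>l\<in>UNIV. cinner (e l) x * cnj (cinner (e l) x))"
    unfolding cinner_sum_right cinner_scale_right by (simp add: cinner_commute[of _ x])
  also have "\<dots> = of_real (\<Sum>l\<in>UNIV. (cmod (cinner (e l) x))\<^sup>2)"
    by (rule sum_mult_cnj)
  finally show ?thesis using of_real_eq_iff by metis
qed

lemma bessel_partial_isometry:
  fixes y :: "'d::finite \<Rightarrow> complex ^ 'n"
  assumes orth: "\<And>l m. l \<noteq> m \<Longrightarrow> cinner (y l) (y m) = 0" and le: "\<And>l. norm (y l) \<le> 1"
  shows "(\<Sum>l\<in>UNIV. (cmod (cinner (y l) z))\<^sup>2) \<le> (norm z)\<^sup>2"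
proof -
  define c where "c = (\<lambda>l. cinner (y l) z)"
  define p where "p = (\<Sum>l\<in>UNIV. c l *s y l)"
  define S where "S = (\<Sum>l\<in>UNIV. (cmod (c l))\<^sup>2)"
  have "cinner p z = (\<Sum>l\<in>UNIV. cnj (c l) * c l)"
    by (simp add: p_def cinner_sum_left cinner_scale_left c_def)
  also have "\<dots> = of_real S" unfolding S_def sum_mult_cnj[symmetric] by (simp add: mult.commute)
  finally have pz: "p \<bullet> z = S" using Re_cinner[of p z] by simp
  have yp: "cinner (y l) p = c l * of_real ((norm (y l))\<^sup>2)" for l
  proof -
    have "cinner (y l) p = (\<Sum>m\<in>UNIV. c m * cinner (y l) (y m))"
      by (simp add: p_def cinner_sum_right cinner_scale_right)
    also have "\<dots> = c l * cinner (y l) (y l)"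
      by (subst sum.mono_neutral_right[of UNIV "{l}"]) (auto simp: orth)
    finally show ?thesis by (simp only: cinner_self)
  qed
  have "cinner (\<Sum>l\<in>UNIV. c l *s y l) p = (\<Sum>l\<in>UNIV. cnj (c l) * (c l * of_real ((norm (y l))\<^sup>2)))"
    by (simp add: cinner_sum_left cinner_scale_left yp)
  then have "cinner p p = (\<Sum>l\<in>UNIV. cnj (c l) * (c l * of_real ((norm (y l))\<^sup>2)))"
    unfolding p_def[symmetric] .
  also have "\<dots> = (\<Sum>l\<in>UNIV. of_real ((cmod (c l))\<^sup>2 * (norm (y l))\<^sup>2))"
    unfolding of_real_mult complex_norm_square[of "c _"] by (simp add: mult_ac)
  also have "\<dots> = of_real (\<Sum>l\<in>UNIV. (cmod (c l))\<^sup>2 * (norm (y l))\<^sup>2)" by simp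
  finally have "p \<bullet> p = (\<Sum>l\<in>UNIV. (cmod (c l))\<^sup>2 * (norm (y l))\<^sup>2)"
    using Re_cinner[of p p] by simp
  also have "\<dots> \<le> S"
    unfolding S_def using le by (intro sum_mono mult_left_le) (auto simp: power_le_one)
  finally have "p \<bullet> p \<le> S" .
  moreover have "0 \<le> (z - p) \<bullet> (z - p)" by simp
  moreover have "(z - p) \<bullet> (z - p) = z \<bullet> z - 2 * (p \<bullet> z) + p \<bullet> p"
    by (simp add: inner_diff_left inner_diff_right inner_commute)
  ultimately have "S \<le> z \<bullet> z" using pz by linarith
  then show ?thesis by (simp add: S_def c_def power2_norm_eq_inner)
qed

section \<open>The spectral theorem for Hermitian matrices\<close>

lemma Herm_inner:
  assumes "A \<in> Herm"
  shows "cinner (A *v x) y = cinner x (A *v y)" and "(A *v x) \<bullet> y = x \<bullet> (A *v y)"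
proof -
  show "cinner (A *v x) y = cinner x (A *v y)"
    using assms by (simp add: cinner_adjoint Herm_def)
  then show "(A *v x) \<bullet> y = x \<bullet> (A *v y)" by (metis Re_cinner)
qed

lemma quadratic_nonneg_linear_zero:
  fixes a b :: real
  assumes "\<And>t. 0 \<le> t * a + t\<^sup>2 * b"
  shows "a = 0"
proof (rule ccontr)
  assume a: "a \<noteq> 0"
  \<comment> \<open>Of the order of the minimizer of
    \<open>t * a + t\<^sup>2 * \<bar>b\<bar>\<close>; the summand 1 avoids division by 0 and makes
    the value strictly negative.\<close>
  define t where "t = - a / (\<bar>b\<bar> + 1)"
  have b: "\<bar>b\<bar> + 1 > 0" by simp
  have "t * a + t\<^sup>2 * b \<le> t * a + t\<^sup>2 * \<bar>b\<bar>" by (simp add: mult_left_mono)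
  also have "\<dots> = a\<^sup>2 / (\<bar>b\<bar> + 1)\<^sup>2 * (\<bar>b\<bar> - (\<bar>b\<bar> + 1))"
  proof -
    have "t * a = - (a\<^sup>2 / (\<bar>b\<bar> + 1)\<^sup>2 * (\<bar>b\<bar> + 1))" "t\<^sup>2 = a\<^sup>2 / (\<bar>b\<bar> + 1)\<^sup>2"
      using b by (simp_all add: t_def power2_eq_square)
    then show ?thesis by (simp only: right_diff_distrib)
  qed
  also have "\<dots> < 0" using a b by (simp add: divide_neg_pos)
  finally show False using assms[of t] by simp
qed

text \<open>The orthogonal complement of eigenvectors is invariant under a Hermitian matrix, so the
  variational argument can be repeated inside it; the maximum of the real quadratic form is
  automatically a real eigenvalue.\<close>

lemma Herm_eigenvector_in_complement:
  fixes A :: "complex ^ 'd ^ 'd" and J :: "'d set"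
  assumes A: "A \<in> Herm" and J: "card J < CARD('d)"
    and eig: "\<And>j. j \<in> J \<Longrightarrow> A *v e j = of_real (lam j) *s e j"
  obtains x \<mu> where "norm x = 1" "\<And>j. j \<in> J \<Longrightarrow> cinner (e j) x = 0" "A *v x = of_real \<mu> *s x"
proof -
  define W where "W = {x. \<forall>j\<in>J. cinner (e j) x = 0}"
  have Wlin: "x + t *\<^sub>R y \<in> W" if "x \<in> W" "y \<in> W" for x y t
    using that by (simp add: W_def cinner_add_right cinner_scaleR_right)
  have Wsc: "t *\<^sub>R y \<in> W" if "y \<in> W" for y t
    using that by (simp add: W_def cinner_scaleR_right)
  have WA: "A *v x \<in> W" if "x \<in> W" for x
    using that by (simp add: W_def Herm_inner(1)[OF A, symmetric] eig cinner_scale_left)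
  have finJ: "finite J" by simp
  \<comment> \<open>Real orthogonality to both \<open>e j\<close> and \<open>\<i> *s e j\<close> is
    complex orthogonality to \<open>e j\<close>. These are at most \<open>2 * card J\<close> vectors
    in a space of real dimension \<open>2 * CARD('d)\<close>.\<close>
  define T where "T = e ` J \<union> (\<lambda>j. \<i> *s e j) ` J"
  have "card T \<le> card (e ` J) + card ((\<lambda>j. \<i> *s e j) ` J)" unfolding T_def by (rule card_Un_le)
  also have "\<dots> \<le> card J + card J" by (intro add_mono card_image_le finJ)
  also have "\<dots> < DIM(complex ^ 'd)" using J by simp
  finally have "dim T < DIM(complex ^ 'd)" using dim_le_card'[of T] finJ by (simp add: T_def)
  then obtain x0 where x0: "x0 \<noteq> 0" "\<And>y. y \<in> span T \<Longrightarrow> orthogonal x0 y"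
    using orthogonal_to_subspace_exists by blast
  have "x0 \<in> W"
    unfolding W_def
  proof (safe)
    fix j assume j: "j \<in> J"
    have "e j \<in> span T" "\<i> *s e j \<in> span T" using j by (auto simp: T_def intro: span_base)
    then have "e j \<bullet> x0 = 0" "(\<i> *s e j) \<bullet> x0 = 0"
      using x0(2) by (metis orthogonal_def inner_commute)+
    then have "Re (cinner (e j) x0) = 0" "Re (cinner (\<i> *s e j) x0) = 0" by (simp_all only: Re_cinner)
    then show "cinner (e j) x0 = 0" by (simp add: cinner_scale_left complex_eq_iff)
  qed
  define S where "S = W \<inter> sphere 0 1"
  have cc: "continuous_on UNIV (\<lambda>x. cinner (e j) x)" for j
    unfolding cinner_def by (intro continuous_intros)
  have "closed (\<Inter>j\<in>J. {x. cinner (e j) x = 0})"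
    by (intro closed_INT ballI closed_Collect_eq cc continuous_on_const)
  moreover have "W = (\<Inter>j\<in>J. {x. cinner (e j) x = 0})" by (auto simp: W_def)
  ultimately have "closed W" by simp
  then have Sc: "compact S" unfolding S_def using compact_sphere by (simp add: closed_Int_compact)
  have "(1 / norm x0) *\<^sub>R x0 \<in> S" using x0(1) Wsc[OF \<open>x0 \<in> W\<close>] by (simp add: S_def)
  then have Sne: "S \<noteq> {}" by blast
  define f where "f = (\<lambda>x. x \<bullet> (A *v x))"
  have lin: "linear ((*v) A)" by (rule linear_matrix_vector_mult)
  have "continuous_on S f"
    unfolding f_def by (intro continuous_intros linear_continuous_on linear_conv_bounded_linear[THEN iffD1] lin)
  then obtain x where x: "x \<in> S" "\<And>y. y \<in> S \<Longrightarrow> f y \<le> f x"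
    using continuous_attains_sup[OF Sc Sne] by blast
  \<comment> \<open>Maximizers of the Rayleigh quotient on an invariant subspace are eigenvectors.\<close>
  define \<mu> where "\<mu> = f x"
  have xW: "x \<in> W" and nx: "norm x = 1" using x(1) by (auto simp: S_def)
  have fsc: "f (t *\<^sub>R z) = t\<^sup>2 * f z" for t z
    by (simp add: f_def linear_scale[OF lin] power2_eq_square)
  have le: "f z \<le> \<mu> * (z \<bullet> z)" if z: "z \<in> W" for z
  proof (cases "z = 0")
    case True
    then show ?thesis by (simp add: f_def)
  next
    case False
    then have "(1 / norm z) *\<^sub>R z \<in> S" using Wsc[OF z] by (simp add: S_def)
    from x(2)[OF this] have "(1 / norm z)\<^sup>2 * f z \<le> \<mu>" by (simp only: fsc \<mu>_def)
    then have "f z \<le> \<mu> * (norm z)\<^sup>2" using False by (simp add: power_divide pos_divide_le_eq)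
    then show ?thesis by (simp add: power2_norm_eq_inner)
  qed
  define r where "r = A *v x - \<mu> *\<^sub>R x"
  have rW: "r \<in> W" unfolding r_def using Wlin[OF WA[OF xW] xW, of "- \<mu>"] by simp
  \<comment> \<open>The maximizer is varied in the direction of its own residual \<open>r\<close>,
    so the vanishing first-order coefficient is a multiple of \<open>r \<bullet> r\<close>.\<close>
  have "2 * (r \<bullet> (\<mu> *\<^sub>R x - A *v x)) = 0"
  proof (rule quadratic_nonneg_linear_zero)
    fix t :: real
    have "f (x + t *\<^sub>R r) \<le> \<mu> * ((x + t *\<^sub>R r) \<bullet> (x + t *\<^sub>R r))" by (rule le[OF Wlin[OF xW rW]])
    moreover have "f (x + t *\<^sub>R r) = f x + 2 * t * (r \<bullet> (A *v x)) + t\<^sup>2 * f r"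
    proof -
      have "x \<bullet> (A *v r) = r \<bullet> (A *v x)" using Herm_inner(2)[OF A, of x r] by (simp add: inner_commute)
      then show ?thesis
        by (simp add: f_def linear_add[OF lin] linear_scale[OF lin] inner_add_left inner_add_right power2_eq_square algebra_simps)
    qed
    moreover have "(x + t *\<^sub>R r) \<bullet> (x + t *\<^sub>R r) = 1 + 2 * t * (r \<bullet> x) + t\<^sup>2 * (r \<bullet> r)"
    proof -
      have "x \<bullet> x = 1" using nx by (simp add: norm_eq_1)
      then show ?thesis
        by (simp add: inner_add_left inner_add_right inner_commute power2_eq_square algebra_simps)
    qed
    ultimately have "f x + 2 * t * (r \<bullet> (A *v x)) + t\<^sup>2 * f r \<le> \<mu> * (1 + 2 * t * (r \<bullet> x) + t\<^sup>2 * (r \<bullet> r))"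
      by simp
    then show "0 \<le> t * (2 * (r \<bullet> (\<mu> *\<^sub>R x - A *v x))) + t\<^sup>2 * (\<mu> * (r \<bullet> r) - f r)"
      by (simp add: \<mu>_def[symmetric] inner_diff_right algebra_simps)
  qed
  then have "r \<bullet> r = 0" by (simp add: r_def inner_diff_right)
  then have "r = 0" by simp
  then have Ax: "A *v x = of_real \<mu> *s x"
    by (simp add: r_def vec_eq_iff) (simp add: scaleR_conv_of_real)
  show ?thesis by (rule that[OF nx _ Ax]) (use xW in \<open>simp add: W_def\<close>)
qed

text \<open>Eigenvectors are added one at a time; indices outside \<open>J\<close> carry arbitrary
  vectors until they are filled.\<close>

lemma spectral_theorem:
  fixes A :: "complex ^ 'd ^ 'd"
  assumes A: "A \<in> Herm"
  obtains e lam where "orthonormal_basis e" "\<And>l. A *v e l = of_real (lam l) *s e l"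
proof -
  have "\<exists>(J :: 'd set) e lam. card J = n \<and> (\<forall>l\<in>J. \<forall>m\<in>J. cinner (e l) (e m) = (if l = m then 1 else 0)) \<and>
      (\<forall>l\<in>J. A *v e l = of_real (lam l) *s e l)" if "n \<le> CARD('d)" for n
    using that
  proof (induction n)
    case 0
    show ?case by (intro exI[of _ "{}"]) simp
  next
    case (Suc n)
    have "n \<le> CARD('d)" using Suc.prems by simp
    from Suc.IH[OF this] obtain J :: "'d set" and e lam where "card J = n \<and>
      (\<forall>l\<in>J. \<forall>m\<in>J. cinner (e l) (e m) = (if l = m then 1 else 0)) \<and>
      (\<forall>l\<in>J. A *v e l = of_real (lam l) *s e l)"
      by blast
    then have J: "card J = n"
      "\<And>l m. l \<in> J \<Longrightarrow> m \<in> J \<Longrightarrow> cinner (e l) (e m) = (if l = m then 1 else 0)"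
      "\<And>l. l \<in> J \<Longrightarrow> A *v e l = of_real (lam l) *s e l"
      by blast+
    have lt: "card J < CARD('d)" using Suc.prems J(1) by simp
    then obtain i where i: "i \<notin> J" by (metis UNIV_eq_I less_irrefl)
    obtain x \<mu> where x: "norm x = 1" "\<And>j. j \<in> J \<Longrightarrow> cinner (e j) x = 0" "A *v x = of_real \<mu> *s x"
      using Herm_eigenvector_in_complement[where e = e and lam = lam, OF A lt J(3)] by blast
    have xx: "cinner x x = 1" using cinner_self[of x] x(1) by simp
    have xj: "cinner x (e j) = 0" if "j \<in> J" for j using x(2)[OF that] cinner_commute[of "e j" x] by simp
    show ?case
    proof (intro exI[of _ "insert i J"] exI[of _ "e(i := x)"] exI[of _ "lam(i := \<mu>)"] conjI ballI)
      show "card (insert i J) = Suc n" using i J(1) by simp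
      show "cinner ((e(i := x)) l) ((e(i := x)) m) = (if l = m then 1 else 0)" if "l \<in> insert i J" "m \<in> insert i J" for l m
        using that i J(2) xx xj x(2) by auto
      show "A *v (e(i := x)) l = of_real ((lam(i := \<mu>)) l) *s (e(i := x)) l" if "l \<in> insert i J" for l
        using that i J(3) x(3) by auto
    qed
  qed
  from this[OF order_refl] obtain J :: "'d set" and e lam where "card J = CARD('d) \<and>
    (\<forall>l\<in>J. \<forall>m\<in>J. cinner (e l) (e m) = (if l = m then 1 else 0)) \<and>
    (\<forall>l\<in>J. A *v e l = of_real (lam l) *s e l)"
    by blast
  then have J: "card J = CARD('d)"
    "\<And>l m. l \<in> J \<Longrightarrow> m \<in> J \<Longrightarrow> cinner (e l) (e m) = (if l = m then 1 else 0)"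
    "\<And>l. l \<in> J \<Longrightarrow> A *v e l = of_real (lam l) *s e l"
    by blast+
  have "J = UNIV" using J(1) by (intro card_subset_eq) auto
  then show ?thesis using that[of e lam] J(2,3) by (simp add: orthonormal_basis_def)
qed

section \<open>Eigenvalues with multiplicity from a diagonalization\<close>

lemma const_poly_sum: "(\<Sum>i\<in>I. [:f i:]) = [:\<Sum>i\<in>I. f i:]"
  by (induction I rule: infinite_finite_induct) auto

lemma sum_singleton_mset: "finite I \<Longrightarrow> (\<Sum>i\<in>I. {#f i#}) = image_mset f (mset_set I)"
  by (induction I rule: finite_induct) auto

text \<open>The diagonalization is carried out over the polynomial ring:
  \<open>X ** K P = K P ** D\<close> for the characteristic matrix \<open>X\<close> and a diagonal
  \<open>D\<close>. The determinant of \<open>K P\<close> is nonzero and cancels, which identifies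
  multiplicities of roots with numbers of eigenvectors.\<close>

lemma real_eigenvalues_eq:
  fixes A :: "complex ^ 'd ^ 'd"
  assumes e: "orthonormal_basis e" and eig: "\<And>l. A *v e l = of_real (lam l) *s e l"
  shows "real_eigenvalues A = image_mset lam (mset_set UNIV)"
proof -
  \<comment> \<open>Embeds complex matrices as matrices of constant polynomials.\<close>
  define K :: "complex ^ 'd ^ 'd \<Rightarrow> complex poly ^ 'd ^ 'd" where "K = (\<lambda>B. \<chi> i j. [:B $ i $ j:])"
  define P :: "complex ^ 'd ^ 'd" where "P = (\<chi> i l. e l $ i)"
  define X :: "complex poly ^ 'd ^ 'd" where "X = (\<chi> i j. (if i = j then [:0, 1:] else 0) - [:A $ i $ j:])"
  define D :: "complex poly ^ 'd ^ 'd" where "D = (\<chi> l m. if l = m then [:- of_real (lam l), 1:] else 0)"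
  have "conj_transpose P ** P = mat 1"
    using e by (simp add: P_def conj_transpose_def matrix_matrix_mult_def mat_def vec_eq_iff orthonormal_basis_def cinner_def)
  then have "K (conj_transpose P ** P) = mat 1"
    by (simp add: K_def mat_def vec_eq_iff one_pCons)
  moreover have "K (conj_transpose P ** P) = K (conj_transpose P) ** K P"
    by (simp add: K_def matrix_matrix_mult_def vec_eq_iff const_poly_sum mult.commute)
  ultimately have "det (K (conj_transpose P)) * det (K P) = 1"
    by (metis det_I det_mul)
  then have detP: "det (K P) \<noteq> 0" by auto
  have "X ** K P = K P ** D"
  proof -
    have "(X ** K P) $ i $ m = (K P ** D) $ i $ m" for i m
    proof -
      have "(X ** K P) $ i $ m = (\<Sum>j\<in>UNIV. (if i = j then [:0, 1:] * [:P $ j $ m:] else 0)) - (\<Sum>j\<in>UNIV. [:A $ i $ j:] * [:P $ j $ m:])"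
        unfolding sum_subtractf[symmetric]
        by (simp add: X_def K_def matrix_matrix_mult_def) (intro sum.cong refl, simp add: algebra_simps)
      also have "(\<Sum>j\<in>UNIV. (if i = j then [:0, 1:] * [:P $ j $ m:] else 0)) = [:0, 1:] * [:P $ i $ m:]"
        by simp
      also have "(\<Sum>j\<in>UNIV. [:A $ i $ j:] * [:P $ j $ m:]) = [:(A *v e m) $ i:]"
        by (simp add: const_poly_sum matrix_vector_mult_def P_def mult.commute)
      also have "(A *v e m) $ i = of_real (lam m) * P $ i $ m" by (simp add: eig P_def)
      also have "[:0, 1:] * [:P $ i $ m:] - [:of_real (lam m) * P $ i $ m:] = [:P $ i $ m:] * [:- of_real (lam m), 1:]"
        by (simp add: mult.commute)
      also have "\<dots> = (\<Sum>l\<in>UNIV. if l = m then [:P $ i $ l:] * [:- of_real (lam l), 1:] else 0)"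
        by simp
      also have "\<dots> = (K P ** D) $ i $ m"
        unfolding K_def D_def matrix_matrix_mult_def
        by (simp only: vec_lambda_beta) (intro sum.cong refl, simp)
      finally show ?thesis .
    qed
    then show ?thesis by (simp add: vec_eq_iff)
  qed
  then have "det X * det (K P) = det (K P) * det D" by (metis det_mul)
  then have "det X = det D" using detP by (simp add: mult.commute)
  also have "det D = (\<Prod>l\<in>UNIV. D $ l $ l)" by (rule det_diagonal) (simp add: D_def)
  also have "\<dots> = (\<Prod>l\<in>UNIV. [:- of_real (lam l), 1:])" by (simp add: D_def)
  finally have "charpoly A = (\<Prod>l\<in>UNIV. [:- of_real (lam l), 1:])" by (simp add: charpoly_def X_def)
  then have "proots (charpoly A) = (\<Sum>l\<in>UNIV. proots [:- of_real (lam l), 1 :: complex:])"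
    by (simp add: proots_prod)
  also have "\<dots> = (\<Sum>l\<in>UNIV. {#of_real (lam l)#})" by simp
  also have "\<dots> = image_mset (\<lambda>l. of_real (lam l)) (mset_set UNIV)" by (rule sum_singleton_mset) simp
  finally show ?thesis by (simp add: real_eigenvalues_def multiset.map_comp o_def)
qed

section \<open>Sums of the largest elements of a multiset\<close>

text \<open>Defined on multisets so that eigenvalues and singular values share the combinatorics.
  Its value at \<open>k = 0\<close> is 0, so the largest element is a difference of consecutive sums
  as well.\<close>

definition top_sum :: "nat \<Rightarrow> real multiset \<Rightarrow> real" where
  "top_sum k N = sum_list (take k (rev (sorted_list_of_multiset N)))"

lemma top_sum_Suc:
  assumes "k < size N"
  shows "rev (sorted_list_of_multiset N) ! k = top_sum (Suc k) N - top_sum k N"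
proof -
  have "length (sorted_list_of_multiset N) = size N"
    by (metis mset_sorted_list_of_multiset size_mset)
  then show ?thesis using assms by (simp add: top_sum_def take_Suc_conv_app_nth)
qed

lemma sorted_enumeration:
  fixes s :: "'d::finite \<Rightarrow> real"
  obtains xs where "distinct xs" "set xs = UNIV" "sorted_wrt (\<ge>) (map s xs)"
    "map s xs = rev (sorted_list_of_multiset (image_mset s (mset_set UNIV)))"
proof -
  obtain ys :: "'d list" where ys: "distinct ys" "set ys = UNIV"
    using finite_distinct_list[of "UNIV :: 'd set"] by auto
  define zs where "zs = sort_key s ys"
  have zs: "distinct zs" "set zs = UNIV" "sorted (map s zs)" using ys by (auto simp: zs_def)
  have "mset zs = mset_set UNIV" using zs by (metis mset_set_set)
  then have eq: "image_mset s (mset_set UNIV) = mset (map s zs)" by simp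
  have sl: "sorted_list_of_multiset (image_mset s (mset_set UNIV)) = map s zs"
    unfolding eq sorted_list_of_multiset_mset by (rule sorted_sort_id[OF zs(3)])
  show ?thesis
  proof (rule that[of "rev zs"])
    show "distinct (rev zs)" "set (rev zs) = UNIV" using zs by simp_all
    show "sorted_wrt (\<ge>) (map s (rev zs))"
      using zs(3) unfolding rev_map[symmetric] sorted_wrt_rev by simp
    show "map s (rev zs) = rev (sorted_list_of_multiset (image_mset s (mset_set UNIV)))"
      unfolding sl rev_map ..
  qed
qed

text \<open>A fractional selection \<open>c\<close> cannot beat the \<open>k\<close> largest values.
  Its total must be exactly \<open>k\<close> if values may be negative, as for eigenvalues; a total
  of at most \<open>k\<close> is enough for nonnegative values, as for singular values.\<close>

lemma top_sum_attained_and_max: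
  fixes s :: "'d::finite \<Rightarrow> real"
  assumes k: "k \<le> CARD('d)"
  obtains J where "card J = k" "top_sum k (image_mset s (mset_set UNIV)) = (\<Sum>l\<in>J. s l)"
    "\<And>c :: 'd \<Rightarrow> real. (\<And>l. 0 \<le> c l) \<Longrightarrow> (\<And>l. c l \<le> 1) \<Longrightarrow> (\<Sum>l\<in>UNIV. c l) = real k \<or> (\<Sum>l\<in>UNIV. c l) \<le> real k \<and> (\<forall>l. s l \<ge> 0) \<Longrightarrow>
       (\<Sum>l\<in>UNIV. c l * s l) \<le> top_sum k (image_mset s (mset_set UNIV))"
proof -
  obtain xs :: "'d list" where xs: "distinct xs" "set xs = UNIV" "sorted_wrt (\<ge>) (map s xs)"
    "map s xs = rev (sorted_list_of_multiset (image_mset s (mset_set UNIV)))"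
    by (rule sorted_enumeration)
  have len: "length xs = CARD('d)" using xs(1,2) distinct_card by metis
  define J where "J = set (take k xs)"
  have cJ: "card J = k" using xs(1) k len by (simp add: J_def distinct_card)
  have ts: "top_sum k (image_mset s (mset_set UNIV)) = (\<Sum>l\<in>J. s l)"
    unfolding top_sum_def xs(4)[symmetric] J_def take_map using xs(1) by (simp add: sum_list_distinct_conv_sum_set)
  have max: "(\<Sum>l\<in>UNIV. c l * s l) \<le> (\<Sum>l\<in>J. s l)"
    if c: "\<And>l. 0 \<le> c l" "\<And>l. c l \<le> 1" and sc: "(\<Sum>l\<in>UNIV. c l) = real k \<or> (\<Sum>l\<in>UNIV. c l) \<le> real k \<and> (\<forall>l. s l \<ge> 0)" for c :: "'d \<Rightarrow> real"
  proof (cases "k = 0")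
    case True
    then have "(\<Sum>l\<in>UNIV. c l) = 0" using sc sum_nonneg[of UNIV c] c(1) by auto
    then have "c l = 0" for l using c(1) by (subst (asm) sum_nonneg_eq_0_iff) auto
    then show ?thesis using True cJ by simp
  next
    case False
    \<comment> \<open>The \<open>k\<close>-th largest value, at list position \<open>k - 1\<close>,
      as a threshold: inside \<open>J\<close> the weights fall short of 1 while \<open>s\<close> is
      at least \<open>\<theta>\<close>; outside, they exceed 0 while \<open>s\<close> is at most
      \<open>\<theta>\<close>. Every product is therefore nonpositive.\<close>
    define \<theta> where "\<theta> = s (xs ! (k - 1))"
    have mono: "s (xs ! j) \<le> s (xs ! i)" if "i \<le> j" "j < length xs" for i j
    proof (cases "i = j")
      case False
      then show ?thesis using sorted_wrt_nth_less[OF xs(3), of i j] that by simp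
    qed simp
    have inJ: "s l \<ge> \<theta>" if l: "l \<in> J" for l
    proof -
      obtain i where "i < k" "i < length xs" "l = xs ! i"
        using l by (auto simp: J_def in_set_conv_nth)
      then show ?thesis using mono[of i "k - 1"] False k len by (simp add: \<theta>_def)
    qed
    have outJ: "s l \<le> \<theta>" if l: "l \<notin> J" for l
    proof -
      obtain i where i: "i < length xs" "l = xs ! i" using xs(2) by (metis UNIV_I in_set_conv_nth)
      have "\<not> i < k"
      proof
        assume "i < k"
        then have "take k xs ! i \<in> set (take k xs)" using i by (intro nth_mem) simp
        then show False using l i \<open>i < k\<close> by (simp add: J_def)
      qed
      then show ?thesis using mono[of "k - 1" i] i by (simp add: \<theta>_def)
    qed
    let ?i = "\<lambda>l. if l \<in> J then 1 else 0 :: real"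
    have neg: "(\<Sum>l\<in>UNIV. (c l - ?i l) * (s l - \<theta>)) \<le> 0"
    proof (rule sum_nonpos)
      fix l
      show "(c l - ?i l) * (s l - \<theta>) \<le> 0"
        using inJ[of l] outJ[of l] c[of l] by (cases "l \<in> J") (auto intro: mult_nonpos_nonneg mult_nonneg_nonpos)
    qed
    have split: "(\<Sum>l\<in>UNIV. (c l - ?i l) * (s l - \<theta>)) = (\<Sum>l\<in>UNIV. c l * s l) - (\<Sum>l\<in>UNIV. ?i l * s l)
        - ((\<Sum>l\<in>UNIV. c l) - (\<Sum>l\<in>UNIV. ?i l)) * \<theta>"
      by (simp only: sum_subtractf[symmetric] sum_distrib_right) (intro sum.cong refl, simp add: algebra_simps)
    have iJ: "(\<Sum>l\<in>UNIV. ?i l * s l) = (\<Sum>l\<in>J. s l)"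
      by (subst sum.mono_neutral_right[of UNIV J]) auto
    have ik: "(\<Sum>l\<in>UNIV. ?i l) = real k" using cJ by (subst sum.mono_neutral_right[of UNIV J]) auto
    have "((\<Sum>l\<in>UNIV. c l) - real k) * \<theta> \<le> 0"
      using sc by (auto simp: \<theta>_def intro: mult_nonpos_nonneg)
    then show ?thesis using neg unfolding split iJ ik by linarith
  qed
  show ?thesis
    by (rule that[OF cJ ts]) (use max ts in simp)
qed

section \<open>Convexity of Ky Fan sums\<close>

text \<open>An attained supremum of linear functionals is encoded by a supporting functional at each
  point. The one at a convex combination gives convexity, the one at \<open>x\<close> gives one half
  of the Lipschitz estimate.\<close>

lemma convex_lipschitz_if_support:
  fixes F :: "'v::euclidean_space \<Rightarrow> real"
  assumes "\<And>A. \<exists>l. linear l \<and> F A = l A \<and> (\<forall>B. l B \<le> F B) \<and> (\<forall>B. \<bar>l B\<bar> \<le> L * norm B)"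
  shows "convex_lipschitz F L"
proof
  show "convex_on UNIV F"
  proof (rule convex_onI)
    fix t :: real and x y assume t: "0 < t" "t < 1"
    obtain l where l: "linear l" "F ((1 - t) *\<^sub>R x + t *\<^sub>R y) = l ((1 - t) *\<^sub>R x + t *\<^sub>R y)" "\<And>B. l B \<le> F B"
      using assms by metis
    have "F ((1 - t) *\<^sub>R x + t *\<^sub>R y) = (1 - t) * l x + t * l y"
      unfolding l(2) by (simp add: linear_add[OF l(1)] linear_scale[OF l(1)])
    also have "\<dots> \<le> (1 - t) * F x + t * F y" using t l(3) by (intro add_mono mult_left_mono) auto
    finally show "F ((1 - t) *\<^sub>R x + t *\<^sub>R y) \<le> (1 - t) * F x + t * F y" .
  qed simp
  have le: "F x - F y \<le> L * norm (x - y)" for x y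
  proof -
    obtain l where l: "linear l" "F x = l x" "\<And>B. l B \<le> F B" "\<And>B. \<bar>l B\<bar> \<le> L * norm B"
      using assms by metis
    have "F x - F y \<le> l x - l y" using l(2) l(3)[of y] by simp
    also have "\<dots> = l (x - y)" by (simp add: linear_diff[OF l(1)])
    also have "\<dots> \<le> L * norm (x - y)" using l(4)[of "x - y"] by simp
    finally show ?thesis .
  qed
  show "\<bar>F x - F y\<bar> \<le> L * norm (x - y)" for x y
    using le[of x y] le[of y x] by (simp add: norm_minus_commute abs_le_iff)
qed

lemma linear_bilinear_form: "linear (\<lambda>B :: complex ^ 'd ^ 'D. x \<bullet> (B *v y))"
proof (rule linearI)
  fix B C :: "complex ^ 'd ^ 'D" and r :: real
  show "x \<bullet> ((B + C) *v y) = x \<bullet> (B *v y) + x \<bullet> (C *v y)"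
    by (simp add: matrix_vector_mult_add_rdistrib inner_add_right)
  have "(r *\<^sub>R B) *v y = r *\<^sub>R (B *v y)"
    by (simp add: matrix_vector_mult_def vec_eq_iff scaleR_sum_right)
  then show "x \<bullet> ((r *\<^sub>R B) *v y) = r *\<^sub>R (x \<bullet> (B *v y))" by simp
qed

lemma sum_bilinear_bound:
  fixes B :: "complex ^ 'd ^ 'D"
  assumes "\<And>l. norm (x l) \<le> 1" "\<And>l. norm (y l) \<le> 1"
  shows "\<bar>\<Sum>l\<in>J. x l \<bullet> (B *v y l)\<bar> \<le> real (card J) * norm B"
proof -
  have "\<bar>x l \<bullet> (B *v y l)\<bar> \<le> norm B" for l
  proof -
    have "\<bar>x l \<bullet> (B *v y l)\<bar> \<le> norm (x l) * norm (B *v y l)" by (rule Cauchy_Schwarz_ineq2)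
    also have "\<dots> \<le> 1 * (norm B * 1)"
      using assms
      by (intro mult_mono order_trans[OF norm_matrix_vector_mult_le] mult_left_mono) auto
    finally show ?thesis by simp
  qed
  then show ?thesis
    by (intro order_trans[OF sum_abs]) (use sum_bounded_above[of J "\<lambda>l. \<bar>x l \<bullet> (B *v y l)\<bar>" "norm B"] in auto)
qed

text \<open>Extends functions of Hermitian matrices to all matrices.\<close>

definition herm_part :: "complex ^ 'd ^ 'd \<Rightarrow> complex ^ 'd ^ 'd" where
  "herm_part A = (1 / 2) *\<^sub>R (A + conj_transpose A)"

lemma herm_part_Herm: "herm_part A \<in> Herm"
  by (simp add: herm_part_def Herm_def conj_transpose_def vec_eq_iff add.commute)

lemma herm_part_eq: "A \<in> Herm \<Longrightarrow> herm_part A = A"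
  by (simp add: herm_part_def Herm_def flip: scaleR_2)

lemma herm_part_form: "x \<bullet> (herm_part A *v x) = x \<bullet> (A *v x)"
proof -
  have "x \<bullet> (conj_transpose A *v x) = x \<bullet> (A *v x)"
    using cinner_adjoint[of x "conj_transpose A" x]
    by (metis Re_cinner conj_transpose_involutive inner_commute)
  then show ?thesis
    unfolding herm_part_def linear_scale[OF linear_bilinear_form] linear_add[OF linear_bilinear_form] by simp
qed

lemma Herm_form_eigen:
  fixes A :: "complex ^ 'd ^ 'd"
  assumes e: "orthonormal_basis e" and eig: "\<And>l. A *v e l = of_real (lam l) *s e l"
  shows "x \<bullet> (A *v x) = (\<Sum>m\<in>UNIV. (cmod (cinner (e m) x))\<^sup>2 * lam m)"
proof -
  have "A *v x = (\<Sum>m\<in>UNIV. cinner (e m) x *s (A *v e m))"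
    by (subst orthonormal_basis_expansion[OF e, of x])
      (simp add: linear_sum[OF linear_matrix_vector_mult] vector_scalar_commute)
  then have "cinner x (A *v x) = (\<Sum>m\<in>UNIV. cinner (e m) x * (of_real (lam m) * cinner x (e m)))"
    by (simp add: cinner_sum_right cinner_scale_right eig mult.assoc)
  also have "\<dots> = (\<Sum>m\<in>UNIV. of_real ((cmod (cinner (e m) x))\<^sup>2 * lam m))"
    by (intro sum.cong refl) (simp only: of_real_mult complex_norm_square cinner_commute[of x] mult_ac)
  finally show ?thesis unfolding Re_cinner[symmetric] by simp
qed

text \<open>The supporting functional sums the quadratic form over eigenvectors of
  \<open>herm_part A\<close> for its \<open>k\<close> largest eigenvalues. On \<open>B\<close> it
  becomes a weighted sum of the eigenvalues of \<open>herm_part B\<close>; Parseval in the two bases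
  gives weights at most 1 with total \<open>k\<close>. The Lipschitz constant \<open>k\<close>
  counts quadratic forms at unit vectors.\<close>

lemma convex_lipschitz_top_eigenvalues:
  assumes k: "k \<le> CARD('d)"
  shows "convex_lipschitz (\<lambda>A :: complex ^ 'd ^ 'd. top_sum k (real_eigenvalues (herm_part A))) (real k)"
proof (rule convex_lipschitz_if_support)
  fix A :: "complex ^ 'd ^ 'd"
  obtain e lam where e: "orthonormal_basis e" and eig: "\<And>l. herm_part A *v e l = of_real (lam l) *s e l"
    using spectral_theorem[OF herm_part_Herm[of A]] by blast
  obtain J where J: "card J = k" "top_sum k (image_mset lam (mset_set UNIV)) = (\<Sum>l\<in>J. lam l)"
    using top_sum_attained_and_max[OF k, of lam] by metis
  define l where "l = (\<lambda>B :: complex ^ 'd ^ 'd. \<Sum>j\<in>J. e j \<bullet> (B *v e j))"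
  have "linear l" unfolding l_def by (intro linear_compose_sum ballI linear_bilinear_form)
  moreover have "top_sum k (real_eigenvalues (herm_part A)) = l A"
  proof -
    have "e j \<bullet> (A *v e j) = lam j" for j
    proof -
      have "e j \<bullet> (A *v e j) = e j \<bullet> (herm_part A *v e j)" by (rule herm_part_form[symmetric])
      also have "\<dots> = Re (of_real (lam j) * cinner (e j) (e j))"
        unfolding Re_cinner[symmetric] by (simp add: eig cinner_scale_right)
      also have "\<dots> = lam j" using e by (simp add: orthonormal_basis_def)
      finally show ?thesis .
    qed
    then show ?thesis by (simp add: real_eigenvalues_eq[OF e eig] J(2) l_def)
  qed
  moreover have "l B \<le> top_sum k (real_eigenvalues (herm_part B))" for B
  proof -
    obtain e' lam' where e': "orthonormal_basis e'" and eig': "\<And>l. herm_part B *v e' l = of_real (lam' l) *s e' l"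
      using spectral_theorem[OF herm_part_Herm[of B]] by blast
    define c where "c = (\<lambda>m. \<Sum>j\<in>J. (cmod (cinner (e' m) (e j)))\<^sup>2)"
    have "l B = (\<Sum>j\<in>J. e j \<bullet> (herm_part B *v e j))" by (simp add: l_def herm_part_form)
    also have "\<dots> = (\<Sum>j\<in>J. \<Sum>m\<in>UNIV. (cmod (cinner (e' m) (e j)))\<^sup>2 * lam' m)"
      by (simp add: Herm_form_eigen[OF e' eig'])
    also have "\<dots> = (\<Sum>m\<in>UNIV. c m * lam' m)"
      unfolding c_def sum_distrib_right by (rule sum.swap)
    finally have lB: "l B = (\<Sum>m\<in>UNIV. c m * lam' m)" .
    have c0: "0 \<le> c m" for m by (simp add: c_def sum_nonneg)
    have c1: "c m \<le> 1" for m
    proof -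
      have "c m \<le> (\<Sum>j\<in>UNIV. (cmod (cinner (e' m) (e j)))\<^sup>2)" unfolding c_def by (rule sum_mono2) auto
      also have "\<dots> = (\<Sum>j\<in>UNIV. (cmod (cinner (e j) (e' m)))\<^sup>2)"
        by (subst cinner_commute) simp
      also have "\<dots> = 1" unfolding parseval[OF e] by (simp add: orthonormal_basis_norm[OF e'])
      finally show ?thesis .
    qed
    have "(\<Sum>m\<in>UNIV. c m) = (\<Sum>j\<in>J. \<Sum>m\<in>UNIV. (cmod (cinner (e' m) (e j)))\<^sup>2)"
      unfolding c_def by (rule sum.swap)
    also have "\<dots> = k" unfolding parseval[OF e'] by (simp add: orthonormal_basis_norm[OF e] J(1))
    finally have "(\<Sum>m\<in>UNIV. c m) = k" .
    then have "(\<Sum>m\<in>UNIV. c m * lam' m) \<le> top_sum k (image_mset lam' (mset_set UNIV))"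
      using top_sum_attained_and_max[OF k, of lam'] c0 c1 by metis
    then show ?thesis unfolding lB real_eigenvalues_eq[OF e' eig'] .
  qed
  moreover have "\<bar>l B\<bar> \<le> real k * norm B" for B
    unfolding l_def J(1)[symmetric] by (rule sum_bilinear_bound) (simp_all add: orthonormal_basis_norm[OF e])
  ultimately show "\<exists>l. linear l \<and> top_sum k (real_eigenvalues (herm_part A)) = l A \<and>
      (\<forall>B. l B \<le> top_sum k (real_eigenvalues (herm_part B))) \<and> (\<forall>B. \<bar>l B\<bar> \<le> real k * norm B)" by blast
qed

text \<open>The left singular vector \<open>y l\<close> is \<open>0\<close> where the singular value vanishes, so the family need not
  extend to an orthonormal one.\<close>

lemma singular_value_decomposition:
  fixes A :: "complex ^ 'd ^ 'D"
  obtains e y s where "orthonormal_basis e" "\<And>l. A *v e l = s l *\<^sub>R y l" "\<And>l. 0 \<le> s l"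
    "\<And>l m. l \<noteq> m \<Longrightarrow> cinner (y l) (y m) = 0" "\<And>l. norm (y l) \<le> 1" "\<And>l. y l \<bullet> (A *v e l) = s l"
    "image_mset sqrt (real_eigenvalues (conj_transpose A ** A)) = image_mset s (mset_set UNIV)"
proof -
  have H: "conj_transpose A ** A \<in> Herm" by (simp add: Herm_def conj_transpose_mult)
  obtain e lam where e: "orthonormal_basis e" and eig: "\<And>l. (conj_transpose A ** A) *v e l = of_real (lam l) *s e l"
    using spectral_theorem[OF H] by blast
  have AA: "cinner (A *v e l) (A *v e m) = (if l = m then of_real (lam m) else 0)" for l m
  proof -
    have "cinner (A *v e l) (A *v e m) = cinner (conj_transpose (conj_transpose A) *v e l) (A *v e m)" by simp
    also have "\<dots> = cinner (e l) (conj_transpose A *v (A *v e m))" by (rule cinner_adjoint[symmetric])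
    also have "\<dots> = of_real (lam m) * cinner (e l) (e m)"
      by (simp add: matrix_vector_mul_assoc eig cinner_scale_right)
    finally show ?thesis using e by (simp add: orthonormal_basis_def)
  qed
  define s where "s = (\<lambda>l. norm (A *v e l))"
  \<comment> \<open>Since \<open>inverse 0 = 0\<close>, this is the zero vector where the singular
    value vanishes.\<close>
  define y where "y = (\<lambda>l. inverse (s l) *\<^sub>R (A *v e l))"
  have lam: "lam l = (s l)\<^sup>2" for l
    using AA[of l l] cinner_self[of "A *v e l"] by (simp add: s_def flip: of_real_power)
  have "sqrt (lam l) = s l" for l by (simp add: lam s_def)
  then have "image_mset sqrt (real_eigenvalues (conj_transpose A ** A)) = image_mset s (mset_set UNIV)"
    by (simp add: real_eigenvalues_eq[OF e eig] multiset.map_comp o_def)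
  moreover have "A *v e l = s l *\<^sub>R y l" for l
    by (cases "s l = 0") (simp_all add: y_def s_def)
  moreover have "cinner (y l) (y m) = 0" if "l \<noteq> m" for l m
    using AA[of l m] that by (simp add: y_def cinner_scaleR_left cinner_scaleR_right)
  moreover have "norm (y l) \<le> 1" for l
    by (cases "s l = 0") (simp_all add: y_def s_def)
  moreover have "y l \<bullet> (A *v e l) = s l" for l
    by (cases "s l = 0") (simp_all add: y_def s_def power2_norm_eq_inner[symmetric] power2_eq_square)
  moreover have "0 \<le> s l" for l by (simp add: s_def)
  ultimately show ?thesis using that[of e s y] e by blast
qed

lemma Re_complex_of_real_mult: "Re (of_real r * z) = r * Re z"
  by simp

text \<open>The supporting functional pairs left and right singular vectors of \<open>A\<close>. On
  \<open>B\<close> every term contains a product of one coefficient from each side; the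
  arithmetic-geometric mean splits it into squares, so that the two sides are estimated
  separately.\<close>

lemma convex_lipschitz_top_singular_values:
  assumes k: "k \<le> CARD('d)"
  shows "convex_lipschitz (\<lambda>A :: complex ^ 'd ^ 'D.
    top_sum k (image_mset sqrt (real_eigenvalues (conj_transpose A ** A)))) (real k)"
proof (rule convex_lipschitz_if_support)
  fix A :: "complex ^ 'd ^ 'D"
  obtain e y s where e: "orthonormal_basis e" and y: "\<And>l m. l \<noteq> m \<Longrightarrow> cinner (y l) (y m) = 0" "\<And>l. norm (y l) \<le> 1"
    "\<And>l. y l \<bullet> (A *v e l) = s l"
    and N: "image_mset sqrt (real_eigenvalues (conj_transpose A ** A)) = image_mset s (mset_set UNIV)"
    by (rule singular_value_decomposition[of A]) blast
  obtain J where J: "card J = k" "top_sum k (image_mset s (mset_set UNIV)) = (\<Sum>l\<in>J. s l)"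
    using top_sum_attained_and_max[OF k, of s] by metis
  define l where "l = (\<lambda>B :: complex ^ 'd ^ 'D. \<Sum>j\<in>J. y j \<bullet> (B *v e j))"
  have "linear l" unfolding l_def by (intro linear_compose_sum ballI linear_bilinear_form)
  moreover have "top_sum k (image_mset sqrt (real_eigenvalues (conj_transpose A ** A))) = l A"
    unfolding N by (simp add: J(2) l_def y(3))
  moreover have "l B \<le> top_sum k (image_mset sqrt (real_eigenvalues (conj_transpose B ** B)))" for B
  proof -
    obtain e' y' s' where e': "orthonormal_basis e'" and Be: "\<And>l. B *v e' l = s' l *\<^sub>R y' l" and s': "\<And>l. 0 \<le> s' l"
      and y': "\<And>l m. l \<noteq> m \<Longrightarrow> cinner (y' l) (y' m) = 0" "\<And>l. norm (y' l) \<le> 1"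
      and N': "image_mset sqrt (real_eigenvalues (conj_transpose B ** B)) = image_mset s' (mset_set UNIV)"
      by (rule singular_value_decomposition[of B]) blast
    define a where "a = (\<lambda>m j. (cmod (cinner (e' m) (e j)))\<^sup>2)"
    define b where "b = (\<lambda>m j. (cmod (cinner (y j) (y' m)))\<^sup>2)"
    \<comment> \<open>The mean of two systems of weights, \<open>a\<close> controlled by Parseval
      and \<open>b\<close> by Bessel. As left singular vectors may vanish, the total of
      \<open>b\<close> may be smaller than \<open>k\<close>, so the selection principle is used in
      its variant for nonnegative values.\<close>
    define c where "c = (\<lambda>m. \<Sum>j\<in>J. (a m j + b m j) / 2)"
    have term_le: "y j \<bullet> (B *v e j) \<le> (\<Sum>m\<in>UNIV. (a m j + b m j) / 2 * s' m)" for j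
    proof -
      have "B *v e j = (\<Sum>m\<in>UNIV. cinner (e' m) (e j) *s (s' m *\<^sub>R y' m))"
        by (subst orthonormal_basis_expansion[OF e', of "e j"])
          (simp add: linear_sum[OF linear_matrix_vector_mult] vector_scalar_commute Be)
      then have "cinner (y j) (B *v e j) = (\<Sum>m\<in>UNIV. of_real (s' m) * (cinner (e' m) (e j) * cinner (y j) (y' m)))"
        by (simp add: cinner_sum_right cinner_scale_right cinner_scaleR_right mult_ac)
      then have "y j \<bullet> (B *v e j) = (\<Sum>m\<in>UNIV. s' m * Re (cinner (e' m) (e j) * cinner (y j) (y' m)))"
        unfolding Re_cinner[symmetric] by (simp only: Re_sum Re_complex_of_real_mult)
      also have "\<dots> \<le> (\<Sum>m\<in>UNIV. s' m * ((a m j + b m j) / 2))"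
      proof (intro sum_mono mult_left_mono s')
        fix m
        have "Re (cinner (e' m) (e j) * cinner (y j) (y' m)) \<le> cmod (cinner (e' m) (e j)) * cmod (cinner (y j) (y' m))"
          by (metis complex_Re_le_cmod norm_mult)
        also have "\<dots> \<le> (a m j + b m j) / 2"
          using sum_squares_bound[of "cmod (cinner (e' m) (e j))" "cmod (cinner (y j) (y' m))"] by (simp add: a_def b_def)
        finally show "Re (cinner (e' m) (e j) * cinner (y j) (y' m)) \<le> (a m j + b m j) / 2" .
      qed
      finally show ?thesis by (simp only: mult.commute)
    qed
    have "l B \<le> (\<Sum>j\<in>J. \<Sum>m\<in>UNIV. (a m j + b m j) / 2 * s' m)"
      unfolding l_def by (intro sum_mono term_le)
    also have "\<dots> = (\<Sum>m\<in>UNIV. c m * s' m)"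
      unfolding c_def sum_distrib_right by (rule sum.swap)
    finally have lB: "l B \<le> (\<Sum>m\<in>UNIV. c m * s' m)" .
    have ab0: "0 \<le> a m j" "0 \<le> b m j" for m j by (simp_all add: a_def b_def)
    have c0: "0 \<le> c m" for m unfolding c_def using ab0 by (intro sum_nonneg) (simp add: add_nonneg_nonneg)
    have c1: "c m \<le> 1" for m
    proof -
      have "(\<Sum>j\<in>J. a m j) \<le> (\<Sum>j\<in>UNIV. a m j)" by (rule sum_mono2) (use ab0 in auto)
      also have "\<dots> = (\<Sum>j\<in>UNIV. (cmod (cinner (e j) (e' m)))\<^sup>2)"
        unfolding a_def by (subst cinner_commute) simp
      also have "\<dots> = 1" unfolding parseval[OF e] by (simp add: orthonormal_basis_norm[OF e'])
      finally have A1: "(\<Sum>j\<in>J. a m j) \<le> 1" .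
      have "(\<Sum>j\<in>J. b m j) \<le> (\<Sum>j\<in>UNIV. b m j)" by (rule sum_mono2) (use ab0 in auto)
      also have "\<dots> \<le> (norm (y' m))\<^sup>2" unfolding b_def by (rule bessel_partial_isometry[OF y(1,2)])
      also have "\<dots> \<le> 1" using y'(2)[of m] by (simp add: power_le_one)
      finally have B1: "(\<Sum>j\<in>J. b m j) \<le> 1" .
      have "c m = ((\<Sum>j\<in>J. a m j) + (\<Sum>j\<in>J. b m j)) / 2"
        by (simp add: c_def sum.distrib flip: sum_divide_distrib)
      then show ?thesis using A1 B1 by simp
    qed
    have "(\<Sum>m\<in>UNIV. c m) = (\<Sum>j\<in>J. \<Sum>m\<in>UNIV. (a m j + b m j) / 2)"
      unfolding c_def by (rule sum.swap)
    also have "\<dots> \<le> (\<Sum>j\<in>J. 1)"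
    proof (rule sum_mono)
      fix j
      have "(\<Sum>m\<in>UNIV. a m j) = 1" unfolding a_def parseval[OF e'] by (simp add: orthonormal_basis_norm[OF e])
      moreover have "(\<Sum>m\<in>UNIV. b m j) \<le> 1"
      proof -
        have "(\<Sum>m\<in>UNIV. b m j) = (\<Sum>m\<in>UNIV. (cmod (cinner (y' m) (y j)))\<^sup>2)"
          unfolding b_def by (subst cinner_commute) simp
        also have "\<dots> \<le> (norm (y j))\<^sup>2" by (rule bessel_partial_isometry[OF y'])
        also have "\<dots> \<le> 1" using y(2)[of j] by (simp add: power_le_one)
        finally show ?thesis .
      qed
      ultimately show "(\<Sum>m\<in>UNIV. (a m j + b m j) / 2) \<le> 1"
        by (simp add: sum.distrib flip: sum_divide_distrib)
    qed
    also have "\<dots> = k" using J(1) by simp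
    finally have "(\<Sum>m\<in>UNIV. c m) \<le> k" .
    then have "(\<Sum>m\<in>UNIV. c m * s' m) \<le> top_sum k (image_mset s' (mset_set UNIV))"
      using top_sum_attained_and_max[OF k, of s'] c0 c1 s' by metis
    then show ?thesis unfolding N' using lB by simp
  qed
  moreover have "\<bar>l B\<bar> \<le> real k * norm B" for B
    unfolding l_def J(1)[symmetric] by (rule sum_bilinear_bound) (simp_all add: orthonormal_basis_norm[OF e] y(2))
  ultimately show "\<exists>l. linear l \<and> top_sum k (image_mset sqrt (real_eigenvalues (conj_transpose A ** A))) = l A \<and>
      (\<forall>B. l B \<le> top_sum k (image_mset sqrt (real_eigenvalues (conj_transpose B ** B)))) \<and>
      (\<forall>B. \<bar>l B\<bar> \<le> real k * norm B)" by blast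
qed

section \<open>Ordered eigenvalues and singular values as differences of Ky Fan sums\<close>

text \<open>In a list of length \<open>CARD('d)\<close>, the \<open>i\<close>-th smallest entry is
  the \<open>(CARD('d) - i + 1)\<close>-th largest. On Hermitian matrices \<open>herm_part\<close>
  is the identity.\<close>

lemma eigenvalue_up_eq_top_sum_diff:
  fixes A :: "complex ^ 'd ^ 'd"
  assumes A: "A \<in> Herm" and i: "i \<in> {1..CARD('d)}"
  shows "eigenvalue_up i A = top_sum (CARD('d) - i + 1) (real_eigenvalues (herm_part A)) -
           top_sum (CARD('d) - i) (real_eigenvalues (herm_part A))"
proof -
  obtain e lam where e: "orthonormal_basis e" and eig: "\<And>l. A *v e l = of_real (lam l) *s e l"
    using spectral_theorem[OF A] by blast
  have sz: "size (real_eigenvalues A) = CARD('d)"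
    by (simp add: real_eigenvalues_eq[OF e eig])
  have len: "length (sorted_list_of_multiset (real_eigenvalues A)) = CARD('d)"
    using sz by (metis mset_sorted_list_of_multiset size_mset)
  have "eigenvalue_up i A = rev (sorted_list_of_multiset (real_eigenvalues A)) ! (CARD('d) - i)"
    using i len by (subst rev_nth) (auto simp: eigenvalue_up_def Suc_diff_Suc)
  also have "\<dots> = top_sum (Suc (CARD('d) - i)) (real_eigenvalues A) - top_sum (CARD('d) - i) (real_eigenvalues A)"
    using i sz by (intro top_sum_Suc) auto
  finally show ?thesis by (simp add: herm_part_eq[OF A])
qed

lemma singular_value_eq_top_sum_diff:
  fixes A :: "complex ^ 'd ^ 'D"
  assumes i: "i \<in> {1..CARD('d)}"
  shows "singular_value i A = top_sum i (image_mset sqrt (real_eigenvalues (conj_transpose A ** A))) -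
           top_sum (i - 1) (image_mset sqrt (real_eigenvalues (conj_transpose A ** A)))"
proof -
  \<comment> \<open>Only the number of singular values is read off the decomposition; it keeps
    position \<open>i - 1\<close> in range.\<close>
  obtain s :: "'d \<Rightarrow> real" where N: "image_mset sqrt (real_eigenvalues (conj_transpose A ** A)) = image_mset s (mset_set UNIV)"
    by (rule singular_value_decomposition[of A]) blast
  have "size (image_mset sqrt (real_eigenvalues (conj_transpose A ** A))) = CARD('d)"
    unfolding N by simp
  then show ?thesis
    using top_sum_Suc[of "i - 1" "image_mset sqrt (real_eigenvalues (conj_transpose A ** A))"] i
    by (auto simp: singular_value_def)
qed

theorem corollary1p18:
  fixes f :: "real \<Rightarrow> real" and q :: real and U :: "(real ^ 'm) set"
  assumes "CARD('d) \<le> CARD('D)"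
    and "\<exists>L. L-lipschitz_on UNIV f"
    and "1 \<le> q"
    and "open U" and "bounded U"
  shows "(\<forall>i\<in>{1..CARD('d)}.
            sobolev_well_defined U q (UNIV :: (complex ^ 'd ^ 'D) set) (UNIV :: real set)
              (\<lambda>A. f \<circ> singular_value i \<circ> A) \<and>
            sobolev_continuous U q (UNIV :: (complex ^ 'd ^ 'D) set)
              (\<lambda>A. f \<circ> singular_value i \<circ> A)) \<and>
         (\<forall>i\<in>{1..CARD('d)}.
            sobolev_well_defined U q (Herm :: (complex ^ 'd ^ 'd) set) (UNIV :: real set)
              (\<lambda>A. f \<circ> eigenvalue_up i \<circ> A) \<and>
            sobolev_continuous U q (Herm :: (complex ^ 'd ^ 'd) set)
              (\<lambda>A. f \<circ> eigenvalue_up i \<circ> A))"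
proof -
  obtain L where "L-lipschitz_on UNIV f" using assms(2) by blast
  then have f: "\<bar>f x - f y\<bar> \<le> L * \<bar>x - y\<bar>" for x y
    using lipschitz_onD[of L UNIV f x y] by (simp add: dist_real_def)
  \<comment> \<open>For \<open>i = 1\<close> the subtracted sum is \<open>top_sum 0\<close>, the
    zero function, with Lipschitz constant 0.\<close>
  have sv: "dc_sobolev (\<lambda>A :: complex ^ 'd ^ 'D. top_sum i (image_mset sqrt (real_eigenvalues (conj_transpose A ** A))))
      (\<lambda>A. top_sum (i - 1) (image_mset sqrt (real_eigenvalues (conj_transpose A ** A)))) (real i) (real (i - 1))
      U q UNIV (singular_value i) f L" if "i \<in> {1..CARD('d)}" for i
    using that assms(3-5) f singular_value_eq_top_sum_diff[OF that]
    by (intro dc_sobolev.intro dc_function.intro dc_sobolev_axioms.intro convex_lipschitz_top_singular_values) auto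
  have ev: "dc_sobolev (\<lambda>A :: complex ^ 'd ^ 'd. top_sum (CARD('d) - i + 1) (real_eigenvalues (herm_part A)))
      (\<lambda>A. top_sum (CARD('d) - i) (real_eigenvalues (herm_part A))) (real (CARD('d) - i + 1)) (real (CARD('d) - i))
      U q Herm (eigenvalue_up i) f L" if "i \<in> {1..CARD('d)}" for i
    using that assms(3-5) f eigenvalue_up_eq_top_sum_diff[OF _ that]
    by (intro dc_sobolev.intro dc_function.intro dc_sobolev_axioms.intro convex_lipschitz_top_eigenvalues) auto
  show ?thesis
    using dc_sobolev.well_defined[OF sv] dc_sobolev.continuous[OF sv]
      dc_sobolev.well_defined[OF ev] dc_sobolev.continuous[OF ev] by blast
qed

end
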